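(* Let $T>0$, let $X$ be a Banach space, $\alpha\in(0,1]$ and $p\in(1,\infty)$. Then $L^p_\alpha(0,T;X)$ is isometrically isomorphic to $L^p(0,T;X)$. Therefore, if $X$ is reflexive, then $L^p_\alpha(0,T;X)$ is also reflexive.
   Context: For $\alpha\in(0,1]$ and $p\in[1,\infty)$, $L^p_\alpha(0,T;X)$ is the space of (a.e.-equivalence classes of) Bochner measurable functions $v:[0,T]\to X$ with $\int_0^T\frac{(T-s)^{\alpha-1}}{\Gamma(\alpha)}\|v(s)\|_X^p\,ds<\infty$, with norm $\|v\|_{L^p_\alpha(0,T;X)}=\left(\int_0^T\frac{(T-s)^{\alpha-1}}{\Gamma(\alpha)}\|v(s)\|_X^p\,ds\right)^{1/p}$. $L^p(0,T;X)$ is the usual Bochner-Lebesgue space with its usual norm. *)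

theory Defs
  imports "HOL-Analysis.Analysis"
begin

text \<open>The spaces below depend on real parameters, so they cannot be types; a real normed space is
  a carrier set with explicit operations. (The zero vector is \<open>0 \<cdot> x\<close> for any
  \<open>x\<close> in the carrier.)\<close>

record 'v normed_space =
  vecs :: "'v set"
  vadd :: "'v \<Rightarrow> 'v \<Rightarrow> 'v"
  vscale :: "real \<Rightarrow> 'v \<Rightarrow> 'v"
  vnorm :: "'v \<Rightarrow> real"

definition type_space :: "'a::real_normed_vector normed_space" where
  "type_space = \<lparr>vecs = UNIV, vadd = (+), vscale = (*\<^sub>R), vnorm = norm\<rparr>"

definition isometrically_isomorphic :: "'v normed_space \<Rightarrow> 'w normed_space \<Rightarrow> bool" where
  "isometrically_isomorphic V W \<longleftrightarrow>
     (\<exists>\<Phi>. bij_betw \<Phi> (vecs V) (vecs W) \<and>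
          (\<forall>x\<in>vecs V. \<forall>y\<in>vecs V. \<Phi> (vadd V x y) = vadd W (\<Phi> x) (\<Phi> y)) \<and>
          (\<forall>c. \<forall>x\<in>vecs V. \<Phi> (vscale V c x) = vscale W c (\<Phi> x)) \<and>
          (\<forall>x\<in>vecs V. vnorm W (\<Phi> x) = vnorm V x))"

text \<open>Functionals are made extensional (undefined off the carrier) so that two of them are equal
  as HOL functions iff they agree on the carrier.\<close>

definition bounded_functionals :: "'v normed_space \<Rightarrow> ('v \<Rightarrow> real) set" where
  "bounded_functionals V =
     {f \<in> extensional (vecs V).
        (\<forall>x\<in>vecs V. \<forall>y\<in>vecs V. f (vadd V x y) = f x + f y) \<and>
        (\<forall>c. \<forall>x\<in>vecs V. f (vscale V c x) = c * f x) \<and>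
        (\<exists>K. \<forall>x\<in>vecs V. \<bar>f x\<bar> \<le> K * vnorm V x)}"

definition dual_space :: "'v normed_space \<Rightarrow> ('v \<Rightarrow> real) normed_space" where
  "dual_space V =
     \<lparr>vecs = bounded_functionals V,
      vadd = (\<lambda>f g. \<lambda>x\<in>vecs V. f x + g x),
      vscale = (\<lambda>c f. \<lambda>x\<in>vecs V. c * f x),
      vnorm = (\<lambda>f. SUP x\<in>{x \<in> vecs V. vnorm V x \<le> 1}. \<bar>f x\<bar>)\<rparr>"

definition canonical_embedding :: "'v normed_space \<Rightarrow> 'v \<Rightarrow> ('v \<Rightarrow> real) \<Rightarrow> real" where
  "canonical_embedding V x = (\<lambda>f\<in>vecs (dual_space V). f x)"

definition reflexive_space :: "'v normed_space \<Rightarrow> bool" where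
  "reflexive_space V \<longleftrightarrow>
     canonical_embedding V ` vecs V = vecs (dual_space (dual_space V))"

text \<open>Strong measurability; \<open>borel_measurable\<close> is not equivalent when the
  target space is not separable.\<close>

definition Bochner_measurable :: "'t measure \<Rightarrow> ('t \<Rightarrow> 'a::real_normed_vector) \<Rightarrow> bool" where
  "Bochner_measurable M v \<longleftrightarrow>
     (\<exists>s. (\<forall>n::nat. simple_function M (s n)) \<and> (AE t in M. (\<lambda>n. s n t) \<longlonglongrightarrow> v t))"

definition wLp_functions ::
  "'t measure \<Rightarrow> ('t \<Rightarrow> real) \<Rightarrow> real \<Rightarrow> ('t \<Rightarrow> 'a::real_normed_vector) set" where
  "wLp_functions M w p =
     {v. Bochner_measurable M v \<and> integrable M (\<lambda>t. w t * norm (v t) powr p)}"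

definition wLp_ae_eq ::
  "'t measure \<Rightarrow> ('t \<Rightarrow> real) \<Rightarrow> real \<Rightarrow> ('t \<Rightarrow> 'a::real_normed_vector) rel" where
  "wLp_ae_eq M w p =
     {(u, v). u \<in> wLp_functions M w p \<and> v \<in> wLp_functions M w p \<and> (AE t in M. u t = v t)}"

definition wLp_space ::
  "'t measure \<Rightarrow> ('t \<Rightarrow> real) \<Rightarrow> real \<Rightarrow> ('t \<Rightarrow> 'a::real_normed_vector) set normed_space" where
  "wLp_space M w p =
     \<lparr>vecs = wLp_functions M w p // wLp_ae_eq M w p,
      vadd = (\<lambda>A B. \<Union>u\<in>A. \<Union>v\<in>B. wLp_ae_eq M w p `` {\<lambda>t. u t + v t}),
      vscale = (\<lambda>c A. \<Union>v\<in>A. wLp_ae_eq M w p `` {\<lambda>t. c *\<^sub>R v t}),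
      vnorm = (\<lambda>A. the_elem ((\<lambda>v. (LINT t|M. w t * norm (v t) powr p) powr (1 / p)) ` A))\<rparr>"

text \<open>Elements are classes of total functions on the reals, but only the values on
  \<open>{0..T}\<close> matter, since the measure is restricted to that interval.\<close>

definition Lp_space :: "real \<Rightarrow> real \<Rightarrow> (real \<Rightarrow> 'a::real_normed_vector) set normed_space" where
  "Lp_space T p = wLp_space (lebesgue_on {0..T}) (\<lambda>_. 1) p"

definition Lp_alpha_space ::
  "real \<Rightarrow> real \<Rightarrow> real \<Rightarrow> (real \<Rightarrow> 'a::real_normed_vector) set normed_space" where
  "Lp_alpha_space T \<alpha> p =
     wLp_space (lebesgue_on {0..T}) (\<lambda>s. (T - s) powr (\<alpha> - 1) / Gamma \<alpha>) p"

end

theory Submission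
  imports Defs
begin

text \<open>
  Multiplication by the \<open>p\<close>-th root of the weight is the isometry, so the point is that
  \<open>L\<^sup>p(0,T;X)\<close> is reflexive if \<open>X\<close> is. This follows by applying twice (to \<open>X\<close> with exponent \<open>p\<close>
  and to \<open>X\<^sup>*\<close> with the conjugate exponent \<open>q\<close>) the representation of every bounded functional
  \<open>\<phi>\<close> on \<open>L\<^sup>p(X)\<close> as \<open>\<phi> f = \<integral> g(t) (f t) dt\<close> with \<open>g\<close> in \<open>L\<^sup>q(X\<^sup>*)\<close>.
  The averages of \<open>\<phi>\<close> over dyadic cells form an \<open>X\<^sup>*\<close>-valued martingale \<open>g\<^sub>n\<close> bounded in \<open>L\<^sup>q\<close>.
  Its values span a separable closed subspace \<open>S\<close>, which is normed by countably many \<open>x\<^sub>i\<close>; along a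
  subsequence all the scalar martingales \<open>g\<^sub>n(t) x\<^sub>i\<close> converge almost everywhere. At almost every
  \<open>t\<close> a generalized limit of \<open>g\<^sub>n(t)\<close> exists, and reflexivity puts it into \<open>S\<close>; there it is
  determined by the \<open>x\<^sub>i\<close>, hence strongly measurable by Pettis' argument. Since the Bochner integral of
  the library is restricted to second countable spaces, only scalar integrals are used.
\<close>

section \<open>Hahn--Banach\<close>

text \<open>In the representation, reflexivity enters in one way: every continuous functional on the
  dual is evaluation at a point, so a norm-closed subspace of the dual is also weak-star closed. A
  generalized limit of the densities could otherwise leave \<open>S\<close>, outside of which the
  \<open>x_i\<close> need not determine a functional. The same argument shows that integrating an
  \<open>S\<close>-valued function over a cell gives a functional in \<open>S\<close>, which takes
  the place of a vector-valued integral.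

  At a fixed \<open>t\<close> Fatou's lemma controls only the lower limit of the norms, so the
  generalized limit is taken along a set of indices that depends on \<open>t\<close>. Convergence at
  all \<open>x_i\<close> along one common subsequence makes the result independent of this set. The
  condition \<open>q > 1\<close> supplies the uniform integrability by which almost everywhere
  limits pass through integrals over cells.

  Hahn-Banach serves to norm vectors, to separate points from closed subspaces and to build
  generalized limits; a version with a sublinear bound and one prescribed value covers all
  three.\<close>

definition sublinear :: "('a::real_vector \<Rightarrow> real) \<Rightarrow> bool" where
  "sublinear q \<longleftrightarrow> (\<forall>x y. q (x + y) \<le> q x + q y) \<and> (\<forall>x. \<forall>c>0. q (c *\<^sub>R x) \<le> c * q x) \<and> q 0 = 0"

text \<open>\<open>sublinear\<close> demands only one inequality for positive scaling because this
  is what passes through infima; applying it to \<open>1 / c\<close> gives back the other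
  one.\<close>

lemma
  assumes "sublinear q"
  shows sublinear_add: "q (x + y) \<le> q x + q y"
    and sublinear_scale: "c \<ge> 0 \<Longrightarrow> q (c *\<^sub>R x) = c * q x"
    and sublinear_zero: "q 0 = 0"
    and sublinear_minus: "- q (- x) \<le> q x"
proof -
  show add: "q (x + y) \<le> q x + q y" for x y
    using assms by (auto simp: sublinear_def)
  show zero: "q 0 = 0"
    using assms by (auto simp: sublinear_def)
  have le: "q (c *\<^sub>R x) \<le> c * q x" if "c > 0" for c x
    using assms that by (auto simp: sublinear_def)
  show "q (c *\<^sub>R x) = c * q x" if "c \<ge> 0"
  proof (cases "c = 0")
    case False
    have "q x \<le> (1 / c) * q (c *\<^sub>R x)"
      using le[of "1 / c" "c *\<^sub>R x"] False that by simp
    then have "c * q x \<le> q (c *\<^sub>R x)"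
      using False that by (simp add: field_simps)
    then show ?thesis using le[of c x] False that by simp
  qed (simp add: zero)
  show "- q (- x) \<le> q x"
    using add[of x "- x"] zero by simp
qed

text \<open>The largest sublinear functional below \<open>q\<close> whose value at
  \<open>- y\<close> is at most \<open>- q y\<close>. A sublinear functional that equals all its
  descents is therefore odd.\<close>

definition sublinear_descent :: "('a::real_vector \<Rightarrow> real) \<Rightarrow> 'a \<Rightarrow> 'a \<Rightarrow> real" where
  "sublinear_descent q y z = (INF t\<in>{0..}. q (z + t *\<^sub>R y) - t * q y)"

lemma
  assumes q: "sublinear q"
  shows sublinear_sublinear_descent: "sublinear (sublinear_descent q y)"
    and sublinear_descent_le: "sublinear_descent q y z \<le> q z"
    and sublinear_descent_minus: "sublinear_descent q y (- y) \<le> - q y"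
proof -
  let ?d = "sublinear_descent q y"
  have bdd: "bdd_below ((\<lambda>t. q (z + t *\<^sub>R y) - t * q y) ` {0..})" for z
  proof (rule bdd_belowI2)
    fix t :: real assume "t \<in> {0..}"
    then show "- q (- z) \<le> q (z + t *\<^sub>R y) - t * q y"
      using sublinear_add[OF q, of "z + t *\<^sub>R y" "- z"] sublinear_scale[OF q, of t y] by simp
  qed
  have le: "?d z \<le> q (z + t *\<^sub>R y) - t * q y" if "t \<ge> 0" for z t
    unfolding sublinear_descent_def using bdd that by (intro cINF_lower) auto
  show le0: "?d z \<le> q z" for z
    using le[of 0 z] by simp
  show "?d (- y) \<le> - q y"
    using le[of 1 "- y"] by (simp add: sublinear_zero[OF q])
  have ge: "b \<le> ?d z" if "\<And>t. t \<ge> 0 \<Longrightarrow> b \<le> q (z + t *\<^sub>R y) - t * q y" for b z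
    unfolding sublinear_descent_def by (rule cINF_greatest) (use that in auto)
  show "sublinear ?d"
    unfolding sublinear_def
  proof (intro conjI allI impI)
    fix u v
    have "?d (u + v) - (q (v + s *\<^sub>R y) - s * q y) \<le> ?d u" if s: "s \<ge> 0" for s
    proof (rule ge)
      fix t :: real assume t: "t \<ge> 0"
      have "?d (u + v) \<le> q ((u + v) + (s + t) *\<^sub>R y) - (s + t) * q y"
        using s t by (intro le) auto
      also have "(u + v) + (s + t) *\<^sub>R y = (u + t *\<^sub>R y) + (v + s *\<^sub>R y)"
        by (simp add: algebra_simps)
      also have "q \<dots> \<le> q (u + t *\<^sub>R y) + q (v + s *\<^sub>R y)"
        by (rule sublinear_add[OF q])
      finally show "?d (u + v) - (q (v + s *\<^sub>R y) - s * q y) \<le> q (u + t *\<^sub>R y) - t * q y"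
        by (simp add: algebra_simps)
    qed
    then have "?d (u + v) - ?d u \<le> ?d v"
      by (intro ge) (simp add: algebra_simps)
    then show "?d (u + v) \<le> ?d u + ?d v"
      by simp
  next
    fix x and c :: real assume c: "c > 0"
    have "?d (c *\<^sub>R x) / c \<le> ?d x"
    proof (rule ge)
      fix t :: real assume t: "t \<ge> 0"
      have "?d (c *\<^sub>R x) \<le> q (c *\<^sub>R x + (c * t) *\<^sub>R y) - (c * t) * q y"
        using c t by (intro le) auto
      also have "c *\<^sub>R x + (c * t) *\<^sub>R y = c *\<^sub>R (x + t *\<^sub>R y)"
        by (simp add: algebra_simps)
      finally show "?d (c *\<^sub>R x) / c \<le> q (x + t *\<^sub>R y) - t * q y"
        using c sublinear_scale[OF q, of c "x + t *\<^sub>R y"] by (simp add: field_simps)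
    qed
    then show "?d (c *\<^sub>R x) \<le> c * ?d x"
      using c by (simp add: field_simps)
  next
    have "0 \<le> ?d 0"
      by (rule ge) (simp add: sublinear_scale[OF q])
    then show "?d 0 = 0"
      using le0[of 0] sublinear_zero[OF q] by simp
  qed
qed

text \<open>Zorn's lemma for the reversed pointwise order. The infimum of a chain is subadditive
  because any two members have a common lower bound in the chain, and it is finite because a
  sublinear functional below \<open>p\<close> is at least \<open>- p (- z)\<close> at
  \<open>z\<close>.\<close>

lemma minimal_sublinear_below:
  assumes p: "sublinear p"
  shows "\<exists>m. sublinear m \<and> m \<le> p \<and> (\<forall>q. sublinear q \<longrightarrow> q \<le> m \<longrightarrow> q = m)"
proof -
  define A where "A = {q. sublinear q \<and> q \<le> p}"
  have "\<exists>m\<in>A. \<forall>a\<in>A. a \<le> m \<longrightarrow> a = m"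
  proof (rule predicate_Zorn)
    show "partial_order_on A (relation_of (\<lambda>a b. b \<le> a) A)"
      by (rule partial_order_on_relation_ofI) auto
  next
    fix C assume C: "C \<in> Chains (relation_of (\<lambda>a b. b \<le> a) A)"
    then have CA: "C \<subseteq> A" and tot: "\<And>a b. a \<in> C \<Longrightarrow> b \<in> C \<Longrightarrow> a \<le> b \<or> b \<le> a"
      unfolding Chains_def relation_of_def by blast+
    show "\<exists>u\<in>A. \<forall>a\<in>C. u \<le> a"
    proof (cases "C = {}")
      case True
      then show ?thesis using p by (auto simp: A_def)
    next
      case False
      define u where "u z = (INF q\<in>C. q z)" for z
      have sub: "sublinear q" "q \<le> p" if "q \<in> C" for q
        using that CA by (auto simp: A_def)
      have bdd: "bdd_below ((\<lambda>q. q z) ` C)" for z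
      proof (rule bdd_belowI2)
        fix q assume "q \<in> C"
        then show "- p (- z) \<le> q z"
          using sub[of q] sublinear_minus[of q z] le_funD[of q p "- z"] by linarith
      qed
      have le: "u z \<le> q z" if "q \<in> C" for q z
        unfolding u_def using bdd that by (rule cINF_lower)
      have ge: "b \<le> u z" if "\<And>q. q \<in> C \<Longrightarrow> b \<le> q z" for b z
        unfolding u_def using False that by (rule cINF_greatest)
      have "sublinear u"
        unfolding sublinear_def
      proof (intro conjI allI impI)
        fix x y
        have "u (x + y) - q y \<le> u x" if q: "q \<in> C" for q
        proof (rule ge)
          fix r assume r: "r \<in> C"
          have "\<exists>s\<in>C. s \<le> q \<and> s \<le> r"
            using tot[OF q r] q r by blast
          then obtain s where s: "s \<in> C" "s \<le> q" "s \<le> r" by blast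
          have "u (x + y) \<le> s x + s y"
            using le[OF s(1), of "x + y"] sublinear_add[OF sub(1)[OF s(1)], of x y] by linarith
          also have "\<dots> \<le> r x + q y"
            using s by (intro add_mono) (auto simp: le_fun_def)
          finally show "u (x + y) - q y \<le> r x" by simp
        qed
        then have "u (x + y) - u x \<le> u y"
          by (intro ge) (simp add: algebra_simps)
        then show "u (x + y) \<le> u x + u y" by simp
      next
        fix x and c :: real assume c: "c > 0"
        have "u (c *\<^sub>R x) / c \<le> u x"
        proof (rule ge)
          fix q assume q: "q \<in> C"
          show "u (c *\<^sub>R x) / c \<le> q x"
            using le[OF q, of "c *\<^sub>R x"] sublinear_scale[OF sub(1)[OF q], of c x] c
            by (simp add: field_simps)
        qed
        then show "u (c *\<^sub>R x) \<le> c * u x"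
          using c by (simp add: field_simps)
      next
        show "u 0 = 0"
        proof (rule antisym)
          obtain q where q: "q \<in> C" using False by blast
          show "u 0 \<le> 0"
            using le[OF q, of 0] sublinear_zero[OF sub(1)[OF q]] by simp
          show "0 \<le> u 0"
            by (rule ge) (simp add: sublinear_zero sub)
        qed
      qed
      moreover have "u \<le> p"
        using False le sub by (fastforce simp: le_fun_def intro: order_trans)
      ultimately show ?thesis
        using le by (intro bexI[of _ u]) (auto simp: A_def le_fun_def)
    qed
  qed
  then obtain m where m: "m \<in> A" "\<And>a. a \<in> A \<Longrightarrow> a \<le> m \<Longrightarrow> a = m" by blast
  show ?thesis
    by (rule exI[of _ m]) (use m in \<open>auto simp: A_def intro: order_trans\<close>)
qed

text \<open>A minimal sublinear functional equals its own descents, hence is odd, and an odd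
  sublinear functional is linear. Minimality is sought below \<open>sublinear_descent p y\<close>
  and not merely below \<open>p\<close>: this pushes the value at \<open>- y\<close> down to
  \<open>- p y\<close> and so forces \<open>L y = p y\<close>.\<close>

theorem Hahn_Banach_sublinear:
  assumes p: "sublinear p"
  shows "\<exists>L. linear L \<and> (\<forall>z. L z \<le> p z) \<and> L y = p y"
proof -
  obtain m where m: "sublinear m" "m \<le> sublinear_descent p y"
      and min: "\<And>q. sublinear q \<Longrightarrow> q \<le> m \<Longrightarrow> q = m"
    using minimal_sublinear_below[OF sublinear_sublinear_descent[OF p]] by metis
  have odd: "m (- x) = - m x" for x
  proof -
    have "sublinear_descent m x = m"
      using sublinear_sublinear_descent[OF m(1)] sublinear_descent_le[OF m(1)]
      by (intro min) (auto simp: le_fun_def)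
    then show ?thesis
      using sublinear_descent_minus[OF m(1), of x] sublinear_minus[OF m(1), of x] by simp
  qed
  have "linear m"
  proof (rule linearI)
    show "m (a + b) = m a + m b" for a b
      using sublinear_add[OF m(1), of a b] sublinear_add[OF m(1), of "- a" "- b"] odd[of a] odd[of b]
        odd[of "a + b"] by simp
    show "m (r *\<^sub>R b) = r *\<^sub>R m b" for r b
    proof (cases "r \<ge> 0")
      case True
      then show ?thesis by (simp add: sublinear_scale[OF m(1)])
    next
      case False
      then show ?thesis
        using sublinear_scale[OF m(1), of "- r" b] odd[of "r *\<^sub>R b"] by simp
    qed
  qed
  moreover have "m z \<le> p z" for z
    using m(2) sublinear_descent_le[OF p, of y z] by (meson le_funD order_trans)
  moreover have "p y \<le> m y"
    using le_funD[OF m(2), of "- y"] sublinear_descent_minus[OF p, of y] odd[of y] by linarith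
  ultimately show ?thesis
    by (intro exI[of _ m]) (auto intro: antisym)
qed

section \<open>Bounded functionals: norming, separation, generalized limits\<close>

lemma Hahn_Banach_blinfun:
  fixes p :: "'a::real_normed_vector \<Rightarrow> real"
  assumes "sublinear p" and K: "\<And>x. p x \<le> K * norm x"
  shows "\<exists>L :: 'a \<Rightarrow>\<^sub>L real. (\<forall>z. blinfun_apply L z \<le> p z) \<and> blinfun_apply L y = p y"
proof -
  obtain L where L: "linear L" "\<And>z. L z \<le> p z" "L y = p y"
    using Hahn_Banach_sublinear[OF assms(1)] by metis
  have "\<bar>L x\<bar> \<le> norm x * K" for x
    using L(2)[of x] L(2)[of "- x"] K[of x] K[of "- x"] linear_neg[OF L(1), of x]
    by (simp add: abs_le_iff mult.commute)
  then have "bounded_linear L"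
    using L(1) by (intro bounded_linear_intro) (auto simp: linear_add linear_scale)
  then show ?thesis
    using L by (intro exI[of _ "Blinfun L"]) (simp add: bounded_linear_Blinfun_apply)
qed

lemma norming_functional:
  fixes x :: "'a::real_normed_vector"
  shows "\<exists>L :: 'a \<Rightarrow>\<^sub>L real. norm L \<le> 1 \<and> blinfun_apply L x = norm x"
proof -
  have "sublinear (norm :: 'a \<Rightarrow> real)"
    by (auto simp: sublinear_def norm_triangle_ineq)
  from Hahn_Banach_blinfun[OF this, of 1 x] obtain L :: "'a \<Rightarrow>\<^sub>L real"
    where L: "\<And>z. blinfun_apply L z \<le> norm z" "blinfun_apply L x = norm x" by auto
  have "norm L \<le> 1"
    using L(1) L(1)[of "- z" for z]
    by (intro norm_blinfun_bound) (auto simp: abs_le_iff blinfun.minus_right)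
  then show ?thesis using L by blast
qed

text \<open>The distance to \<open>S\<close> is sublinear because \<open>S\<close> is a subspace, it
  is at most the norm, and closedness makes it nonzero at \<open>y\<close>. A functional below it
  vanishes on \<open>S\<close>, as the bound applies to \<open>s\<close> and to
  \<open>- s\<close>.\<close>

lemma separating_functional:
  fixes S :: "'a::real_normed_vector set"
  assumes S: "subspace S" "closed S" and y: "y \<notin> S"
  shows "\<exists>L :: 'a \<Rightarrow>\<^sub>L real. (\<forall>s\<in>S. blinfun_apply L s = 0) \<and> blinfun_apply L y \<noteq> 0"
proof -
  have ne: "S \<noteq> {}" using subspace_0[OF S(1)] by auto
  let ?p = "\<lambda>x. infdist x S"
  have le: "?p x \<le> norm (x - s)" if "s \<in> S" for s x
    using infdist_le[OF that, of x] by (simp add: dist_norm)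
  have ge: "b \<le> ?p x" if "\<And>s. s \<in> S \<Longrightarrow> b \<le> norm (x - s)" for b x
    unfolding infdist_def using ne that by (auto simp: dist_norm intro!: cINF_greatest)
  have zero: "?p s = 0" if "s \<in> S" for s
    using that by simp
  have "sublinear ?p"
    unfolding sublinear_def
  proof (intro conjI allI impI)
    fix x z
    have "?p (x + z) - norm (z - t) \<le> ?p x" if t: "t \<in> S" for t
    proof (rule ge)
      fix s assume s: "s \<in> S"
      have "?p (x + z) \<le> norm (x + z - (s + t))"
        using s t by (intro le subspace_add[OF S(1)])
      also have "\<dots> \<le> norm (x - s) + norm (z - t)"
        using norm_triangle_ineq[of "x - s" "z - t"] by (simp add: algebra_simps)
      finally show "?p (x + z) - norm (z - t) \<le> norm (x - s)" by simp
    qed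
    then have "?p (x + z) - ?p x \<le> ?p z"
      by (intro ge) (simp add: algebra_simps)
    then show "?p (x + z) \<le> ?p x + ?p z" by simp
  next
    fix x and c :: real assume c: "c > 0"
    have "?p (c *\<^sub>R x) / c \<le> ?p x"
    proof (rule ge)
      fix s assume s: "s \<in> S"
      have "?p (c *\<^sub>R x) \<le> norm (c *\<^sub>R x - c *\<^sub>R s)"
        using s by (intro le subspace_scale[OF S(1)])
      also have "\<dots> = c * norm (x - s)"
        using c by (simp flip: scaleR_diff_right)
      finally show "?p (c *\<^sub>R x) / c \<le> norm (x - s)"
        using c by (simp add: field_simps)
    qed
    then show "?p (c *\<^sub>R x) \<le> c * ?p x"
      using c by (simp add: field_simps)
  qed (simp add: zero subspace_0[OF S(1)])
  moreover have "?p x \<le> 1 * norm x" for x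
    using le[OF subspace_0[OF S(1)], of x] by simp
  ultimately obtain L :: "'a \<Rightarrow>\<^sub>L real"
    where L: "\<And>z. blinfun_apply L z \<le> ?p z" "blinfun_apply L y = ?p y"
    using Hahn_Banach_blinfun by metis
  have "blinfun_apply L s = 0" if "s \<in> S" for s
    using L(1)[of s] L(1)[of "- s"] zero that subspace_neg[OF S(1) that]
    by (simp add: blinfun.minus_right)
  moreover have "?p y \<noteq> 0"
    using in_closed_iff_infdist_zero[OF S(2) ne] y by simp
  ultimately show ?thesis using L(2) by (intro exI[of _ L]) simp
qed

text \<open>Generalized limit points (in the sense of Banach limits) replace Alaoglu's theorem: no
  topology on the dual is needed, and every half-space bound that holds eventually is inherited.\<close>

lemma bounded_functionals_cluster:
  fixes y :: "'i \<Rightarrow> 'a::real_normed_vector \<Rightarrow>\<^sub>L real"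
  assumes F: "F \<noteq> bot" and R: "eventually (\<lambda>j. norm (y j) \<le> R) F"
  shows "\<exists>L :: 'a \<Rightarrow>\<^sub>L real. \<forall>x c. eventually (\<lambda>j. blinfun_apply (y j) x \<le> c) F \<longrightarrow> blinfun_apply L x \<le> c"
proof -
  define C where "C x = {c. eventually (\<lambda>j. blinfun_apply (y j) x \<le> c) F}" for x
  \<comment> \<open>The limit superior at \<open>x\<close> of the \<open>y j\<close> along
    \<open>F\<close>; every linear functional below it is a generalized limit.\<close>
  define p where "p x = Inf (C x)" for x
  have ev: "eventually (\<lambda>j. \<bar>blinfun_apply (y j) x\<bar> \<le> R * norm x) F" for x
    using R
  proof eventually_elim
    case (elim j)
    have "\<bar>blinfun_apply (y j) x\<bar> \<le> norm (y j) * norm x"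
      using norm_blinfun[of "y j" x] by simp
    also have "\<dots> \<le> R * norm x"
      using elim by (intro mult_right_mono) auto
    finally show ?case .
  qed
  have mem: "R * norm x \<in> C x" for x
    unfolding C_def using ev[of x] by (auto elim: eventually_mono)
  have below: "- (R * norm x) \<le> c" if "c \<in> C x" for x c
  proof -
    have "eventually (\<lambda>j. - (R * norm x) \<le> c) F"
      using ev[of x] that unfolding C_def mem_Collect_eq by eventually_elim linarith
    then show ?thesis using F by (simp add: eventually_const_iff)
  qed
  have bdd: "bdd_below (C x)" for x
    using below by (meson bdd_belowI)
  have le: "p x \<le> c" if "c \<in> C x" for x c
    unfolding p_def using that bdd by (rule cInf_lower)
  have ge: "b \<le> p x" if "\<And>c. c \<in> C x \<Longrightarrow> b \<le> c" for b x
    unfolding p_def using mem that by (intro cInf_greatest) auto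
  have "sublinear p"
    unfolding sublinear_def
  proof (intro conjI allI impI)
    fix x z
    have "p (x + z) - d \<le> p x" if d: "d \<in> C z" for d
    proof (rule ge)
      fix c assume c: "c \<in> C x"
      have "c + d \<in> C (x + z)"
        using c d unfolding C_def mem_Collect_eq
        by eventually_elim (simp add: blinfun.add_right)
      then show "p (x + z) - d \<le> c" using le by fastforce
    qed
    then have "p (x + z) - p x \<le> p z"
      by (intro ge) (simp add: algebra_simps)
    then show "p (x + z) \<le> p x + p z" by simp
  next
    fix x and a :: real assume a: "a > 0"
    have "p (a *\<^sub>R x) / a \<le> p x"
    proof (rule ge)
      fix c assume c: "c \<in> C x"
      have "a * c \<in> C (a *\<^sub>R x)"
        using c unfolding C_def mem_Collect_eq
        by eventually_elim (use a in \<open>simp add: blinfun.scaleR_right\<close>)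
      then show "p (a *\<^sub>R x) / a \<le> c" using le a by (simp add: field_simps)
    qed
    then show "p (a *\<^sub>R x) \<le> a * p x"
      using a by (simp add: field_simps)
  next
    have "C 0 = {0..}"
      using F by (auto simp: C_def blinfun.zero_right eventually_const_iff)
    then show "p 0 = 0" by (simp add: p_def)
  qed
  moreover have "p x \<le> R * norm x" for x
    using le[OF mem] .
  ultimately obtain L :: "'a \<Rightarrow>\<^sub>L real" where "\<And>z. blinfun_apply L z \<le> p z"
    using Hahn_Banach_blinfun by metis
  then show ?thesis
    using le by (intro exI[of _ L]) (fastforce simp: C_def intro: order_trans)
qed

section \<open>Bochner measurability and p-integrable functions\<close>

lemma (in complete_measure) borel_measurable_AE_cong:
  fixes f g :: "'a \<Rightarrow> real"
  assumes f: "f \<in> borel_measurable M" and ae: "AE t in M. f t = g t"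
  shows "g \<in> borel_measurable M"
proof (rule measurableI)
  fix A :: "real set" assume A: "A \<in> sets borel"
  show "g -` A \<inter> space M \<in> sets M"
  proof (rule in_sets_AE)
    show "AE x in M. (x \<in> f -` A \<inter> space M) = (x \<in> g -` A \<inter> space M)"
      using ae by eventually_elim auto
    show "f -` A \<inter> space M \<in> sets M"
      using f A by (rule measurable_sets)
  qed auto
qed auto

lemma (in complete_measure) borel_measurable_AE_LIMSEQ:
  fixes f :: "'a \<Rightarrow> real"
  assumes s[measurable]: "\<And>n::nat. s n \<in> borel_measurable M"
    and lim: "AE t in M. (\<lambda>n. s n t) \<longlonglongrightarrow> f t"
  shows "f \<in> borel_measurable M"
proof (rule borel_measurable_AE_cong)
  show "(\<lambda>t. lim (\<lambda>n. s n t)) \<in> borel_measurable M" by measurable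
  show "AE t in M. lim (\<lambda>n. s n t) = f t"
    using lim by eventually_elim (rule limI)
qed

lemma Bochner_measurable_simple: "simple_function M s \<Longrightarrow> Bochner_measurable M s"
  unfolding Bochner_measurable_def by (intro exI[of _ "\<lambda>_. s"]) auto

lemma Bochner_measurable_compose2:
  assumes u: "Bochner_measurable M u" and v: "Bochner_measurable M v"
    and h: "\<And>a b x y. a \<longlonglongrightarrow> x \<Longrightarrow> b \<longlonglongrightarrow> y \<Longrightarrow> (\<lambda>n. h (a n) (b n)) \<longlonglongrightarrow> h x y"
  shows "Bochner_measurable M (\<lambda>t. h (u t) (v t))"
proof -
  obtain s where s: "\<And>n. simple_function M (s n)" "AE t in M. (\<lambda>n::nat. s n t) \<longlonglongrightarrow> u t"
    using u unfolding Bochner_measurable_def by blast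
  obtain r where r: "\<And>n. simple_function M (r n)" "AE t in M. (\<lambda>n::nat. r n t) \<longlonglongrightarrow> v t"
    using v unfolding Bochner_measurable_def by blast
  have "AE t in M. (\<lambda>n. h (s n t) (r n t)) \<longlonglongrightarrow> h (u t) (v t)"
    using s(2) r(2) by eventually_elim (rule h)
  moreover have "simple_function M (\<lambda>t. h (s n t) (r n t))" for n
    using s(1) r(1) by (rule simple_function_compose2)
  ultimately show ?thesis
    unfolding Bochner_measurable_def by (intro exI[of _ "\<lambda>n t. h (s n t) (r n t)"]) auto
qed

lemma Bochner_measurable_compose1:
  assumes u: "Bochner_measurable M u"
    and h: "\<And>a x. a \<longlonglongrightarrow> x \<Longrightarrow> (\<lambda>n. h (a n)) \<longlonglongrightarrow> h x"
  shows "Bochner_measurable M (\<lambda>t. h (u t))"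
  by (rule Bochner_measurable_compose2[OF u u, of "\<lambda>x y. h x"]) (rule h)

lemma Bochner_measurable_borel:
  fixes f :: "'t \<Rightarrow> real"
  assumes "f \<in> borel_measurable M"
  shows "Bochner_measurable M f"
proof -
  obtain F where "\<And>i. simple_function M (F i)" "\<And>x. x \<in> space M \<Longrightarrow> (\<lambda>i. F i x) \<longlonglongrightarrow> f x"
    using borel_measurable_implies_sequence_metric[OF assms] by blast
  then show ?thesis
    unfolding Bochner_measurable_def by (intro exI[of _ F]) auto
qed

lemma (in complete_measure) borel_measurable_Bochner:
  fixes f :: "'a \<Rightarrow> real"
  assumes "Bochner_measurable M f"
  shows "f \<in> borel_measurable M"
proof -
  obtain s where s: "\<And>n. simple_function M (s n)" "AE t in M. (\<lambda>n::nat. s n t) \<longlonglongrightarrow> f t"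
    using assms unfolding Bochner_measurable_def by blast
  show ?thesis
    by (rule borel_measurable_AE_LIMSEQ[OF _ s(2)]) (rule borel_measurable_simple_function[OF s(1)])
qed

lemma (in complete_measure) borel_measurable_norm_Bochner:
  "Bochner_measurable M v \<Longrightarrow> (\<lambda>t. norm (v t)) \<in> borel_measurable M"
  by (rule borel_measurable_Bochner, rule Bochner_measurable_compose1[where h = norm]) (assumption | erule tendsto_norm)+

lemma Bochner_measurable_add:
  "Bochner_measurable M u \<Longrightarrow> Bochner_measurable M v \<Longrightarrow> Bochner_measurable M (\<lambda>t. u t + v t)"
  by (rule Bochner_measurable_compose2[where h = "(+)"]) (assumption | erule (1) tendsto_add)+

lemma Bochner_measurable_scaleR:
  "Bochner_measurable M u \<Longrightarrow> Bochner_measurable M v \<Longrightarrow> Bochner_measurable M (\<lambda>t. u t *\<^sub>R v t)"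
  by (rule Bochner_measurable_compose2[where h = "(*\<^sub>R)"]) (assumption | erule (1) tendsto_scaleR)+

lemma Bochner_measurable_apply:
  "Bochner_measurable M g \<Longrightarrow> Bochner_measurable M v \<Longrightarrow> Bochner_measurable M (\<lambda>t. blinfun_apply (g t) (v t))"
  by (rule Bochner_measurable_compose2[where h = "blinfun_apply"]) (assumption | erule (1) blinfun.tendsto)+

text \<open>Approximants of norm above \<open>2 * norm (v t)\<close> are replaced by 0. Where
  \<open>v t \<noteq> 0\<close> the factor 2 leaves room, so that only finitely many are affected;
  where \<open>v t = 0\<close> all of them become 0. The resulting majorant is what dominated
  convergence in the \<open>p\<close>-th mean requires.\<close>

lemma Bochner_measurable_dominated_approx:
  assumes v: "Bochner_measurable M v" and norm_v[measurable]: "(\<lambda>t. norm (v t)) \<in> borel_measurable M"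
  shows "\<exists>s. (\<forall>n::nat. simple_function M (s n)) \<and> (AE t in M. (\<lambda>n. s n t) \<longlonglongrightarrow> v t) \<and>
             (\<forall>n t. norm (s n t) \<le> 2 * norm (v t))"
proof -
  obtain s where s: "\<And>n. simple_function M (s n)" and lim: "AE t in M. (\<lambda>n::nat. s n t) \<longlonglongrightarrow> v t"
    using v unfolding Bochner_measurable_def by blast
  define r where "r n t = (if norm (s n t) \<le> 2 * norm (v t) then s n t else 0)" for n t
  have "simple_function M (r n)" for n
  proof -
    have [measurable]: "(\<lambda>t. norm (s n t)) \<in> borel_measurable M"
      using simple_function_compose1[OF s, of norm] by (rule borel_measurable_simple_function)
    show ?thesis
      unfolding r_def by (rule simple_function_If) (rule s, rule simple_function_const, measurable)
  qed
  moreover have "AE t in M. (\<lambda>n. r n t) \<longlonglongrightarrow> v t"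
    using lim
  proof eventually_elim
    case (elim t)
    show ?case
    proof (cases "v t = 0")
      case True
      then have "r n t = 0" for n by (auto simp: r_def)
      then show ?thesis using True by simp
    next
      case False
      have "eventually (\<lambda>n. norm (s n t) < 2 * norm (v t)) sequentially"
        using False by (intro order_tendstoD(2)[OF tendsto_norm[OF elim]]) simp
      then have "eventually (\<lambda>n. s n t = r n t) sequentially"
        by eventually_elim (simp add: r_def)
      then show ?thesis using elim by (rule Lim_transform_eventually[rotated])
    qed
  qed
  moreover have "norm (r n t) \<le> 2 * norm (v t)" for n t
    by (simp add: r_def)
  ultimately show ?thesis by (intro exI[of _ r]) auto
qed

section \<open>Integrability of p-th powers and Hoelder's inequality\<close>

lemma powr_add_le:
  fixes a b p :: real
  assumes "0 \<le> a" "0 \<le> b" "0 \<le> p"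
  shows "(a + b) powr p \<le> 2 powr p * (a powr p + b powr p)"
proof -
  have "(a + b) powr p \<le> (2 * max a b) powr p"
    using assms by (intro powr_mono2) auto
  also have "\<dots> = 2 powr p * max a b powr p"
    using assms by (simp add: powr_mult)
  also have "\<dots> \<le> 2 powr p * (a powr p + b powr p)"
    by (intro mult_left_mono) (auto simp: max_def)
  finally show ?thesis .
qed

lemma (in complete_measure) integrable_powr_Bochner_bound:
  assumes v: "Bochner_measurable M v" and w[measurable]: "w \<in> borel_measurable M"
    and g: "integrable M g" and le: "AE t in M. \<bar>w t * norm (v t) powr p\<bar> \<le> g t"
  shows "integrable M (\<lambda>t. w t * norm (v t) powr p)"
proof -
  have [measurable]: "(\<lambda>t. norm (v t)) \<in> borel_measurable M"
    using v by (rule borel_measurable_norm_Bochner)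
  show ?thesis
    by (rule Bochner_Integration.integrable_bound[OF g]) (use le in auto)
qed

lemma (in complete_measure) wLp_functions_add:
  assumes w[measurable]: "w \<in> borel_measurable M" and w0: "AE t in M. 0 \<le> w t" and p: "0 \<le> p"
    and u: "u \<in> wLp_functions M w p" and v: "v \<in> wLp_functions M w p"
  shows "(\<lambda>t. u t + v t) \<in> wLp_functions M w p"
proof -
  have uv: "Bochner_measurable M u" "Bochner_measurable M v"
      "integrable M (\<lambda>t. w t * norm (u t) powr p)" "integrable M (\<lambda>t. w t * norm (v t) powr p)"
    using u v by (simp_all add: wLp_functions_def)
  have "integrable M (\<lambda>t. w t * norm (u t + v t) powr p)"
  proof (rule integrable_powr_Bochner_bound)
    show "integrable M (\<lambda>t. 2 powr p * (w t * norm (u t) powr p + w t * norm (v t) powr p))"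
      using uv by auto
    show "AE t in M. \<bar>w t * norm (u t + v t) powr p\<bar>
        \<le> 2 powr p * (w t * norm (u t) powr p + w t * norm (v t) powr p)"
      using w0
    proof eventually_elim
      case (elim t)
      have "norm (u t + v t) powr p \<le> (norm (u t) + norm (v t)) powr p"
        using p by (intro powr_mono2 norm_triangle_ineq) auto
      also have "\<dots> \<le> 2 powr p * (norm (u t) powr p + norm (v t) powr p)"
        using p by (intro powr_add_le) auto
      finally have "w t * norm (u t + v t) powr p \<le> w t * (2 powr p * (norm (u t) powr p + norm (v t) powr p))"
        using elim by (rule mult_left_mono)
      then show ?case using elim by (simp add: algebra_simps abs_mult)
    qed
  qed (use uv in \<open>auto intro: Bochner_measurable_add\<close>)
  then show ?thesis
    using uv by (auto simp: wLp_functions_def intro: Bochner_measurable_add)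
qed

lemma wLp_functions_scaleR:
  assumes v: "v \<in> wLp_functions M w p"
  shows "(\<lambda>t. c *\<^sub>R v t) \<in> wLp_functions M w p"
proof -
  have "integrable M (\<lambda>t. \<bar>c\<bar> powr p * (w t * norm (v t) powr p))"
    using v by (auto simp: wLp_functions_def)
  then have "integrable M (\<lambda>t. w t * norm (c *\<^sub>R v t) powr p)"
    by (simp add: powr_mult mult_ac)
  moreover have "Bochner_measurable M (\<lambda>t. c *\<^sub>R v t)"
    using v by (intro Bochner_measurable_scaleR[OF Bochner_measurable_simple])
      (auto simp: wLp_functions_def)
  ultimately show ?thesis by (simp add: wLp_functions_def)
qed

lemma integral_norm_scaleR_powr:
  "(LINT t|M. w t * norm (c *\<^sub>R v t) powr p) = \<bar>c\<bar> powr p * (LINT t|M. w t * norm (v t) powr p)"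
proof -
  have "(\<lambda>t. w t * norm (c *\<^sub>R v t) powr p) = (\<lambda>t. \<bar>c\<bar> powr p * (w t * norm (v t) powr p))"
    by (simp add: fun_eq_iff powr_mult)
  then show ?thesis by simp
qed

definition Lp_functions :: "'t measure \<Rightarrow> real \<Rightarrow> ('t \<Rightarrow> 'a::real_normed_vector) set" where
  "Lp_functions M p = {v. Bochner_measurable M v \<and> integrable M (\<lambda>t. norm (v t) powr p)}"

definition Lp_norm :: "'t measure \<Rightarrow> real \<Rightarrow> ('t \<Rightarrow> 'a::real_normed_vector) \<Rightarrow> real" where
  "Lp_norm M p v = (LINT t|M. norm (v t) powr p) powr (1 / p)"

lemma wLp_functions_1: "wLp_functions M (\<lambda>_. 1) p = Lp_functions M p"
  by (simp add: wLp_functions_def Lp_functions_def)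

lemma (in complete_measure) Lp_functions_add:
  "0 \<le> p \<Longrightarrow> u \<in> Lp_functions M p \<Longrightarrow> v \<in> Lp_functions M p \<Longrightarrow> (\<lambda>t. u t + v t) \<in> Lp_functions M p"
  unfolding wLp_functions_1[symmetric] by (rule wLp_functions_add) auto

lemma Lp_functions_scaleR: "v \<in> Lp_functions M p \<Longrightarrow> (\<lambda>t. c *\<^sub>R v t) \<in> Lp_functions M p"
  unfolding wLp_functions_1[symmetric] by (rule wLp_functions_scaleR)

lemma (in complete_measure) Lp_functions_diff:
  assumes "0 \<le> p" "u \<in> Lp_functions M p" "v \<in> Lp_functions M p"
  shows "(\<lambda>t. u t - v t) \<in> Lp_functions M p"
  using Lp_functions_add[OF assms(1,2) Lp_functions_scaleR[OF assms(3), of "-1"]] by simp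

lemma (in finite_measure) simple_function_integrable_real:
  fixes s :: "'a \<Rightarrow> real"
  assumes s: "simple_function M s"
  shows "integrable M s"
proof (rule integrable_const_bound)
  have "finite ((\<lambda>t. \<bar>s t\<bar>) ` space M)"
    using simple_functionD(1)[OF s] by (simp flip: image_image)
  then show "AE t in M. norm (s t) \<le> Max ((\<lambda>t. \<bar>s t\<bar>) ` space M)"
    by (intro AE_I2) simp
  show "s \<in> borel_measurable M"
    using s by (rule borel_measurable_simple_function)
qed

lemma (in finite_measure) simple_function_Lp:
  assumes s: "simple_function M s"
  shows "s \<in> Lp_functions M p"
proof -
  have "integrable M (\<lambda>t. norm (s t) powr p)"
    by (rule simple_function_integrable_real) (rule simple_function_compose1[OF s, of "\<lambda>x. norm x powr p"])
  then show ?thesis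
    using Bochner_measurable_simple[OF s] by (simp add: Lp_functions_def)
qed

text \<open>Young's inequality, integrated after dividing the functions by their norms
  \<open>\<alpha>\<close> and \<open>\<beta>\<close>. If one norm is 0, that function vanishes
  almost everywhere and so does the product.\<close>

lemma Holder_inequality_integral:
  fixes a b :: "'t \<Rightarrow> real"
  assumes pq: "p > 1" "q > 1" "1 / p + 1 / q = 1"
    and [measurable]: "a \<in> borel_measurable M" "b \<in> borel_measurable M"
    and nn: "\<And>t. 0 \<le> a t" "\<And>t. 0 \<le> b t"
    and ia: "integrable M (\<lambda>t. a t powr p)" and ib: "integrable M (\<lambda>t. b t powr q)"
  shows "integrable M (\<lambda>t. a t * b t)"
    and "(LINT t|M. a t * b t) \<le> (LINT t|M. a t powr p) powr (1 / p) * (LINT t|M. b t powr q) powr (1 / q)"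
proof -
  have young: "a t * b t \<le> a t powr p / p + b t powr q / q" for t
    using Youngs_inequality[OF pq nn] .
  show int: "integrable M (\<lambda>t. a t * b t)"
    by (rule Bochner_Integration.integrable_bound[where f = "\<lambda>t. a t powr p / p + b t powr q / q"])
       (use young nn ia ib in \<open>auto simp: abs_mult intro: order_trans[OF _ abs_ge_self]\<close>)
  define A where "A = (LINT t|M. a t powr p)"
  define B where "B = (LINT t|M. b t powr q)"
  have AB: "A \<ge> 0" "B \<ge> 0" by (auto simp: A_def B_def)
  show "(LINT t|M. a t * b t) \<le> A powr (1 / p) * B powr (1 / q)"
  proof (cases "A = 0 \<or> B = 0")
    case True
    have "(AE t in M. a t powr p = 0) \<or> (AE t in M. b t powr q = 0)"
      using True integral_nonneg_eq_0_iff_AE[OF ia] integral_nonneg_eq_0_iff_AE[OF ib]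
      by (auto simp: A_def B_def)
    then have "AE t in M. a t * b t = 0"
      by auto
    then have "(LINT t|M. a t * b t) = 0"
      by (rule integral_eq_zero_AE)
    then show ?thesis by simp
  next
    case False
    then have pos: "A > 0" "B > 0" using AB by auto
    define \<alpha> where "\<alpha> = A powr (1 / p)"
    define \<beta> where "\<beta> = B powr (1 / q)"
    have ab: "\<alpha> > 0" "\<beta> > 0" "\<alpha> powr p = A" "\<beta> powr q = B"
      using pos pq by (auto simp: \<alpha>_def \<beta>_def powr_powr)
    have "(a t * b t) / (\<alpha> * \<beta>) \<le> a t powr p / (p * A) + b t powr q / (q * B)" for t
      using Youngs_inequality[OF pq, of "a t / \<alpha>" "b t / \<beta>"] nn ab by (simp add: powr_divide mult.commute)
    then have "(LINT t|M. (a t * b t) / (\<alpha> * \<beta>)) \<le> (LINT t|M. a t powr p / (p * A) + b t powr q / (q * B))"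
      using int ia ib by (intro integral_mono) auto
    also have "\<dots> = 1 / p + 1 / q"
      using ia ib pos by (simp add: A_def[symmetric] B_def[symmetric])
    finally have "(LINT t|M. a t * b t) / (\<alpha> * \<beta>) \<le> 1"
      using pq by simp
    then show ?thesis
      using ab by (simp add: \<alpha>_def[symmetric] \<beta>_def[symmetric])
  qed
qed

lemma (in complete_measure) Lp_pairing:
  fixes g :: "'a \<Rightarrow> 'b::real_normed_vector \<Rightarrow>\<^sub>L real"
  assumes pq: "p > 1" "q > 1" "1 / p + 1 / q = 1"
    and f: "f \<in> Lp_functions M p" and g: "g \<in> Lp_functions M q"
  shows "integrable M (\<lambda>t. norm (g t) * norm (f t))"
    and "integrable M (\<lambda>t. blinfun_apply (g t) (f t))"
    and "\<bar>LINT t|M. blinfun_apply (g t) (f t)\<bar> \<le> Lp_norm M q g * Lp_norm M p f"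
proof -
  have B: "Bochner_measurable M f" "Bochner_measurable M g"
    using f g by (auto simp: Lp_functions_def)
  have [measurable]: "(\<lambda>t. norm (f t)) \<in> borel_measurable M" "(\<lambda>t. norm (g t)) \<in> borel_measurable M"
      "(\<lambda>t. blinfun_apply (g t) (f t)) \<in> borel_measurable M"
    by (rule borel_measurable_norm_Bochner[OF B(1)], rule borel_measurable_norm_Bochner[OF B(2)],
        rule borel_measurable_Bochner[OF Bochner_measurable_apply[OF B(2,1)]])
  have qp: "1 / q + 1 / p = 1" using pq by simp
  note H = Holder_inequality_integral[OF pq(2,1) qp, of "\<lambda>t. norm (g t)" M "\<lambda>t. norm (f t)"]
  show int: "integrable M (\<lambda>t. norm (g t) * norm (f t))"
    using f g by (intro H) (auto simp: Lp_functions_def)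
  have le: "norm (blinfun_apply (g t) (f t)) \<le> norm (g t) * norm (f t)" for t
    by (rule norm_blinfun)
  show int': "integrable M (\<lambda>t. blinfun_apply (g t) (f t))"
    by (rule Bochner_Integration.integrable_bound[OF int]) (use le in auto)
  have "\<bar>LINT t|M. blinfun_apply (g t) (f t)\<bar> \<le> (LINT t|M. norm (g t) * norm (f t))"
    using le int int' by (intro order_trans[OF integral_abs_bound] integral_mono) auto
  also have "\<dots> \<le> Lp_norm M q g * Lp_norm M p f"
    unfolding Lp_norm_def using f g by (intro H) (auto simp: Lp_functions_def)
  finally show "\<bar>LINT t|M. blinfun_apply (g t) (f t)\<bar> \<le> Lp_norm M q g * Lp_norm M p f" .
qed

section \<open>Scalar martingales along a refining sequence of finite partitions\<close>

text \<open>The function \<open>\<lambda>x. sqrt (1 + x\<^sup>2)\<close> is strictly convex but grows only linearly, so its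
  Bregman divergence controls the increments of a martingale bounded in \<open>L\<^sup>1\<close>.\<close>

lemma Bregman_sqrt_one_plus_square:
  fixes a b :: real
  defines "A \<equiv> sqrt (1 + a\<^sup>2)" and "B \<equiv> sqrt (1 + b\<^sup>2)"
  shows "(a - b)\<^sup>2 / (2 * A * B\<^sup>2) \<le> A - B - b / B * (a - b)"
proof -
  have AB: "A \<ge> 1" "B \<ge> 1" "A\<^sup>2 = 1 + a\<^sup>2" "B\<^sup>2 = 1 + b\<^sup>2"
    by (auto simp: A_def B_def)
  \<comment> \<open>Lagrange's identity for the vectors \<open>(1, a)\<close> and
    \<open>(1, b)\<close>, whose lengths are \<open>A\<close> and \<open>B\<close>.\<close>
  have id: "(A * B)\<^sup>2 - (1 + a * b)\<^sup>2 = (a - b)\<^sup>2"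
    using AB by (simp add: power_mult_distrib) (simp add: power2_eq_square algebra_simps)
  have "(1 + a * b)\<^sup>2 \<le> (A * B)\<^sup>2"
    using id zero_le_power2[of "a - b"] by linarith
  then have le: "\<bar>1 + a * b\<bar> \<le> A * B"
    using AB power2_le_imp_le[of "\<bar>1 + a * b\<bar>" "A * B"] by simp
  have D: "A - B - b / B * (a - b) = (A * B - (1 + a * b)) / B"
    using AB by (simp add: field_simps power2_eq_square)
  have "(a - b)\<^sup>2 = (A * B - (1 + a * b)) * (A * B + (1 + a * b))"
    using id by (simp add: power2_eq_square algebra_simps)
  also have "\<dots> \<le> (A * B - (1 + a * b)) * (2 * (A * B))"
    using le by (intro mult_left_mono) auto
  finally have "(a - b)\<^sup>2 / (2 * A * B\<^sup>2) \<le> (A * B - (1 + a * b)) * (2 * (A * B)) / (2 * A * B\<^sup>2)"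
    using AB by (intro divide_right_mono) auto
  also have "\<dots> = (A * B - (1 + a * b)) / B"
    using AB(1,2) by (simp add: power2_eq_square)
  finally show ?thesis using D by simp
qed

text \<open>The divergence \<open>D\<close> controls \<open>(a - b)\<^sup>2\<close> only with a
  factor that grows with \<open>a\<close> and \<open>b\<close>. Below the threshold \<open>R\<close>
  this factor is at most \<open>2 * (1 + R) ^ 3\<close>, and an increment larger than
  \<open>\<delta>\<close> is at most its square over \<open>\<delta>\<close>; above the threshold
  the last term already exceeds 1. After integration the first and last terms are small by the
  choice of \<open>\<delta>\<close> and \<open>R\<close>, and the middle one by convergence of the
  integrals of \<open>sqrt (1 + x\<^sup>2)\<close> along the martingale.\<close>

lemma min_one_le_Bregman:
  fixes a b R \<delta> :: real
  assumes R: "R > 0" and \<delta>: "\<delta> > 0"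
  defines "D \<equiv> sqrt (1 + a\<^sup>2) - sqrt (1 + b\<^sup>2) - b / sqrt (1 + b\<^sup>2) * (a - b)"
  shows "min 1 \<bar>a - b\<bar> \<le> \<delta> + 2 * (1 + R) ^ 3 / \<delta> * D + (\<bar>a\<bar> + \<bar>b\<bar>) / R"
proof -
  define A where "A = sqrt (1 + a\<^sup>2)"
  define B where "B = sqrt (1 + b\<^sup>2)"
  have AB: "A \<ge> 1" "B \<ge> 1" "A \<le> 1 + \<bar>a\<bar>" "B \<le> 1 + \<bar>b\<bar>"
    by (auto simp: A_def B_def intro!: real_le_lsqrt simp: power2_sum)
  have D: "(a - b)\<^sup>2 / (2 * A * B\<^sup>2) \<le> D"
    unfolding D_def A_def B_def by (rule Bregman_sqrt_one_plus_square)
  have D0: "D \<ge> 0"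
    by (rule order_trans[OF _ D]) (use AB in auto)
  show ?thesis
  proof (cases "\<bar>a\<bar> \<le> R \<and> \<bar>b\<bar> \<le> R")
    case True
    have "A * B\<^sup>2 \<le> (1 + R) * (1 + R)\<^sup>2"
      using True AB by (intro mult_mono power_mono) auto
    then have "2 * (A * B\<^sup>2) \<le> 2 * ((1 + R) * (1 + R)\<^sup>2)"
      by simp
    then have "2 * A * B\<^sup>2 \<le> 2 * (1 + R) ^ 3"
      by (simp only: power3_eq_cube power2_eq_square mult.assoc)
    then have "(a - b)\<^sup>2 / (2 * (1 + R) ^ 3) \<le> (a - b)\<^sup>2 / (2 * A * B\<^sup>2)"
      using AB R by (intro divide_left_mono) auto
    also note D
    finally have "(a - b)\<^sup>2 \<le> 2 * (1 + R) ^ 3 * D"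
      using R by (simp add: field_simps)
    then have 1: "(a - b)\<^sup>2 / \<delta> \<le> 2 * (1 + R) ^ 3 / \<delta> * D"
      using \<delta> by (simp add: field_simps)
    have 2: "\<bar>a - b\<bar> \<le> \<delta> + (a - b)\<^sup>2 / \<delta>"
    proof (cases "\<bar>a - b\<bar> \<le> \<delta>")
      case True
      then show ?thesis using \<delta> by (simp add: add_increasing2)
    next
      case False
      then have "\<bar>a - b\<bar> * \<delta> \<le> \<bar>a - b\<bar> * \<bar>a - b\<bar>" by (intro mult_left_mono) auto
      then have "\<bar>a - b\<bar> \<le> (a - b)\<^sup>2 / \<delta>" using \<delta> by (simp add: field_simps power2_eq_square)
      then show ?thesis using \<delta> by simp
    qed
    have "0 \<le> (\<bar>a\<bar> + \<bar>b\<bar>) / R" using R by simp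
    then show ?thesis using 1 2 by linarith
  next
    case False
    then have "1 \<le> (\<bar>a\<bar> + \<bar>b\<bar>) / R" using R by (auto simp: field_simps)
    moreover have "0 \<le> 2 * (1 + R) ^ 3 / \<delta> * D" using D0 R \<delta> by simp
    ultimately show ?thesis using \<delta> by linarith
  qed
qed

text \<open>A partition is encoded by the label \<open>c n t\<close> of the cell that contains
  \<open>t\<close>; simplicity of \<open>c n\<close> makes it finite and measurable. The cells
  generate the sets of \<open>M\<close> only up to null sets, as with dyadic intervals, which
  generate the Borel sets and not all Lebesgue sets.\<close>

locale cell_filtration = finite_measure M + complete_measure M
  for M :: "'t measure" +
  fixes c :: "nat \<Rightarrow> 't \<Rightarrow> nat"
  assumes c_simple: "simple_function M (c n)"
    and c_refine: "s \<in> space M \<Longrightarrow> t \<in> space M \<Longrightarrow> c (Suc n) s = c (Suc n) t \<Longrightarrow> c n s = c n t"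
    and c_generates: "A \<in> sets M \<Longrightarrow>
      \<exists>B\<in>sigma_sets (space M) {{t \<in> space M. c n t = k} | n k. True}. AE t in M. t \<in> A \<longleftrightarrow> t \<in> B"
begin

definition cell :: "nat \<Rightarrow> nat \<Rightarrow> 't set" where
  "cell n k = {t \<in> space M. c n t = k}"

definition cells :: "nat \<Rightarrow> nat set" where
  "cells n = c n ` space M"

lemma finite_cells: "finite (cells n)"
  unfolding cells_def using c_simple by (rule simple_functionD)

lemma sets_cell[measurable]: "cell n k \<in> sets M"
proof -
  have "cell n k = c n -` {k} \<inter> space M" by (auto simp: cell_def)
  then show ?thesis using simple_functionD(2)[OF c_simple] by simp
qed

lemma simple_step: "simple_function M (\<lambda>t. \<gamma> (c n t))"
  using c_simple by (rule simple_function_compose1)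

lemma step_measurable[measurable]: "(\<lambda>t. \<gamma> (c n t)) \<in> borel_measurable M"
  by (rule borel_measurable_simple_function[OF simple_step])

lemma integrable_step: "integrable M (\<lambda>t. \<gamma> (c n t) :: real)"
  by (rule simple_function_integrable_real[OF simple_step])

lemma c_refine_le: "n \<le> m \<Longrightarrow> s \<in> space M \<Longrightarrow> t \<in> space M \<Longrightarrow> c m s = c m t \<Longrightarrow> c n s = c n t"
  by (induction m rule: dec_induct) (auto dest: c_refine)

lemma sum_cells:
  fixes f :: "nat \<Rightarrow> 'b::real_vector"
  assumes "t \<in> space M"
  shows "(\<Sum>k\<in>cells n. indicator (cell n k) t *\<^sub>R f k) = f (c n t)"
proof -
  have "(\<Sum>k\<in>cells n. indicator (cell n k) t *\<^sub>R f k) = (\<Sum>k\<in>cells n. if k = c n t then f k else 0)"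
    using assms by (intro sum.cong) (auto simp: cell_def)
  also have "\<dots> = f (c n t)"
    using assms finite_cells by (simp add: sum.delta cells_def)
  finally show ?thesis .
qed

lemma integral_sum_cells:
  assumes f: "integrable M f"
  shows "(LINT t|M. \<psi> (c n t) * f t) = (\<Sum>k\<in>cells n. \<psi> k * (LINT t|M. indicator (cell n k) t * f t :: real))"
proof -
  have "(LINT t|M. \<psi> (c n t) * f t) = (LINT t|M. (\<Sum>k\<in>cells n. \<psi> k * (indicator (cell n k) t * f t)))"
  proof (rule Bochner_Integration.integral_cong)
    fix t assume "t \<in> space M"
    then have "\<psi> (c n t) * f t = (\<Sum>k\<in>cells n. indicator (cell n k) t * \<psi> k) * f t"
      using sum_cells[of t n \<psi>] by simp
    also have "\<dots> = (\<Sum>k\<in>cells n. \<psi> k * (indicator (cell n k) t * f t))"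
      unfolding sum_distrib_right by (simp add: mult_ac)
    finally show "\<psi> (c n t) * f t = (\<Sum>k\<in>cells n. \<psi> k * (indicator (cell n k) t * f t))" .
  qed simp
  also have "\<dots> = (\<Sum>k\<in>cells n. \<psi> k * (LINT t|M. indicator (cell n k) t * f t))"
    using f by (simp add: integrable_real_mult_indicator mult.commute[of "indicator _ _"])
  finally show ?thesis .
qed

lemma integral_step:
  fixes \<psi> :: "nat \<Rightarrow> real"
  shows "(LINT t|M. \<psi> (c n t)) = (\<Sum>k\<in>cells n. \<psi> k * measure M (cell n k))"
  using integral_sum_cells[of "\<lambda>_. 1" \<psi> n] sets.sets_into_space[OF sets_cell] by (simp add: Int_absorb1)

text \<open>The integrals \<open>E n\<close> of \<open>\<Phi> (h n t)\<close> increase, because the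
  linear part of the Bregman divergence integrates to 0 along a martingale and the divergence is
  nonnegative. Linear growth of \<open>\<Phi>\<close> bounds \<open>E\<close> through
  \<open>C\<close>, so \<open>E\<close> is Cauchy, and its increments are exactly the integrated
  divergences.\<close>

lemma martingale_Cauchy_in_measure:
  fixes \<gamma> :: "nat \<Rightarrow> nat \<Rightarrow> real"
  defines "h \<equiv> \<lambda>n t. \<gamma> n (c n t)"
  assumes mart: "\<And>n m k. n \<le> m \<Longrightarrow>
      (LINT t|M. indicator (cell n k) t * h m t) = (LINT t|M. indicator (cell n k) t * h n t)"
    and bound: "\<And>n. (LINT t|M. \<bar>h n t\<bar>) \<le> C" and e: "e > 0"
  shows "\<exists>N. \<forall>n\<ge>N. \<forall>m\<ge>n. (LINT t|M. min 1 \<bar>h m t - h n t\<bar>) < e"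
proof -
  define \<Phi> :: "real \<Rightarrow> real" where "\<Phi> x = sqrt (1 + x\<^sup>2)" for x
  define D where "D m n t = \<Phi> (h m t) - \<Phi> (h n t) - h n t / \<Phi> (h n t) * (h m t - h n t)" for m n t
  define E where "E n = (LINT t|M. \<Phi> (h n t))" for n
  have h[measurable]: "h n \<in> borel_measurable M" for n
    unfolding h_def by measurable
  have ih: "integrable M (h n)" "integrable M (\<lambda>t. F (h n t))" for n and F :: "real \<Rightarrow> real"
    unfolding h_def using integrable_step[of "\<gamma> n" n] integrable_step[of "\<lambda>k. F (\<gamma> n k)" n] by auto
  have iprod: "integrable M (\<lambda>t. F (h n t) * h m t)" for n m and F :: "real \<Rightarrow> real"
  proof -
    have "simple_function M (\<lambda>t. F (\<gamma> n (c n t)) * \<gamma> m (c m t))"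
      using simple_step[of "\<gamma> n" n] simple_step[of "\<gamma> m" m]
      by (rule simple_function_compose2[where h = "\<lambda>x y. F x * y"])
    then show ?thesis
      unfolding h_def by (rule simple_function_integrable_real)
  qed
  \<comment> \<open>\<open>F (h n t)\<close> is constant on the cells of level \<open>n\<close>, and
    on each of them \<open>h m\<close> and \<open>h n\<close> have the same integral. This is the
    only use of conditional expectations.\<close>
  have orth: "(LINT t|M. F (h n t) * h m t) = (LINT t|M. F (h n t) * h n t)" if "n \<le> m" for n m and F :: "real \<Rightarrow> real"
    using integral_sum_cells[OF ih(1)[of m], of "\<lambda>k. F (\<gamma> n k)" n]
      integral_sum_cells[OF ih(1)[of n], of "\<lambda>k. F (\<gamma> n k)" n] mart[OF that]
    by (simp add: h_def)
  have Dsplit: "D m n t = \<Phi> (h m t) - \<Phi> (h n t) - (h n t / \<Phi> (h n t) * h m t - h n t / \<Phi> (h n t) * h n t)" for m n t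
    by (simp add: D_def right_diff_distrib)
  have iD: "integrable M (D m n)" for m n
    unfolding Dsplit using ih(2)[of \<Phi>] iprod[of "\<lambda>x. x / \<Phi> x"] by (intro Bochner_Integration.integrable_diff)
  have ED: "(LINT t|M. D m n t) = E m - E n" if "n \<le> m" for m n
    unfolding Dsplit E_def using ih(2)[of \<Phi>] iprod[of "\<lambda>x. x / \<Phi> x"] orth[OF that, of "\<lambda>x. x / \<Phi> x"]
    by simp
  have D0: "D m n t \<ge> 0" for m n t
    unfolding D_def \<Phi>_def by (rule order_trans[OF _ Bregman_sqrt_one_plus_square]) auto
  have "incseq E"
    unfolding incseq_def
  proof (intro allI impI)
    fix n m :: nat assume "n \<le> m"
    moreover have "0 \<le> (LINT t|M. D m n t)"
      by (rule integral_nonneg_AE) (simp add: D0)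
    ultimately show "E n \<le> E m"
      using ED[of n m] by simp
  qed
  moreover have "E n \<le> measure M (space M) + C" for n
  proof -
    have "E n \<le> (LINT t|M. 1 + \<bar>h n t\<bar>)"
      unfolding E_def \<Phi>_def
      by (intro integral_mono ih integrable_add) (auto intro!: real_le_lsqrt simp: power2_sum)
    also have "\<dots> = measure M (space M) + (LINT t|M. \<bar>h n t\<bar>)"
      using ih(2)[of abs n] by simp
    finally show ?thesis using bound[of n] by simp
  qed
  ultimately have "convergent E"
    using incseq_convergent by (metis convergentI)
  then have "Cauchy E" by (rule convergent_Cauchy)
  \<comment> \<open>The three error terms are to stay within \<open>e / 3\<close> each. The 6 is
    \<open>3 * 2\<close>, since the bound \<open>C\<close> is used for both \<open>h m\<close> and
    \<open>h n\<close>; the summands 1 keep \<open>\<delta>\<close> finite and \<open>R\<close>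
    positive when the measure or \<open>C\<close> is 0.\<close>
  define \<delta> where "\<delta> = e / (3 * (measure M (space M) + 1))"
  define R where "R = 6 * (\<bar>C\<bar> + 1) / e"
  have pos: "\<delta> > 0" "R > 0"
    using e by (auto simp: \<delta>_def R_def add_nonneg_pos)
  define K where "K = 2 * (1 + R) ^ 3 / \<delta>"
  have K: "K > 0" using pos by (simp add: K_def)
  obtain N where N: "\<And>m n. m \<ge> N \<Longrightarrow> n \<ge> N \<Longrightarrow> \<bar>E m - E n\<bar> < e / (3 * K)"
    using \<open>Cauchy E\<close> e K unfolding Cauchy_def dist_real_def by (metis divide_pos_pos mult_pos_pos zero_less_numeral)
  have "(LINT t|M. min 1 \<bar>h m t - h n t\<bar>) < e" if "n \<ge> N" "m \<ge> n" for m n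
  proof -
    have "(LINT t|M. min 1 \<bar>h m t - h n t\<bar>) \<le> (LINT t|M. \<delta> + K * D m n t + (\<bar>h m t\<bar> + \<bar>h n t\<bar>) / R)"
    proof (rule integral_mono)
      show "integrable M (\<lambda>t. min 1 \<bar>h m t - h n t\<bar>)"
        by (rule integrable_const_bound[where B = 1]) auto
      show "integrable M (\<lambda>t. \<delta> + K * D m n t + (\<bar>h m t\<bar> + \<bar>h n t\<bar>) / R)"
        using iD ih(1) by auto
      show "min 1 \<bar>h m t - h n t\<bar> \<le> \<delta> + K * D m n t + (\<bar>h m t\<bar> + \<bar>h n t\<bar>) / R" for t
        unfolding K_def D_def \<Phi>_def using pos by (intro min_one_le_Bregman)
    qed
    also have "\<dots> = \<delta> * measure M (space M) + K * (E m - E n) + ((LINT t|M. \<bar>h m t\<bar>) + (LINT t|M. \<bar>h n t\<bar>)) / R"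
      using iD ih(1) ED[OF that(2)] by simp
    also have "\<dots> < e"
    proof -
      have "measure M (space M) / (measure M (space M) + 1) \<le> 1"
        by (simp add: divide_le_eq_1 add_nonneg_pos)
      then have "e / 3 * (measure M (space M) / (measure M (space M) + 1)) \<le> e / 3 * 1"
        using e by (intro mult_left_mono) auto
      then have 1: "\<delta> * measure M (space M) \<le> e / 3"
        by (simp add: \<delta>_def)
      have 2: "K * (E m - E n) < e / 3"
      proof -
        have "E m - E n < e / (3 * K)"
          using N[of m n] that by simp
        then show ?thesis using K by (simp add: field_simps)
      qed
      have "((LINT t|M. \<bar>h m t\<bar>) + (LINT t|M. \<bar>h n t\<bar>)) / R \<le> (2 * \<bar>C\<bar>) / R"
        using bound[of m] bound[of n] pos by (intro divide_right_mono) auto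
      also have "\<dots> \<le> e / 3"
        using e by (simp add: R_def field_simps)
      finally show ?thesis using 1 2 by linarith
    qed
    finally show ?thesis .
  qed
  then show ?thesis by blast
qed

end

text \<open>Along a fast subsequence the truncated increments have summable integrals, so they are
  summable almost everywhere. They then tend to 0, the truncation at 1 is eventually inactive, and
  the true increments are summable too.\<close>

lemma (in finite_measure) Cauchy_in_measure_subseq:
  fixes f :: "nat \<Rightarrow> nat \<Rightarrow> 'a \<Rightarrow> real"
  assumes [measurable]: "\<And>i n. f i n \<in> borel_measurable M"
    and Cauchy: "\<And>i e. e > 0 \<Longrightarrow> \<exists>N. \<forall>n\<ge>N. \<forall>m\<ge>n. (LINT t|M. min 1 \<bar>f i m t - f i n t\<bar>) < e"
  shows "\<exists>r. strict_mono r \<and> (AE t in M. \<forall>i. convergent (\<lambda>k. f i (r k) t))"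
proof -
  have "\<forall>i k. \<exists>N. \<forall>n\<ge>N. \<forall>m\<ge>n. (LINT t|M. min 1 \<bar>f i m t - f i n t\<bar>) < (1 / 2) ^ k"
    using Cauchy by simp
  then obtain N where N: "\<And>i k n m. n \<ge> N i k \<Longrightarrow> m \<ge> n \<Longrightarrow> (LINT t|M. min 1 \<bar>f i m t - f i n t\<bar>) < (1 / 2) ^ k"
    by metis
  \<comment> \<open>One subsequence has to serve all \<open>i\<close>: the sum dominates every
    \<open>N i k\<close> with \<open>i \<le> k\<close>, and the summand \<open>k\<close> makes
    \<open>r\<close> strictly increasing.\<close>
  define r where "r k = k + (\<Sum>j\<le>k. \<Sum>i\<le>j. N i j)" for k
  have r: "strict_mono r"
    by (rule strict_monoI_Suc) (simp add: r_def)
  have rN: "N i k \<le> r k" if "i \<le> k" for i k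
  proof -
    have "N i k \<le> (\<Sum>i\<le>k. N i k)" using that by (intro member_le_sum) auto
    also have "\<dots> \<le> (\<Sum>j\<le>k. \<Sum>i\<le>j. N i j)" by (intro member_le_sum) auto
    finally show ?thesis by (simp add: r_def)
  qed
  have "AE t in M. convergent (\<lambda>k. f i (r k) t)" for i
  proof -
    \<comment> \<open>The shift by \<open>i\<close> starts the increments where \<open>r\<close>
      dominates the thresholds of index \<open>i\<close>; it does not affect convergence.\<close>
    define d where "d k t = min 1 \<bar>f i (r (Suc (k + i))) t - f i (r (k + i)) t\<bar>" for k t
    have d[measurable]: "d k \<in> borel_measurable M" for k
      unfolding d_def by measurable
    have d01: "0 \<le> d k t" "d k t \<le> 1" for k t
      by (auto simp: d_def)
    have id: "integrable M (d k)" for k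
      by (rule integrable_const_bound[where B = 1]) (use d01 in auto)
    have le: "(LINT t|M. d k t) \<le> (1 / 2) ^ k" for k
    proof -
      have "(LINT t|M. d k t) < (1 / 2) ^ (k + i)"
        unfolding d_def using r rN[of i "k + i"] by (intro N) (auto simp: strict_mono_less_eq)
      also have "\<dots> \<le> (1 / 2) ^ k" by (rule power_decreasing) auto
      finally show ?thesis by simp
    qed
    have "(\<integral>\<^sup>+t. (\<Sum>k. ennreal (d k t)) \<partial>M) = (\<Sum>k. \<integral>\<^sup>+t. ennreal (d k t) \<partial>M)"
      by (rule nn_integral_suminf) simp
    also have "\<dots> \<le> (\<Sum>k. ennreal ((1 / 2) ^ k))"
      using le id d01 by (intro suminf_le) (auto simp: nn_integral_eq_integral intro!: ennreal_leI)
    also have "\<dots> = ennreal (\<Sum>k. (1 / 2) ^ k)"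
      by (rule suminf_ennreal2) (auto simp: summable_geometric)
    also have "\<dots> < \<infinity>" by simp
    finally have "(\<integral>\<^sup>+t. (\<Sum>k. ennreal (d k t)) \<partial>M) \<noteq> \<infinity>" by simp
    then have "AE t in M. (\<Sum>k. ennreal (d k t)) \<noteq> \<infinity>"
      by (intro nn_integral_PInf_AE) auto
    then show ?thesis
    proof eventually_elim
      case (elim t)
      have s: "summable (\<lambda>k. d k t)"
        using elim d01 by (intro summable_suminf_not_top) (auto simp: infinity_ennreal_def)
      then have "(\<lambda>k. d k t) \<longlonglongrightarrow> 0" by (rule summable_LIMSEQ_zero)
      then have "eventually (\<lambda>k. d k t < 1) sequentially"
        by (rule order_tendstoD) simp
      then have "eventually (\<lambda>k. norm (f i (r (Suc (k + i))) t - f i (r (k + i)) t) \<le> d k t) sequentially"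
        by eventually_elim (auto simp: d_def)
      then have "summable (\<lambda>k. f i (r (Suc (k + i))) t - f i (r (k + i)) t)"
        by (intro summable_comparison_test_ev[OF _ s])
      then have "convergent (\<lambda>n. \<Sum>k<n. f i (r (Suc (k + i))) t - f i (r (k + i)) t)"
        by (simp add: summable_iff_convergent)
      moreover have "(\<Sum>k<n. f i (r (Suc (k + i))) t - f i (r (k + i)) t) = f i (r (n + i)) t - f i (r i) t" for n
        using sum_lessThan_telescope[of "\<lambda>k. f i (r (k + i)) t" n] by simp
      ultimately have "convergent (\<lambda>n. f i (r (n + i)) t - f i (r i) t)" by simp
      then obtain L where "(\<lambda>n. f i (r (n + i)) t - f i (r i) t) \<longlonglongrightarrow> L"
        by (auto simp: convergent_def)
      then have "(\<lambda>n. f i (r (n + i)) t) \<longlonglongrightarrow> L + f i (r i) t"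
        using tendsto_add[OF _ tendsto_const[of "f i (r i) t"]] by fastforce
      then have "(\<lambda>n. f i (r n) t) \<longlonglongrightarrow> L + f i (r i) t"
        by (rule LIMSEQ_offset)
      then show ?case by (rule convergentI)
    qed
  qed
  then have "AE t in M. \<forall>i. convergent (\<lambda>k. f i (r k) t)"
    by (simp add: AE_all_countable)
  with r show ?thesis by blast
qed

text \<open>Uniform integrability by truncation:
  \<open>u \<le> min R u + u powr q / R powr (q - 1)\<close>. The truncated part tends to 0 by
  dominated convergence, and the tail is at most \<open>K / R powr (q - 1)\<close>, which is small
  for large \<open>R\<close> because \<open>q > 1\<close>.\<close>

lemma (in finite_measure) Lp_bounded_AE_LIMSEQ_imp_L1:
  fixes h :: "'a \<Rightarrow> real"
  assumes q: "q > 1" and s[measurable]: "\<And>n. s n \<in> borel_measurable M" and h[measurable]: "h \<in> borel_measurable M"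
    and sq: "\<And>n. integrable M (\<lambda>t. \<bar>s n t\<bar> powr q)" and ih: "integrable M (\<lambda>t. \<bar>h t\<bar> powr q)"
    and C: "\<And>n. (LINT t|M. \<bar>s n t\<bar> powr q) \<le> C" and lim: "AE t in M. (\<lambda>n. s n t) \<longlonglongrightarrow> h t"
  shows "(\<lambda>n. LINT t|M. \<bar>s n t - h t\<bar>) \<longlonglongrightarrow> 0"
proof -
  define u where "u n t = \<bar>s n t - h t\<bar>" for n t
  have u[measurable]: "u n \<in> borel_measurable M" for n
    unfolding u_def by measurable
  have u0: "u n t \<ge> 0" for n t by (simp add: u_def)
  define K where "K = 2 powr q * (C + (LINT t|M. \<bar>h t\<bar> powr q))"
  have le: "u n t powr q \<le> 2 powr q * (\<bar>s n t\<bar> powr q + \<bar>h t\<bar> powr q)" for n t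
  proof -
    have "u n t powr q \<le> (\<bar>s n t\<bar> + \<bar>h t\<bar>) powr q"
      unfolding u_def using q by (intro powr_mono2) auto
    also have "\<dots> \<le> 2 powr q * (\<bar>s n t\<bar> powr q + \<bar>h t\<bar> powr q)"
      using q by (intro powr_add_le) auto
    finally show ?thesis .
  qed
  have iuq: "integrable M (\<lambda>t. u n t powr q)" for n
    by (rule Bochner_Integration.integrable_bound[where f = "\<lambda>t. 2 powr q * (\<bar>s n t\<bar> powr q + \<bar>h t\<bar> powr q)"])
       (use sq ih le in auto)
  have K: "(LINT t|M. u n t powr q) \<le> K" for n
  proof -
    have "(LINT t|M. u n t powr q) \<le> (LINT t|M. 2 powr q * (\<bar>s n t\<bar> powr q + \<bar>h t\<bar> powr q))"
      using iuq sq ih le by (intro integral_mono) auto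
    also have "\<dots> \<le> K"
      using sq ih C[of n] by (simp add: K_def)
    finally show ?thesis .
  qed
  have imin: "integrable M (\<lambda>t. min R (u n t))" if "R > 0" for R n
    using that u0 by (intro integrable_const_bound[where B = R]) auto
  have split: "u n t \<le> min R (u n t) + u n t powr q / R powr (q - 1)" if R: "R > 0" for R n t
  proof (cases "u n t \<le> R")
    case False
    then have "u n t * R powr (q - 1) \<le> u n t * u n t powr (q - 1)"
      using q R u0 by (intro mult_left_mono powr_mono2) auto
    also have "\<dots> = u n t powr q"
      using False R by (simp add: powr_diff)
    finally have "u n t \<le> u n t powr q / R powr (q - 1)"
      using R by (simp add: field_simps)
    then show ?thesis using R False by simp
  qed simp
  have bound: "(LINT t|M. u n t) \<le> (LINT t|M. min R (u n t)) + K / R powr (q - 1)" if R: "R > 0" for R n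
  proof -
    have iu: "integrable M (u n)"
    proof (rule Bochner_Integration.integrable_bound)
      show "integrable M (\<lambda>t. min R (u n t) + u n t powr q / R powr (q - 1))"
        using iuq imin[OF R] by auto
      show "AE t in M. norm (u n t) \<le> norm (min R (u n t) + u n t powr q / R powr (q - 1))"
        using order_trans[OF split[OF R] abs_ge_self] u0 by (intro AE_I2) simp
    qed simp
    have "(LINT t|M. u n t) \<le> (LINT t|M. min R (u n t) + u n t powr q / R powr (q - 1))"
      using iu split[OF R] iuq imin[OF R] by (intro integral_mono) auto
    also have "\<dots> = (LINT t|M. min R (u n t)) + (LINT t|M. u n t powr q) / R powr (q - 1)"
      using iuq imin[OF R] by simp
    also have "\<dots> \<le> (LINT t|M. min R (u n t)) + K / R powr (q - 1)"
      using K by (intro add_mono divide_right_mono) auto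
    finally show ?thesis .
  qed
  have minlim: "(\<lambda>n. LINT t|M. min R (u n t)) \<longlonglongrightarrow> (LINT t|M. 0)" if R: "R > 0" for R
  proof (rule integral_dominated_convergence[where w = "\<lambda>_. R"])
    show "AE t in M. (\<lambda>n. min R (u n t)) \<longlonglongrightarrow> 0"
      using lim
    proof eventually_elim
      case (elim t)
      have "(\<lambda>n. u n t) \<longlonglongrightarrow> 0"
        unfolding u_def using tendsto_rabs[OF tendsto_diff[OF elim tendsto_const[of "h t"]]] by simp
      then have "(\<lambda>n. min R (u n t)) \<longlonglongrightarrow> min R 0"
        by (intro tendsto_min tendsto_const)
      then show ?case using R by simp
    qed
  qed (use u0 R in auto)
  have "((\<lambda>R. K * R powr (- (q - 1))) \<longlongrightarrow> K * 0) at_top"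
    using q by (intro tendsto_mult tendsto_const tendsto_neg_powr filterlim_ident) auto
  then have Rlim: "((\<lambda>R. K / R powr (q - 1)) \<longlongrightarrow> 0) at_top"
    by (simp only: powr_minus_divide times_divide_eq_right mult_1_right mult_zero_right)
  have "(\<lambda>n. LINT t|M. u n t) \<longlonglongrightarrow> 0"
  proof (rule LIMSEQ_I)
    fix e :: real assume e: "e > 0"
    have "eventually (\<lambda>R. K / R powr (q - 1) < e / 2 \<and> R > 0) at_top"
      using order_tendstoD(2)[OF Rlim, of "e / 2"] e eventually_gt_at_top[of 0]
      by (simp add: eventually_conj)
    then obtain R where R: "K / R powr (q - 1) < e / 2" "R > 0"
      using eventually_happens'[OF trivial_limit_at_top_linorder] by blast
    have "eventually (\<lambda>n. (LINT t|M. min R (u n t)) < e / 2) sequentially"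
      using order_tendstoD(2)[OF minlim[OF R(2)], of "e / 2"] e by simp
    then obtain N where N: "\<And>n. n \<ge> N \<Longrightarrow> (LINT t|M. min R (u n t)) < e / 2"
      by (auto simp: eventually_sequentially)
    have "0 \<le> (LINT t|M. u n t)" for n
      by (rule integral_nonneg_AE) (simp add: u0)
    moreover have "(LINT t|M. u n t) < e" if "n \<ge> N" for n
      using bound[OF R(2), of n] N[OF that] R(1) by linarith
    ultimately have "norm ((LINT t|M. u n t) - 0) < e" if "n \<ge> N" for n
      using that by simp
    then show "\<exists>N. \<forall>n\<ge>N. norm ((LINT t|M. u n t) - 0) < e" by blast
  qed
  then show ?thesis by (simp add: u_def)
qed

section \<open>Norming sequences and Pettis measurability\<close>

lemma subspace_closure_span: "subspace (closure (span D :: 'a::real_normed_vector set))"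
proof (rule subspaceI)
  show "0 \<in> closure (span D)"
    using closure_subset span_zero by blast
next
  fix x y assume "x \<in> closure (span D)" "y \<in> closure (span D)"
  then obtain a b where "\<And>n::nat. a n \<in> span D" "a \<longlonglongrightarrow> x" "\<And>n::nat. b n \<in> span D" "b \<longlonglongrightarrow> y"
    unfolding closure_sequential by blast
  then have "\<And>n. a n + b n \<in> span D" "(\<lambda>n. a n + b n) \<longlonglongrightarrow> x + y"
    by (auto intro: span_add tendsto_add)
  then show "x + y \<in> closure (span D)"
    unfolding closure_sequential by (intro exI[of _ "\<lambda>n. a n + b n"]) auto
next
  fix c x assume "x \<in> closure (span D)"
  then obtain a where "\<And>n::nat. a n \<in> span D" "a \<longlonglongrightarrow> x"
    unfolding closure_sequential by blast
  then have "\<And>n. c *\<^sub>R a n \<in> span D" "(\<lambda>n. c *\<^sub>R a n) \<longlonglongrightarrow> c *\<^sub>R x"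
    by (auto intro: span_scale tendsto_scaleR)
  then show "c *\<^sub>R x \<in> closure (span D)"
    unfolding closure_sequential by (intro exI[of _ "\<lambda>n. c *\<^sub>R a n"]) auto
qed

text \<open>Rational combinations become countable when written as lists of pairs of coefficient and
  index. Elements of the span are reached by induction: approximating one more real coefficient
  amounts to prepending a pair to the list.\<close>

lemma dense_sequence_closure_span:
  fixes D :: "nat \<Rightarrow> 'a::real_normed_vector"
  shows "\<exists>s :: nat \<Rightarrow> 'a. closure (range s) = closure (span (range D))"
proof -
  define F :: "(rat \<times> nat) list \<Rightarrow> 'a" where
    "F l = (\<Sum>(r, i)\<leftarrow>l. of_rat r *\<^sub>R D i)" for l
  define s where "s n = F (from_nat n)" for n
  have range_s: "range s = range F"
  proof -
    have "range s = F ` range from_nat" unfolding s_def image_image ..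
    then show ?thesis by (simp only: surj_from_nat)
  qed
  have "F l \<in> span (range D)" for l
    unfolding F_def
    by (induction l) (auto intro!: span_add[OF span_scale[OF span_base]] simp: span_zero)
  then have 1: "closure (range s) \<subseteq> closure (span (range D))"
    unfolding range_s by (intro closure_mono) auto
  have "x \<in> closure (range F)" if "x \<in> span (range D)" for x
    using that
  proof (induction rule: span_induct_alt)
    case base
    have "F [] = 0" by (simp add: F_def)
    then show ?case using subsetD[OF closure_subset rangeI[of F "[]"]] by simp
  next
    case (step c x y)
    obtain i where i: "x = D i" using step(1) by blast
    obtain b where b: "\<And>n::nat. b n \<in> range F" "b \<longlonglongrightarrow> y"
      using step(2) unfolding closure_sequential by blast
    then have "\<forall>n. \<exists>l. b n = F l" by blast
    then obtain l where l: "\<And>n. b n = F (l n)" by metis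
    have "\<forall>n. \<exists>r. c < of_rat r \<and> of_rat r < c + inverse (real (Suc n))"
      by (intro allI of_rat_dense) simp
    then obtain r where r: "\<And>n. c < of_rat (r n)" "\<And>n. of_rat (r n) < c + inverse (real (Suc n))"
      by metis
    define a where "a n = real_of_rat (r n)" for n
    have a: "a \<longlonglongrightarrow> c"
      unfolding a_def
      by (rule tendsto_sandwich[OF _ _ tendsto_const LIMSEQ_inverse_real_of_nat_add])
        (use r in \<open>auto intro!: always_eventually less_imp_le simp del: of_nat_Suc\<close>)
    have "a n *\<^sub>R x + b n = F ((r n, i) # l n)" for n
      by (simp add: F_def a_def l i)
    moreover have "(\<lambda>n. a n *\<^sub>R x + b n) \<longlonglongrightarrow> c *\<^sub>R x + y"
      using a b by (intro tendsto_add tendsto_scaleR tendsto_const)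
    ultimately show ?case
      unfolding closure_sequential by (intro exI[of _ "\<lambda>n. a n *\<^sub>R x + b n"]) auto
  qed
  then have 2: "closure (span (range D)) \<subseteq> closure (range s)"
    unfolding range_s by (intro closure_minimal) auto
  show ?thesis
    using 1 2 by blast
qed

lemma blinfun_almost_attains_norm:
  fixes L :: "'a::real_normed_vector \<Rightarrow>\<^sub>L real"
  assumes "e > 0"
  shows "\<exists>x. norm x \<le> 1 \<and> norm L - e \<le> blinfun_apply L x"
proof (rule ccontr)
  assume "\<not> ?thesis"
  then have less: "blinfun_apply L x < norm L - e" if "norm x \<le> 1" for x
    using that by (meson not_le)
  have pos: "0 < norm L - e" using less[of 0] by (simp add: blinfun.zero_right)
  have "norm L \<le> norm L - e"
  proof (rule norm_blinfun_bound)
    show "norm (blinfun_apply L x) \<le> (norm L - e) * norm x" for x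
    proof (cases "x = 0")
      case False
      have "blinfun_apply L ((1 / norm x) *\<^sub>R x) < norm L - e" "blinfun_apply L ((- 1 / norm x) *\<^sub>R x) < norm L - e"
        using False by (auto intro!: less)
      then have "\<bar>blinfun_apply L x\<bar> / norm x \<le> norm L - e"
        by (auto simp: blinfun.scaleR_right blinfun.minus_right abs_if)
      then show ?thesis using False by (simp add: field_simps)
    qed (simp add: blinfun.zero_right)
  qed (use pos in simp)
  then show False using assms by simp
qed

text \<open>Near-maximizers \<open>X i k\<close> of each \<open>s i\<close>, with error
  \<open>1 / Suc k\<close>, also nearly norm every limit of the \<open>s i\<close>. The conclusion
  speaks of upper bounds \<open>b\<close> because it is later used to write the sublevel sets of a
  norm as countable intersections.\<close>

lemma norming_sequence:
  fixes s :: "nat \<Rightarrow> 'a::real_normed_vector \<Rightarrow>\<^sub>L real"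
  shows "\<exists>x :: nat \<Rightarrow> 'a. (\<forall>i. norm (x i) \<le> 1) \<and>
    (\<forall>y\<in>closure (range s). \<forall>b. (\<forall>i. blinfun_apply y (x i) \<le> b) \<longrightarrow> norm y \<le> b)"
proof -
  have "\<forall>i k. \<exists>x. norm x \<le> 1 \<and> norm (s i) - 1 / real (Suc k) \<le> blinfun_apply (s i) x"
    by (intro allI blinfun_almost_attains_norm) simp
  then obtain X where X: "\<And>i k. norm (X i k) \<le> 1"
      "\<And>i k. norm (s i) - 1 / real (Suc k) \<le> blinfun_apply (s i) (X i k)"
    by metis
  define x where "x j = (case prod_decode j of (i, k) \<Rightarrow> X i k)" for j
  have "norm y \<le> b" if y: "y \<in> closure (range s)" and b: "\<And>i. blinfun_apply y (x i) \<le> b" for y b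
  proof (rule field_le_epsilon)
    fix e :: real assume e: "e > 0"
    obtain i where i: "norm (s i - y) < e / 3"
      using y e unfolding closure_approachable dist_norm by (metis divide_pos_pos imageE zero_less_numeral)
    obtain k where k: "1 / real (Suc k) < e / 3"
      using e nat_approx_posE[of "e / 3"] by auto
    have "norm y \<le> norm (s i) + norm (s i - y)"
      using norm_triangle_ineq4[of "s i" "s i - y"] by simp
    also have "norm (s i) \<le> blinfun_apply (s i) (X i k) + e / 3"
      using X(2)[of i k] k by linarith
    also have "blinfun_apply (s i) (X i k) = blinfun_apply y (X i k) + blinfun_apply (s i - y) (X i k)"
      by (simp add: blinfun.diff_left)
    also have "blinfun_apply (s i - y) (X i k) \<le> norm (s i - y) * norm (X i k)"
      using norm_blinfun[of "s i - y" "X i k"] by simp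
    also have "\<dots> \<le> norm (s i - y)"
      using X(1)[of i k] by (simp add: mult_left_le)
    also have "blinfun_apply y (X i k) \<le> b"
      using b[of "prod_encode (i, k)"] by (simp add: x_def)
    finally show "norm y \<le> b + e"
      using i by simp
  qed
  moreover have "norm (x j) \<le> 1" for j
    using X(1) by (simp add: x_def split: prod.split)
  ultimately show ?thesis by blast
qed

text \<open>\<open>u m t\<close> is a point nearest to \<open>g t\<close> among
  \<open>s 0, ..., s m\<close>, updated only when the new point is strictly closer. The comparisons
  involve just the distance functions, so \<open>u m\<close> is simple, and density of the sequence
  gives convergence.\<close>

lemma Bochner_measurable_Pettis:
  fixes g :: "'t \<Rightarrow> 'a::real_normed_vector"
  assumes range: "\<And>t. t \<in> space M \<Longrightarrow> g t \<in> closure (range s)"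
    and meas: "\<And>i::nat. (\<lambda>t. dist (g t) (s i)) \<in> borel_measurable M"
  shows "Bochner_measurable M g"
proof -
  define u where "u m = rec_nat (\<lambda>t. s 0)
    (\<lambda>m v t. if dist (g t) (s (Suc m)) < dist (g t) (v t) then s (Suc m) else v t) m" for m
  have u0: "u 0 t = s 0" and uS: "u (Suc m) t = (if dist (g t) (s (Suc m)) < dist (g t) (u m t) then s (Suc m) else u m t)" for m t
    by (simp_all add: u_def)
  have um: "simple_function M (u m) \<and> (\<lambda>t. dist (g t) (u m t)) \<in> borel_measurable M" for m
  proof (induction m)
    case 0
    have "u 0 = (\<lambda>t. s 0)" by (simp add: fun_eq_iff u0)
    then show ?case using meas[of 0] by simp
  next
    case (Suc m)
    have uS': "u (Suc m) = (\<lambda>t. if dist (g t) (s (Suc m)) < dist (g t) (u m t) then s (Suc m) else u m t)"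
      by (simp add: fun_eq_iff uS)
    have [measurable]: "(\<lambda>t. dist (g t) (u m t)) \<in> borel_measurable M" "(\<lambda>t. dist (g t) (s (Suc m))) \<in> borel_measurable M"
      using Suc meas by auto
    have "simple_function M (u (Suc m))"
      unfolding uS' by (rule simple_function_If) (use Suc in auto)
    moreover have "(\<lambda>t. dist (g t) (u (Suc m) t)) = (\<lambda>t. min (dist (g t) (s (Suc m))) (dist (g t) (u m t)))"
      by (auto simp: fun_eq_iff uS)
    ultimately show ?case by simp
  qed
  have le: "dist (g t) (u m t) \<le> dist (g t) (s i)" if "i \<le> m" for i m t
    using that
  proof (induction m)
    case (Suc m)
    then show ?case by (cases "i = Suc m") (auto simp: uS)
  qed (simp add: u0)
  have "(\<lambda>m. u m t) \<longlonglongrightarrow> g t" if t: "t \<in> space M" for t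
  proof (rule metric_LIMSEQ_I)
    fix e :: real assume "e > 0"
    then obtain i where i: "dist (s i) (g t) < e"
      using range[OF t] unfolding closure_approachable by blast
    have "dist (u m t) (g t) < e" if "m \<ge> i" for m
      using le[OF that, of t] i by (simp add: dist_commute)
    then show "\<exists>N. \<forall>m\<ge>N. dist (u m t) (g t) < e" by blast
  qed
  then show ?thesis
    unfolding Bochner_measurable_def using um by (intro exI[of _ u]) auto
qed

section \<open>Functionals on spaces of p-integrable functions\<close>

lemma (in complete_measure) Lp_norm_indicator:
  assumes A: "A \<in> sets M" and p: "p > 0"
  shows "Lp_norm M p (\<lambda>t. indicator A t *\<^sub>R x) = norm x * measure M A powr (1 / p)"
proof -
  have "(\<lambda>t. norm (indicator A t *\<^sub>R x) powr p) = (\<lambda>t. norm x powr p * indicator A t)"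
    by (auto simp: fun_eq_iff indicator_def)
  then have "Lp_norm M p (\<lambda>t. indicator A t *\<^sub>R x) = (norm x powr p * measure M A) powr (1 / p)"
    using sets.sets_into_space[OF A] by (simp add: Lp_norm_def Int_absorb2)
  also have "\<dots> = norm x * measure M A powr (1 / p)"
    using p by (simp add: powr_mult powr_powr)
  finally show ?thesis .
qed

text \<open>The functional acts on functions instead of classes; the bound by \<open>Lp_norm\<close>
  makes it blind to null sets (\<open>\<phi>_AE_cong\<close>). The locale covers functionals on both
  spaces of the duality and also the error functional of the representation.\<close>

locale Lp_functional = cell_filtration M c
  for M :: "'t measure" and c +
  fixes p K :: real and \<phi> :: "('t \<Rightarrow> 'a::real_normed_vector) \<Rightarrow> real"
  assumes p: "p > 1" and K: "K \<ge> 0"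
    and \<phi>_add: "u \<in> Lp_functions M p \<Longrightarrow> v \<in> Lp_functions M p \<Longrightarrow> \<phi> (\<lambda>t. u t + v t) = \<phi> u + \<phi> v"
    and \<phi>_scale: "v \<in> Lp_functions M p \<Longrightarrow> \<phi> (\<lambda>t. a *\<^sub>R v t) = a * \<phi> v"
    and \<phi>_bound: "v \<in> Lp_functions M p \<Longrightarrow> \<bar>\<phi> v\<bar> \<le> K * Lp_norm M p v"
begin

definition ind :: "'t set \<Rightarrow> 'a \<Rightarrow> 't \<Rightarrow> 'a" where
  "ind A x = (\<lambda>t. indicator A t *\<^sub>R x)"

lemma ind_simple: "A \<in> sets M \<Longrightarrow> simple_function M (ind A x)"
  unfolding ind_def
  by (rule simple_function_compose1[OF simple_function_indicator, where g = "\<lambda>a :: real. a *\<^sub>R x"])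

lemma ind_Lp: "A \<in> sets M \<Longrightarrow> ind A x \<in> Lp_functions M p"
  by (rule simple_function_Lp[OF ind_simple])

lemma \<phi>_diff:
  assumes "u \<in> Lp_functions M p" "v \<in> Lp_functions M p"
  shows "\<phi> (\<lambda>t. u t - v t) = \<phi> u - \<phi> v"
  using \<phi>_add[OF assms(1) Lp_functions_scaleR[OF assms(2), of "-1"]] \<phi>_scale[OF assms(2), of "-1"] by simp

lemma \<phi>_AE_cong:
  assumes uv: "u \<in> Lp_functions M p" "v \<in> Lp_functions M p" and ae: "AE t in M. u t = v t"
  shows "\<phi> u = \<phi> v"
proof -
  have "AE t in M. norm (u t - v t) powr p = 0"
    using ae by eventually_elim simp
  then have "Lp_norm M p (\<lambda>t. u t - v t) = 0"
    unfolding Lp_norm_def by (simp add: integral_eq_zero_AE)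
  then show ?thesis
    using \<phi>_bound[of "\<lambda>t. u t - v t"] Lp_functions_diff[of p u v] \<phi>_diff[OF uv] p uv by simp
qed

lemma zero_Lp: "(\<lambda>t. 0) \<in> Lp_functions M p"
  by (rule simple_function_Lp) simp

lemma \<phi>_zero: "\<phi> (\<lambda>t. 0) = 0"
  using \<phi>_scale[OF zero_Lp, of 0] by simp

lemma sum_Lp:
  assumes "finite I" "\<And>i. i \<in> I \<Longrightarrow> u i \<in> Lp_functions M p"
  shows "(\<lambda>t. \<Sum>i\<in>I. u i t) \<in> Lp_functions M p"
  using assms
proof (induction rule: finite_induct)
  case (insert i I)
  then show ?case using Lp_functions_add[of p "u i" "\<lambda>t. \<Sum>i\<in>I. u i t"] p by simp
qed (simp add: zero_Lp)

lemma \<phi>_sum: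
  assumes "finite I" "\<And>i. i \<in> I \<Longrightarrow> u i \<in> Lp_functions M p"
  shows "\<phi> (\<lambda>t. \<Sum>i\<in>I. u i t) = (\<Sum>i\<in>I. \<phi> (u i))"
  using assms
proof (induction rule: finite_induct)
  case (insert i I)
  then show ?case using \<phi>_add[of "u i" "\<lambda>t. \<Sum>i\<in>I. u i t"] sum_Lp[of I u] by simp
qed (simp add: \<phi>_zero)

lemma \<phi>_ind_bound:
  assumes "A \<in> sets M"
  shows "\<bar>\<phi> (ind A x)\<bar> \<le> K * measure M A powr (1 / p) * norm x"
  using \<phi>_bound[OF ind_Lp[OF assms], of x] Lp_norm_indicator[OF assms, of p x] p
  by (simp add: ind_def mult_ac)

lemma \<phi>_ind_linear:
  assumes "A \<in> sets M"
  shows "\<phi> (ind A (x + y)) = \<phi> (ind A x) + \<phi> (ind A y)" and "\<phi> (ind A (a *\<^sub>R x)) = a * \<phi> (ind A x)"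
  using \<phi>_add[OF ind_Lp[OF assms] ind_Lp[OF assms], of x y] \<phi>_scale[OF ind_Lp[OF assms], of a x]
  by (simp_all add: ind_def scaleR_add_right mult.commute)

lemma \<phi>_ind_Un:
  assumes "A \<in> sets M" "B \<in> sets M" "A \<inter> B = {}"
  shows "\<phi> (ind (A \<union> B) x) = \<phi> (ind A x) + \<phi> (ind B x)"
proof -
  have "ind (A \<union> B) x = (\<lambda>t. ind A x t + ind B x t)"
    using assms(3) by (auto simp: ind_def fun_eq_iff indicator_def)
  then show ?thesis using \<phi>_add[OF ind_Lp[OF assms(1)] ind_Lp[OF assms(2)]] by simp
qed

lemma \<phi>_step:
  assumes "u \<in> Lp_functions M p" "\<And>t. t \<in> space M \<Longrightarrow> u t = f (c n t)"
  shows "\<phi> u = (\<Sum>k\<in>cells n. \<phi> (ind (cell n k) (f k)))"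
proof -
  have "\<phi> u = \<phi> (\<lambda>t. \<Sum>k\<in>cells n. ind (cell n k) (f k) t)"
  proof (rule \<phi>_AE_cong)
    show "AE t in M. u t = (\<Sum>k\<in>cells n. ind (cell n k) (f k) t)"
      by (rule AE_I2) (simp add: ind_def sum_cells assms)
  qed (use assms in \<open>auto intro!: sum_Lp ind_Lp finite_cells\<close>)
  also have "\<dots> = (\<Sum>k\<in>cells n. \<phi> (ind (cell n k) (f k)))"
    by (intro \<phi>_sum finite_cells ind_Lp sets_cell)
  finally show ?thesis .
qed

text \<open>A Dynkin argument: two cells are nested or disjoint, so the cells form an
  intersection-stable generator. For countable disjoint unions the bound
  \<open>K * measure M A powr (1 / p) * norm x\<close> makes the contribution of the shrinking
  remainders \<open>U - H n\<close> vanish in the limit.\<close>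

lemma vanishes_on_sets:
  assumes zero: "\<And>n k x. \<phi> (ind (cell n k) x) = 0" and A: "A \<in> sets M"
  shows "\<phi> (ind A x) = 0"
proof -
  define G where "G = {{t \<in> space M. c n t = k} | n k. True}"
  have G: "G = {cell n k | n k. True}"
    by (simp add: G_def cell_def)
  have "Int_stable G"
  proof (rule Int_stableI)
    have *: "cell n k \<inter> cell m j \<in> G" if "n \<le> m" for n m k j
    proof (cases "cell n k \<inter> cell m j = {}")
      case True
      \<comment> \<open>A label that does not occur names an empty cell, so the empty set belongs to
        \<open>G\<close> as well.\<close>
      obtain i where "i \<notin> cells n" using finite_cells ex_new_if_finite[of "cells n"] by auto
      then have "cell n i = {}" by (auto simp: cell_def cells_def)
      then show ?thesis using True by (auto simp: G)
    next
      case False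
      then obtain t where t: "t \<in> space M" "c n t = k" "c m t = j" by (auto simp: cell_def)
      have "cell m j \<subseteq> cell n k"
        using c_refine_le[OF that, of _ t] t by (auto simp: cell_def)
      then have "cell n k \<inter> cell m j = cell m j" by blast
      then show ?thesis by (auto simp: G)
    qed
    fix a b assume "a \<in> G" "b \<in> G"
    then obtain n k m j where "a = cell n k" "b = cell m j" by (auto simp: G)
    then show "a \<inter> b \<in> G"
      using *[of n m k j] *[of m n j k] by (cases "n \<le> m") (auto simp: Int_commute)
  qed
  obtain B where B: "B \<in> sigma_sets (space M) G" and ae: "AE t in M. t \<in> A \<longleftrightarrow> t \<in> B"
    using c_generates[OF A] unfolding G_def by blast
  have GM: "G \<subseteq> sets M" by (auto simp: G)
  have sM: "S \<in> sets M" if "S \<in> sigma_sets (space M) G" for S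
    using that GM sets.sigma_sets_subset by blast
  have "G \<subseteq> Pow (space M)" using GM sets.sets_into_space by blast
  have "\<phi> (ind B x) = 0"
    using \<open>Int_stable G\<close> \<open>G \<subseteq> Pow (space M)\<close> B
  proof (induction rule: sigma_sets_induct_disjoint)
    case (basic A)
    then show ?case using zero by (auto simp: G)
  next
    case empty
    show ?case by (simp add: ind_def \<phi>_zero)
  next
    case (compl A)
    have A: "A \<in> sets M" using compl(1) by (rule sM)
    \<comment> \<open>The whole space is the union of the finitely many cells of level 0.\<close>
    have "\<phi> (ind (space M) x) = 0"
      using \<phi>_step[OF ind_Lp[OF sets.top], of x "\<lambda>_. x" 0] zero by (simp add: ind_def)
    moreover have "A \<union> (space M - A) = space M" using sets.sets_into_space[OF A] by blast
    ultimately show ?case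
      using \<phi>_ind_Un[OF A sets.compl_sets[OF A], of x] compl(2) by simp
  next
    case (union A)
    have A[measurable]: "A i \<in> sets M" for i using union(2) sM by blast
    define U where "U = (\<Union>i. A i)"
    define H where "H n = (\<Union>i<n. A i)" for n
    have [measurable]: "U \<in> sets M" "H n \<in> sets M" for n
      unfolding U_def H_def by auto
    have "\<phi> (ind (H n) x) = 0" for n
    proof (induction n)
      case 0
      show ?case by (simp add: H_def ind_def \<phi>_zero)
    next
      case (Suc n)
      have "H (Suc n) = H n \<union> A n" by (auto simp: H_def less_Suc_eq)
      moreover have "H n \<inter> A n = {}"
      proof -
        have "A i \<inter> A n = {}" if "i < n" for i
          using disjoint_family_onD[OF union(1), of i n] that by simp
        then show ?thesis unfolding H_def by blast
      qed
      ultimately show ?case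
        using \<phi>_ind_Un[of "H n" "A n" x] Suc union(3)[of n] by simp
    qed
    moreover have "H n \<union> (U - H n) = U" for n by (auto simp: H_def U_def)
    ultimately have "\<phi> (ind U x) = \<phi> (ind (U - H n) x)" for n
      using \<phi>_ind_Un[of "H n" "U - H n" x] by simp
    then have "\<bar>\<phi> (ind U x)\<bar> \<le> K * measure M (U - H n) powr (1 / p) * norm x" for n
      using \<phi>_ind_bound[of "U - H n" x] by simp
    moreover have "(\<lambda>n. K * measure M (U - H n) powr (1 / p) * norm x) \<longlonglongrightarrow> K * 0 powr (1 / p) * norm x"
    proof (intro tendsto_intros tendsto_powr')
      have "(\<lambda>n. measure M (U - H n)) \<longlonglongrightarrow> measure M (\<Inter>n. U - H n)"
        by (intro finite_Lim_measure_decseq) (auto simp: decseq_def H_def)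
      moreover have "(\<Inter>n. U - H n) = {}" by (auto simp: U_def H_def)
      ultimately show "(\<lambda>n. measure M (U - H n)) \<longlonglongrightarrow> 0" by (simp only: measure_empty)
    qed (use p in auto)
    ultimately have "\<bar>\<phi> (ind U x)\<bar> \<le> K * 0 powr (1 / p) * norm x"
      by (intro LIMSEQ_le_const) auto
    then show ?case by (simp add: U_def)
  qed
  moreover have "\<phi> (ind A x) = \<phi> (ind B x)"
  proof (rule \<phi>_AE_cong)
    show "AE t in M. ind A x t = ind B x t"
      using ae by eventually_elim (simp add: ind_def indicator_def)
  qed (auto intro: ind_Lp A sM B)
  ultimately show ?thesis by simp
qed

text \<open>From sets the claim passes to simple functions by linearity and then to the limit in the
  \<open>p\<close>-th mean. The dominated approximation gives
  \<open>norm (d n t) \<le> (1 + 2) * norm (f t)\<close>, whence the majorant with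
  \<open>3 powr p\<close>.\<close>

lemma vanishes:
  assumes zero: "\<And>n k x. \<phi> (ind (cell n k) x) = 0" and f: "f \<in> Lp_functions M p"
  shows "\<phi> f = 0"
proof -
  have simple: "\<phi> s = 0" if s: "simple_function M s" for s
  proof -
    let ?I = "s ` space M"
    have sets: "s -` {y} \<inter> space M \<in> sets M" for y
      using s by (rule simple_functionD(2))
    have fin: "finite ?I" using s by (rule simple_functionD(1))
    have "\<phi> s = \<phi> (\<lambda>t. \<Sum>y\<in>?I. ind (s -` {y} \<inter> space M) y t)"
    proof (rule \<phi>_AE_cong)
      show "AE t in M. s t = (\<Sum>y\<in>?I. ind (s -` {y} \<inter> space M) y t)"
      proof (rule AE_I2)
        fix t assume t: "t \<in> space M"
        have "(\<Sum>y\<in>?I. ind (s -` {y} \<inter> space M) y t) = (\<Sum>y\<in>?I. if y = s t then y else 0)"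
          using t by (intro sum.cong) (auto simp: ind_def)
        also have "\<dots> = s t" using t fin by (simp add: sum.delta)
        finally show "s t = (\<Sum>y\<in>?I. ind (s -` {y} \<inter> space M) y t)" by simp
      qed
    qed (rule simple_function_Lp[OF s], intro sum_Lp fin ind_Lp sets)
    also have "\<dots> = (\<Sum>y\<in>?I. \<phi> (ind (s -` {y} \<inter> space M) y))"
      by (intro \<phi>_sum fin ind_Lp sets)
    also have "\<dots> = 0"
      using vanishes_on_sets[OF zero sets] by simp
    finally show ?thesis .
  qed
  have fB: "Bochner_measurable M f" and fi: "integrable M (\<lambda>t. norm (f t) powr p)"
    using f by (auto simp: Lp_functions_def)
  obtain s where s: "\<And>n. simple_function M (s n)" and lim: "AE t in M. (\<lambda>n::nat. s n t) \<longlonglongrightarrow> f t"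
      and le: "\<And>n t. norm (s n t) \<le> 2 * norm (f t)"
    using Bochner_measurable_dominated_approx[OF fB borel_measurable_norm_Bochner[OF fB]] by blast
  define d where "d n t = f t - s n t" for n t
  have d: "d n \<in> Lp_functions M p" for n
    unfolding d_def using p f simple_function_Lp[OF s] by (intro Lp_functions_diff) auto
  have eq: "\<phi> f = \<phi> (d n)" for n
    unfolding d_def using \<phi>_diff[OF f simple_function_Lp[OF s]] simple[OF s] by simp
  have "(\<lambda>n. LINT t|M. norm (d n t) powr p) \<longlonglongrightarrow> (LINT t|M. 0)"
  proof (rule integral_dominated_convergence)
    show "integrable M (\<lambda>t. 3 powr p * norm (f t) powr p)" using fi by auto
    show "AE t in M. (\<lambda>n. norm (d n t) powr p) \<longlonglongrightarrow> 0"
      using lim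
    proof eventually_elim
      case (elim t)
      have "(\<lambda>n. d n t) \<longlonglongrightarrow> 0"
        unfolding d_def using tendsto_diff[OF tendsto_const[of "f t"] elim] by simp
      then have "(\<lambda>n. norm (d n t) powr p) \<longlonglongrightarrow> 0 powr p"
        using p by (intro tendsto_powr' tendsto_norm_zero tendsto_const) auto
      then show ?case using p by simp
    qed
    show "AE t in M. norm (norm (d n t) powr p) \<le> 3 powr p * norm (f t) powr p" for n
    proof (rule AE_I2)
      fix t
      have "norm (d n t) \<le> 3 * norm (f t)"
        unfolding d_def using norm_triangle_ineq4[of "f t" "s n t"] le[of n t] by linarith
      then have "norm (d n t) powr p \<le> (3 * norm (f t)) powr p"
        using p by (intro powr_mono2) auto
      then show "norm (norm (d n t) powr p) \<le> 3 powr p * norm (f t) powr p"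
        by (simp add: powr_mult)
    qed
    show "(\<lambda>t. norm (d n t) powr p) \<in> borel_measurable M" for n
      by (rule borel_measurable_integrable) (use d[of n] in \<open>simp add: Lp_functions_def\<close>)
  qed simp
  then have "(\<lambda>n. LINT t|M. norm (d n t) powr p) \<longlonglongrightarrow> 0" by simp
  then have "(\<lambda>n. K * Lp_norm M p (d n)) \<longlonglongrightarrow> K * 0 powr (1 / p)"
    unfolding Lp_norm_def using p by (intro tendsto_mult tendsto_const tendsto_powr') auto
  moreover have "\<bar>\<phi> f\<bar> \<le> K * Lp_norm M p (d n)" for n
    unfolding eq[of n] using d by (rule \<phi>_bound)
  ultimately have "\<bar>\<phi> f\<bar> \<le> K * 0 powr (1 / p)"
    by (intro LIMSEQ_le_const) auto
  then show ?thesis by simp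
qed

end

section \<open>The Riesz representation with values in the dual\<close>

locale reflexive_Lp_functional = Lp_functional M c p K \<phi>
  for M :: "'t measure" and c p K and \<phi> :: "('t \<Rightarrow> 'a::real_normed_vector) \<Rightarrow> real" +
  fixes q :: real
  assumes q: "q > 1" "1 / p + 1 / q = 1"
    and reflexive: "\<exists>x. \<forall>f. blinfun_apply (\<xi> :: ('a \<Rightarrow>\<^sub>L real) \<Rightarrow>\<^sub>L real) f = blinfun_apply f x"
begin

definition cell_density :: "nat \<Rightarrow> nat \<Rightarrow> 'a \<Rightarrow>\<^sub>L real" where
  "cell_density n k = Blinfun (\<lambda>x. \<phi> (ind (cell n k) x) / measure M (cell n k))"

lemma cell_density_apply: "blinfun_apply (cell_density n k) x = \<phi> (ind (cell n k) x) / measure M (cell n k)"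
proof -
  define B where "B = K * measure M (cell n k) powr (1 / p) / measure M (cell n k)"
  have "bounded_linear (\<lambda>x. \<phi> (ind (cell n k) x) / measure M (cell n k))"
  proof (rule bounded_linear_intro)
    show "norm (\<phi> (ind (cell n k) x) / measure M (cell n k)) \<le> norm x * B" for x
    proof -
      have "\<bar>\<phi> (ind (cell n k) x)\<bar> / measure M (cell n k)
          \<le> K * measure M (cell n k) powr (1 / p) * norm x / measure M (cell n k)"
        by (intro divide_right_mono \<phi>_ind_bound) auto
      then show ?thesis by (simp add: B_def mult_ac)
    qed
  qed (simp_all add: \<phi>_ind_linear[OF sets_cell] add_divide_distrib)
  then show ?thesis
    by (simp add: cell_density_def bounded_linear_Blinfun_apply)
qed

text \<open>On a cell of measure 0 the quotient that defines the density is 0 by convention. This is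
  the right value there, since the bound forces \<open>\<phi>\<close> to vanish on functions
  supported in the cell.\<close>

lemma cell_density_measure: "measure M (cell n k) * blinfun_apply (cell_density n k) x = \<phi> (ind (cell n k) x)"
proof (cases "measure M (cell n k) = 0")
  case True
  then show ?thesis using \<phi>_ind_bound[OF sets_cell, of n k x] p by simp
qed (simp add: cell_density_apply)

definition approx :: "nat \<Rightarrow> 't \<Rightarrow> 'a \<Rightarrow>\<^sub>L real" where
  "approx n t = cell_density n (c n t)"

lemma approx_simple: "simple_function M (\<lambda>t. F (approx n t))"
  unfolding approx_def by (rule simple_step)

lemma approx_integrable: "integrable M (\<lambda>t. F (approx n t) :: real)"
  by (rule simple_function_integrable_real[OF approx_simple])

text \<open>A cell of level \<open>n\<close> is a union of cells of level \<open>m\<close>, so its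
  indicator is a step function at level \<open>m\<close>, on which the densities reproduce
  \<open>\<phi>\<close>. As the right-hand side does not depend on \<open>m\<close>, this is also
  the martingale property.\<close>

lemma approx_cell:
  assumes "n \<le> m"
  shows "(LINT t|M. indicator (cell n k) t * blinfun_apply (approx m t) x) = \<phi> (ind (cell n k) x)"
proof -
  define \<psi> :: "nat \<Rightarrow> real" where "\<psi> j = (if cell m j \<subseteq> cell n k then 1 else 0)" for j
  have \<psi>: "indicator (cell n k) t = \<psi> (c m t)" if t: "t \<in> space M" for t
  proof -
    have "cell m (c m t) \<subseteq> cell n k" if "t \<in> cell n k"
      using that c_refine_le[OF assms, of _ t] by (auto simp: cell_def)
    moreover have "t \<in> cell m (c m t)" using t by (simp add: cell_def)
    ultimately show ?thesis by (auto simp: \<psi>_def indicator_def)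
  qed
  have "(LINT t|M. indicator (cell n k) t * blinfun_apply (approx m t) x)
      = (LINT t|M. \<psi> (c m t) * blinfun_apply (cell_density m (c m t)) x)"
    by (intro Bochner_Integration.integral_cong) (simp_all add: approx_def \<psi>)
  also have "\<dots> = (\<Sum>j\<in>cells m. \<psi> j * blinfun_apply (cell_density m j) x * measure M (cell m j))"
    using integral_step[of "\<lambda>j. \<psi> j * blinfun_apply (cell_density m j) x" m] .
  also have "\<dots> = (\<Sum>j\<in>cells m. \<phi> (ind (cell m j) (\<psi> j *\<^sub>R x)))"
    by (intro sum.cong refl) (simp add: cell_density_measure[symmetric] blinfun.scaleR_right mult_ac)
  also have "\<dots> = \<phi> (ind (cell n k) x)"
    by (rule \<phi>_step[symmetric, of _ "\<lambda>j. \<psi> j *\<^sub>R x"]) (use \<psi> in \<open>auto simp: ind_def intro: ind_Lp[unfolded ind_def]\<close>)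
  finally show ?thesis .
qed

text \<open>Testing \<open>\<phi>\<close> on a step function that almost norms the densities and has their
  \<open>(q - 1)\<close>-st powers as norms.\<close>

lemma approx_bound: "(LINT t|M. norm (approx n t) powr q) \<le> (2 * K) powr q"
proof -
  define a where "a k = norm (cell_density n k)" for k
  \<comment> \<open>Half of the norm is reached without a compactness argument; the loss is the 2 in
    \<open>(2 * K) powr q\<close>. A zero density is treated apart because
    \<open>blinfun_almost_attains_norm\<close> wants a positive error.\<close>
  have "\<exists>x. norm x \<le> 1 \<and> a k / 2 \<le> blinfun_apply (cell_density n k) x" for k
  proof (cases "a k = 0")
    case True
    then show ?thesis by (intro exI[of _ 0]) (simp add: blinfun.zero_right)
  next
    case False
    then have "a k / 2 > 0" by (simp add: a_def)
    from blinfun_almost_attains_norm[OF this, of "cell_density n k"] show ?thesis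
      by (simp add: a_def)
  qed
  then obtain x where x: "\<And>k. norm (x k) \<le> 1" "\<And>k. a k / 2 \<le> blinfun_apply (cell_density n k) (x k)"
    by metis
  define f where "f t = a (c n t) powr (q - 1) *\<^sub>R x (c n t)" for t
  have f: "f \<in> Lp_functions M p"
    unfolding f_def by (rule simple_function_Lp[OF simple_step])
  define S where "S = (LINT t|M. norm (approx n t) powr q)"
  have S: "S = (\<Sum>k\<in>cells n. a k powr q * measure M (cell n k))"
    unfolding S_def approx_def a_def by (rule integral_step)
  have S0: "S \<ge> 0" unfolding S by (intro sum_nonneg) auto
  \<comment> \<open>The reason for the power \<open>q - 1\<close> in \<open>f\<close>: the
    \<open>p\<close>-th power of its norm integrates to at most \<open>S\<close>. The resulting
    \<open>S \<le> 2 * K * S powr (1 / p)\<close> then bounds \<open>S powr (1 / q)\<close>, as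
    \<open>1 - 1 / p = 1 / q\<close>.\<close>
  have qp: "(q - 1) * p = q" using p q by (simp add: field_simps)
  have "S / 2 = (\<Sum>k\<in>cells n. a k powr (q - 1) * (a k / 2) * measure M (cell n k))"
    unfolding S sum_divide_distrib
  proof (intro sum.cong refl)
    fix k
    have "a k powr q = a k powr (q - 1) * a k"
      by (cases "a k = 0") (simp_all add: powr_diff a_def)
    then show "a k powr q * measure M (cell n k) / 2 = a k powr (q - 1) * (a k / 2) * measure M (cell n k)"
      by simp
  qed
  also have "\<dots> \<le> (\<Sum>k\<in>cells n. a k powr (q - 1) * blinfun_apply (cell_density n k) (x k) * measure M (cell n k))"
    using x by (intro sum_mono mult_right_mono mult_left_mono) auto
  also have "\<dots> = (\<Sum>k\<in>cells n. \<phi> (ind (cell n k) (a k powr (q - 1) *\<^sub>R x k)))"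
    by (intro sum.cong refl) (simp add: cell_density_measure[symmetric] blinfun.scaleR_right mult_ac)
  also have "\<dots> = \<phi> f"
    by (rule \<phi>_step[symmetric, OF f]) (simp add: f_def)
  also have "\<dots> \<le> K * Lp_norm M p f"
    using \<phi>_bound[OF f] by linarith
  also have "\<dots> \<le> K * S powr (1 / p)"
  proof -
    have le: "norm (f t) powr p \<le> a (c n t) powr q" for t
    proof -
      have "norm (f t) \<le> a (c n t) powr (q - 1)"
        using x(1)[of "c n t"] by (simp add: f_def mult_left_le)
      then have "norm (f t) powr p \<le> (a (c n t) powr (q - 1)) powr p"
        using p by (intro powr_mono2) auto
      then show ?thesis by (simp add: powr_powr qp)
    qed
    have "(LINT t|M. norm (f t) powr p) \<le> (LINT t|M. a (c n t) powr q)"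
      using f le by (intro integral_mono integrable_step) (auto simp: Lp_functions_def)
    also have "\<dots> = S" by (simp add: S_def a_def approx_def)
    finally show ?thesis
      unfolding Lp_norm_def using K p by (intro mult_left_mono powr_mono2) auto
  qed
  finally have le: "S \<le> 2 * K * S powr (1 / p)" by simp
  show ?thesis
  proof (cases "S = 0")
    case False
    then have pos: "S > 0" using S0 by simp
    have "S = S powr (1 / p) * S powr (1 / q)"
      using pos q by (simp flip: powr_add)
    with le have "S powr (1 / p) * S powr (1 / q) \<le> S powr (1 / p) * (2 * K)"
      by (simp add: mult_ac)
    then have "S powr (1 / q) \<le> 2 * K"
      using pos by simp
    then have "(S powr (1 / q)) powr q \<le> (2 * K) powr q"
      using q by (intro powr_mono2) auto
    then show ?thesis using pos q by (simp add: powr_powr S_def)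
  next
    case True
    then show ?thesis by (simp add: S_def)
  qed
qed

text \<open>Since \<open>1 + a powr q\<close> dominates \<open>a\<close>, finiteness of the measure
  turns the bound in \<open>L^q\<close> into the bound in \<open>L^1\<close> that the scalar
  martingale lemma asks for.\<close>

lemma approx_Cauchy:
  assumes e: "e > 0"
  shows "\<exists>N. \<forall>n\<ge>N. \<forall>m\<ge>n. (LINT t|M. min 1 \<bar>blinfun_apply (approx m t) x - blinfun_apply (approx n t) x\<bar>) < e"
  unfolding approx_def
proof (rule martingale_Cauchy_in_measure[OF _ _ e])
  show "(LINT t|M. indicator (cell n k) t * blinfun_apply (cell_density m (c m t)) x)
      = (LINT t|M. indicator (cell n k) t * blinfun_apply (cell_density n (c n t)) x)" if "n \<le> m" for n m k
    using approx_cell[OF that, of k x] approx_cell[of n n k x] by (simp add: approx_def)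
  show "(LINT t|M. \<bar>blinfun_apply (cell_density n (c n t)) x\<bar>) \<le> (measure M (space M) + (2 * K) powr q) * norm x" for n
  proof -
    have "(LINT t|M. \<bar>blinfun_apply (approx n t) x\<bar>) \<le> (LINT t|M. (1 + norm (approx n t) powr q) * norm x)"
    proof (rule integral_mono)
      show "integrable M (\<lambda>t. \<bar>blinfun_apply (approx n t) x\<bar>)" "integrable M (\<lambda>t. (1 + norm (approx n t) powr q) * norm x)"
        by (rule approx_integrable)+
      fix t
      have "norm (approx n t) \<le> 1 + norm (approx n t) powr q"
      proof (cases "norm (approx n t) \<le> 1")
        case False
        then have "norm (approx n t) powr 1 \<le> norm (approx n t) powr q"
          using q by (intro powr_mono) auto
        then show ?thesis using False by simp
      qed (simp add: add_increasing2)
      then show "\<bar>blinfun_apply (approx n t) x\<bar> \<le> (1 + norm (approx n t) powr q) * norm x"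
        using norm_blinfun[of "approx n t" x] mult_right_mono[OF _ norm_ge_zero[of x]] by fastforce
    qed
    also have "\<dots> = (measure M (space M) + (LINT t|M. norm (approx n t) powr q)) * norm x"
      using approx_integrable[of "\<lambda>y. norm y powr q" n] by simp
    also have "\<dots> \<le> (measure M (space M) + (2 * K) powr q) * norm x"
      using approx_bound[of n] by (intro mult_right_mono) auto
    finally show ?thesis by (simp add: approx_def)
  qed
qed

text \<open>\<open>S\<close> is the closed span of the countably many densities, which provides
  separability for an arbitrary \<open>X\<close>. An element of \<open>S\<close> is determined by
  its values at the \<open>x i\<close>, so the pointwise choice of \<open>g t\<close> is unique
  where a limit exists, and its measurability follows from that of these scalar values.\<close>

lemma Lq_limit:
  obtains S and r :: "nat \<Rightarrow> nat" and x :: "nat \<Rightarrow> 'a" and g :: "'t \<Rightarrow> 'a \<Rightarrow>\<^sub>L real"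
  where "subspace S" "closed S" "\<And>n k. cell_density n k \<in> S" "strict_mono r"
    "\<forall>y\<in>S. \<forall>b. (\<forall>i. blinfun_apply y (x i) \<le> b) \<longrightarrow> norm y \<le> b"
    "\<And>t. g t \<in> S" "g \<in> Lp_functions M q"
    "AE t in M. \<forall>i. (\<lambda>k. blinfun_apply (approx (r k) t) (x i)) \<longlonglongrightarrow> blinfun_apply (g t) (x i)"
proof -
  obtain s :: "nat \<Rightarrow> 'a \<Rightarrow>\<^sub>L real"
    where s: "closure (range s) = closure (span (range (\<lambda>j. case prod_decode j of (n, k) \<Rightarrow> cell_density n k)))"
    using dense_sequence_closure_span by blast
  define S where "S = closure (range s)"
  have S: "subspace S" "closed S"
    unfolding S_def s by (auto intro: subspace_closure_span)
  have dens: "cell_density n k \<in> S" for n k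
  proof -
    have "cell_density n k = (case prod_decode (prod_encode (n, k)) of (n, k) \<Rightarrow> cell_density n k)" by simp
    then have "cell_density n k \<in> range (\<lambda>j. case prod_decode j of (n, k) \<Rightarrow> cell_density n k)" by (rule range_eqI)
    then show ?thesis
      unfolding S_def s by (intro subsetD[OF closure_subset] span_base)
  qed
  then have approx_S: "approx n t \<in> S" for n t
    by (simp add: approx_def)
  obtain x :: "nat \<Rightarrow> 'a" where x: "\<And>i. norm (x i) \<le> 1"
      and norming: "\<And>y b. y \<in> S \<Longrightarrow> (\<And>i. blinfun_apply y (x i) \<le> b) \<Longrightarrow> norm y \<le> b"
    using norming_sequence[of s] unfolding S_def by metis
  have approx_meas[measurable]: "(\<lambda>t. F (approx n t) :: real) \<in> borel_measurable M" for F n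
    using approx_integrable by (rule borel_measurable_integrable)
  obtain r where r: "strict_mono r"
      and conv: "AE t in M. \<forall>i. convergent (\<lambda>k. blinfun_apply (approx (r k) t) (x i))"
  proof -
    have "\<exists>r. strict_mono r \<and> (AE t in M. \<forall>i. convergent (\<lambda>k. blinfun_apply (approx (r k) t) (x i)))"
    proof (rule Cauchy_in_measure_subseq)
      show "(\<lambda>t. blinfun_apply (approx n t) (x i)) \<in> borel_measurable M" for i n
        by (rule approx_meas)
    qed (rule approx_Cauchy)
    then show thesis using that by blast
  qed
  \<comment> \<open>Fatou's lemma makes this lower limit integrable, hence finite almost everywhere,
    although the norms may be unbounded along \<open>r\<close>. It later serves as the majorant that
    puts \<open>g\<close> into \<open>L^q\<close>.\<close>
  define llim where "llim t = liminf (\<lambda>k. ennreal (norm (approx (r k) t) powr q))" for t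
  have [measurable]: "llim \<in> borel_measurable M"
    unfolding llim_def by measurable
  have "(\<integral>\<^sup>+t. llim t \<partial>M) \<le> liminf (\<lambda>k. \<integral>\<^sup>+t. ennreal (norm (approx (r k) t) powr q) \<partial>M)"
    unfolding llim_def by (rule nn_integral_liminf) simp
  also have "\<dots> \<le> limsup (\<lambda>k. \<integral>\<^sup>+t. ennreal (norm (approx (r k) t) powr q) \<partial>M)"
    by (intro Liminf_le_Limsup) simp
  also have "\<dots> \<le> ennreal ((2 * K) powr q)"
  proof (rule Limsup_bounded, rule always_eventually, rule allI)
    fix k
    show "(\<integral>\<^sup>+t. ennreal (norm (approx (r k) t) powr q) \<partial>M) \<le> ennreal ((2 * K) powr q)"
      using approx_bound[of "r k"] approx_integrable[of "\<lambda>y. norm y powr q" "r k"]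
      by (simp add: nn_integral_eq_integral ennreal_leI)
  qed
  finally have llim_int: "(\<integral>\<^sup>+t. llim t \<partial>M) \<le> ennreal ((2 * K) powr q)" .
  then have "(\<integral>\<^sup>+t. llim t \<partial>M) \<noteq> \<infinity>"
    by (auto simp: top_unique)
  then have llim_fin: "AE t in M. llim t \<noteq> \<infinity>"
    by (intro nn_integral_PInf_AE) auto
  define good where "good t y \<longleftrightarrow> y \<in> S \<and> (\<forall>i. (\<lambda>k. blinfun_apply (approx (r k) t) (x i)) \<longlonglongrightarrow> blinfun_apply y (x i))" for t y
  have "AE t in M. \<exists>y. good t y"
    using conv llim_fin
  proof eventually_elim
    case (elim t)
    \<comment> \<open>The summand 1 puts \<open>B\<close> strictly above the lower limit, so that
      the sequence returns below \<open>B\<close> infinitely often.\<close>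
    define B where "B = enn2real (llim t) + 1"
    have "llim t < ennreal B"
      unfolding B_def using elim(2) by (cases "llim t") (auto simp: ennreal_less_iff)
    then have "\<not> eventually (\<lambda>k. ennreal B \<le> ennreal (norm (approx (r k) t) powr q)) sequentially"
      unfolding llim_def using Liminf_bounded[of "ennreal B" _ sequentially] by (meson not_le)
    then have freq: "frequently (\<lambda>k. norm (approx (r k) t) powr q \<le> B) sequentially"
      unfolding not_eventually by (rule frequently_mono[rotated]) (auto simp: not_le ennreal_less_iff)
    have freq': "frequently (\<lambda>k. norm (approx (r k) t) \<le> B powr (1 / q)) sequentially"
    proof (rule frequently_mono[OF _ freq], intro allI impI)
      fix k assume "norm (approx (r k) t) powr q \<le> B"
      then have "(norm (approx (r k) t) powr q) powr (1 / q) \<le> B powr (1 / q)"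
        using q by (intro powr_mono2) auto
      then show "norm (approx (r k) t) \<le> B powr (1 / q)"
        using q by (simp add: powr_powr)
    qed
    \<comment> \<open>The sequential filter restricted to the indices with bounded norm. It is
      proper because these indices recur, and what holds eventually along the subsequence holds
      along \<open>F\<close>; the limits at the \<open>x i\<close> are therefore inherited by
      \<open>y\<close>.\<close>
    define F where "F = inf sequentially (principal {k. norm (approx (r k) t) \<le> B powr (1 / q)})"
    have F: "F \<noteq> bot"
      using freq' by (simp add: F_def trivial_limit_def eventually_inf_principal frequently_def)
    have "eventually (\<lambda>k. norm (approx (r k) t) \<le> B powr (1 / q)) F"
      by (simp add: F_def eventually_inf_principal)
    from bounded_functionals_cluster[OF F this] obtain y :: "'a \<Rightarrow>\<^sub>L real"
      where y: "\<And>z b. eventually (\<lambda>k. blinfun_apply (approx (r k) t) z \<le> b) F \<Longrightarrow> blinfun_apply y z \<le> b"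
      by blast
    have Fle: "eventually P F" if "eventually P sequentially" for P
      using that unfolding F_def by (rule filter_leD[OF inf_le1])
    have lim: "(\<lambda>k. blinfun_apply (approx (r k) t) (x i)) \<longlonglongrightarrow> blinfun_apply y (x i)" for i
    proof -
      obtain l where l: "(\<lambda>k. blinfun_apply (approx (r k) t) (x i)) \<longlonglongrightarrow> l"
        using elim(1) unfolding convergent_def by blast
      have "blinfun_apply y (x i) \<le> l + e" if "e > 0" for e
      proof (rule y, rule Fle)
        show "eventually (\<lambda>k. blinfun_apply (approx (r k) t) (x i) \<le> l + e) sequentially"
          using order_tendstoD(2)[OF l, of "l + e"] that by (auto elim: eventually_mono)
      qed
      moreover have "blinfun_apply y (- x i) \<le> - l + e" if "e > 0" for e
      proof (rule y, rule Fle)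
        show "eventually (\<lambda>k. blinfun_apply (approx (r k) t) (- x i) \<le> - l + e) sequentially"
          using order_tendstoD(1)[OF l, of "l - e"] that
          by (auto elim!: eventually_mono simp: blinfun.minus_right)
      qed
      then have "l \<le> blinfun_apply y (x i) + e" if "e > 0" for e
        using that by (fastforce simp: blinfun.minus_right)
      ultimately have "blinfun_apply y (x i) = l"
        by (metis antisym field_le_epsilon)
      then show ?thesis using l by simp
    qed
    \<comment> \<open>A functional that separates \<open>y\<close> from \<open>S\<close> is
      evaluation at some \<open>z\<close> by reflexivity. All \<open>approx n t\<close> vanish at
      \<open>z\<close>, and so does their generalized limit \<open>y\<close>, a
      contradiction.\<close>
    have "y \<in> S"
    proof (rule ccontr)
      assume "y \<notin> S"
      then obtain \<xi> :: "('a \<Rightarrow>\<^sub>L real) \<Rightarrow>\<^sub>L real"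
        where \<xi>: "\<And>z. z \<in> S \<Longrightarrow> blinfun_apply \<xi> z = 0" "blinfun_apply \<xi> y \<noteq> 0"
        using separating_functional[OF S] by blast
      obtain z where z: "\<And>f. blinfun_apply \<xi> f = blinfun_apply f z"
        using reflexive by blast
      have "blinfun_apply (approx n t) z = 0" for n
        using \<xi>(1)[OF approx_S] z by simp
      then have "blinfun_apply y z \<le> 0" "blinfun_apply y (- z) \<le> 0"
        using y[of z 0] y[of "- z" 0] by (simp_all add: blinfun.minus_right)
      then show False using \<xi>(2) z by (simp add: blinfun.minus_right)
    qed
    then show "\<exists>y. good t y"
      using lim by (auto simp: good_def)
  qed
  \<comment> \<open>The default 0 lies in \<open>S\<close>, so that \<open>g t \<in> S\<close> holds
    at every \<open>t\<close> and not just almost everywhere.\<close>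
  moreover define g where "g t = (if \<exists>y. good t y then SOME y. good t y else 0)" for t
  ultimately have good: "AE t in M. good t (g t)"
    by (auto elim!: eventually_mono intro: someI_ex)
  have gS: "g t \<in> S" for t
    using someI_ex[of "good t"] subspace_0[OF S(1)] by (auto simp: g_def good_def)
  have lim: "AE t in M. \<forall>i. (\<lambda>k. blinfun_apply (approx (r k) t) (x i)) \<longlonglongrightarrow> blinfun_apply (g t) (x i)"
    using good by eventually_elim (simp add: good_def)
  have gx[measurable]: "(\<lambda>t. blinfun_apply (g t) (x i)) \<in> borel_measurable M" for i
    by (rule borel_measurable_AE_LIMSEQ[of "\<lambda>k t. blinfun_apply (approx (r k) t) (x i)"])
       (use lim in \<open>auto intro: approx_meas\<close>)
  have dist_meas: "(\<lambda>t. dist (g t) y) \<in> borel_measurable M" if y: "y \<in> S" for y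
    unfolding borel_measurable_iff_le
  proof
    fix b
    \<comment> \<open>Since \<open>g t - y\<close> lies in \<open>S\<close>, its norm is the
      supremum of its values at the \<open>x i\<close>; a sublevel set of the distance is thus a
      countable intersection of measurable sets.\<close>
    have "dist (g t) y \<le> b \<longleftrightarrow> (\<forall>i. blinfun_apply (g t) (x i) - blinfun_apply y (x i) \<le> b)" for t
    proof
      assume b: "dist (g t) y \<le> b"
      show "\<forall>i. blinfun_apply (g t) (x i) - blinfun_apply y (x i) \<le> b"
      proof
        fix i
        have "blinfun_apply (g t) (x i) - blinfun_apply y (x i) \<le> norm (g t - y) * norm (x i)"
          using norm_blinfun[of "g t - y" "x i"] by (simp add: blinfun.diff_left)
        also have "\<dots> \<le> norm (g t - y)" using x[of i] by (simp add: mult_left_le)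
        finally show "blinfun_apply (g t) (x i) - blinfun_apply y (x i) \<le> b"
          using b by (simp add: dist_norm)
      qed
    next
      assume "\<forall>i. blinfun_apply (g t) (x i) - blinfun_apply y (x i) \<le> b"
      then have "norm (g t - y) \<le> b"
        using subspace_diff[OF S(1) gS y] by (intro norming) (auto simp: blinfun.diff_left)
      then show "dist (g t) y \<le> b" by (simp add: dist_norm)
    qed
    then have "{t \<in> space M. dist (g t) y \<le> b}
        = {t \<in> space M. \<forall>i. blinfun_apply (g t) (x i) - blinfun_apply y (x i) \<le> b}" by blast
    also have "\<dots> \<in> sets M" by measurable
    finally show "{t \<in> space M. dist (g t) y \<le> b} \<in> sets M" .
  qed
  have gB: "Bochner_measurable M g"
  proof (rule Bochner_measurable_Pettis)
    show "g t \<in> closure (range s)" for t using gS by (simp add: S_def)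
    show "(\<lambda>t. dist (g t) (s i)) \<in> borel_measurable M" for i
      by (rule dist_meas) (auto simp: S_def intro: subsetD[OF closure_subset])
  qed
  have [measurable]: "(\<lambda>t. norm (g t)) \<in> borel_measurable M"
    using gB by (rule borel_measurable_norm_Bochner)
  have "AE t in M. ennreal (norm (g t) powr q) \<le> llim t"
    using lim llim_fin
  proof eventually_elim
    case (elim t)
    define L where "L = enn2real (llim t)"
    have L: "llim t = ennreal L" "L \<ge> 0"
      using elim(2) by (auto simp: L_def less_top)
    \<comment> \<open>Convergence is known only at the \<open>x i\<close>, so the lower limit of the
      norms first bounds each scalar value; norming by the \<open>x i\<close> then carries the bound
      over to \<open>norm (g t)\<close>.\<close>
    have "\<bar>blinfun_apply (g t) (x i)\<bar> powr q \<le> L" for i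
    proof -
      have "(\<lambda>k. ennreal (\<bar>blinfun_apply (approx (r k) t) (x i)\<bar> powr q)) \<longlonglongrightarrow> ennreal (\<bar>blinfun_apply (g t) (x i)\<bar> powr q)"
        using elim(1) q by (intro tendsto_ennrealI tendsto_powr' tendsto_rabs tendsto_const) auto
      then have "ennreal (\<bar>blinfun_apply (g t) (x i)\<bar> powr q) = liminf (\<lambda>k. ennreal (\<bar>blinfun_apply (approx (r k) t) (x i)\<bar> powr q))"
        by (intro lim_imp_Liminf[symmetric]) auto
      also have "\<dots> \<le> llim t"
        unfolding llim_def
      proof (intro Liminf_mono always_eventually allI ennreal_leI powr_mono2)
        show "\<bar>blinfun_apply (approx (r k) t) (x i)\<bar> \<le> norm (approx (r k) t)" for k
          using norm_blinfun[of "approx (r k) t" "x i"] x[of i]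
            mult_left_le[of "norm (x i)" "norm (approx (r k) t)"] by simp
      qed (use q in auto)
      finally show ?thesis using L by simp
    qed
    then have "(\<bar>blinfun_apply (g t) (x i)\<bar> powr q) powr (1 / q) \<le> L powr (1 / q)" for i
      using q by (intro powr_mono2) auto
    then have "\<bar>blinfun_apply (g t) (x i)\<bar> \<le> L powr (1 / q)" for i
      using q by (simp add: powr_powr)
    then have "norm (g t) \<le> L powr (1 / q)"
      by (intro norming gS) (auto dest: abs_le_D1)
    then have "norm (g t) powr q \<le> (L powr (1 / q)) powr q"
      using q by (intro powr_mono2) auto
    then show ?case using q L by (simp add: powr_powr ennreal_leI)
  qed
  then have "(\<integral>\<^sup>+t. ennreal (norm (g t) powr q) \<partial>M) \<le> (\<integral>\<^sup>+t. llim t \<partial>M)"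
    by (rule nn_integral_mono_AE)
  also note llim_int
  finally have "integrable M (\<lambda>t. norm (g t) powr q)"
    by (intro integrableI_bounded) (auto simp: le_less_trans)
  with gB have "g \<in> Lp_functions M q"
    by (simp add: Lp_functions_def)
  moreover have "\<forall>y\<in>S. \<forall>b. (\<forall>i. blinfun_apply y (x i) \<le> b) \<longrightarrow> norm y \<le> b"
    using norming by blast
  ultimately show ?thesis
    using that[OF S dens r _ gS _ lim] by blast
qed

end

context reflexive_Lp_functional
begin

text \<open>The identity is extended in three stages: for cells and the vectors \<open>x i\<close>
  by convergence in \<open>L^1\<close>, for cells and all vectors because the error is a functional
  in \<open>S\<close> that vanishes at the \<open>x i\<close>, and for all functions because a
  bounded functional that vanishes on cells is 0.\<close>

lemma Riesz_representation:
  "\<exists>g :: 't \<Rightarrow> 'a \<Rightarrow>\<^sub>L real. g \<in> Lp_functions M q \<and>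
     (\<forall>f\<in>Lp_functions M p. \<phi> f = (LINT t|M. blinfun_apply (g t) (f t)))"
proof -
  obtain S and r :: "nat \<Rightarrow> nat" and x :: "nat \<Rightarrow> 'a" and g :: "'t \<Rightarrow> 'a \<Rightarrow>\<^sub>L real"
    where S: "subspace S" "closed S" and dens: "\<And>n k. cell_density n k \<in> S" and r: "strict_mono r"
      and norming: "\<forall>y\<in>S. \<forall>b. (\<forall>i. blinfun_apply y (x i) \<le> b) \<longrightarrow> norm y \<le> b"
      and gS: "\<And>t. g t \<in> S" and g: "g \<in> Lp_functions M q"
      and lim: "AE t in M. \<forall>i. (\<lambda>k. blinfun_apply (approx (r k) t) (x i)) \<longlonglongrightarrow> blinfun_apply (g t) (x i)"
    by (rule Lq_limit, rule that) assumption+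
  note pairing = Lp_pairing[OF p q _ g]
  have ind_apply: "blinfun_apply (g t) (ind A y t) = indicator A t * blinfun_apply (g t) y" for A y t
    by (simp add: ind_def blinfun.scaleR_right)
  have ig: "integrable M (\<lambda>t. indicator A t * blinfun_apply (g t) y)" if "A \<in> sets M" for A y
    using pairing(2)[OF ind_Lp[OF that, of y]] by (simp add: ind_apply)
  have iapply: "integrable M (\<lambda>t. blinfun_apply (g t) y)" for y
    using ig[OF sets.top, of y] by (subst Bochner_Integration.integrable_cong[OF refl]) auto
  have cell_x: "(LINT t|M. indicator (cell n k) t * blinfun_apply (g t) (x i)) = \<phi> (ind (cell n k) (x i))" for n k i
  proof -
    define h where "h t = blinfun_apply (g t) (x i)" for t
    define s where "s j t = blinfun_apply (approx (r j) t) (x i)" for j t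
    have gB: "Bochner_measurable M g" and gi: "integrable M (\<lambda>t. norm (g t) powr q)"
      using g by (simp_all add: Lp_functions_def)
    have h[measurable]: "h \<in> borel_measurable M"
      unfolding h_def using iapply by (rule borel_measurable_integrable)
    have sF: "integrable M (\<lambda>t. F (s j t) :: real)" for F j
      unfolding s_def using approx_integrable[of "\<lambda>y. F (blinfun_apply y (x i))"] by simp
    have s[measurable]: "s j \<in> borel_measurable M" for j
      using sF[of "\<lambda>x. x" j] by (rule borel_measurable_integrable)
    have le: "\<bar>blinfun_apply y (x i)\<bar> powr q \<le> norm (x i) powr q * norm y powr q" for y :: "'a \<Rightarrow>\<^sub>L real"
    proof -
      have "\<bar>blinfun_apply y (x i)\<bar> powr q \<le> (norm (x i) * norm y) powr q"
        using q norm_blinfun[of y "x i"] by (intro powr_mono2) (auto simp: mult.commute)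
      then show ?thesis by (simp add: powr_mult)
    qed
    have L1: "(\<lambda>j. LINT t|M. \<bar>s j t - h t\<bar>) \<longlonglongrightarrow> 0"
    proof (rule Lp_bounded_AE_LIMSEQ_imp_L1[OF q(1) s h])
      show "integrable M (\<lambda>t. \<bar>s j t\<bar> powr q)" for j
        by (rule sF)
      show "integrable M (\<lambda>t. \<bar>h t\<bar> powr q)"
      proof (rule Bochner_Integration.integrable_bound)
        show "integrable M (\<lambda>t. norm (x i) powr q * norm (g t) powr q)"
          using gi by simp
        show "AE t in M. norm (\<bar>h t\<bar> powr q) \<le> norm (norm (x i) powr q * norm (g t) powr q)"
          using le by (intro AE_I2) (simp add: h_def)
      qed simp
      show "(LINT t|M. \<bar>s j t\<bar> powr q) \<le> norm (x i) powr q * (2 * K) powr q" for j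
      proof -
        have "(LINT t|M. \<bar>s j t\<bar> powr q) \<le> (LINT t|M. norm (x i) powr q * norm (approx (r j) t) powr q)"
        proof (rule integral_mono)
          show "integrable M (\<lambda>t. \<bar>s j t\<bar> powr q)"
            by (rule sF)
          show "integrable M (\<lambda>t. norm (x i) powr q * norm (approx (r j) t) powr q)"
            by (rule approx_integrable)
          show "\<bar>s j t\<bar> powr q \<le> norm (x i) powr q * norm (approx (r j) t) powr q" for t
            using le by (simp add: s_def)
        qed
        also have "\<dots> \<le> norm (x i) powr q * (2 * K) powr q"
          using approx_bound[of "r j"] by (simp add: mult_left_mono)
        finally show ?thesis .
      qed
      show "AE t in M. (\<lambda>j. s j t) \<longlonglongrightarrow> h t"
        using lim by eventually_elim (simp add: s_def h_def)
    qed
    have isc: "integrable M (\<lambda>t. indicator (cell n k) t * s j t)" for j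
      using integrable_real_mult_indicator[OF sets_cell sF[of "\<lambda>x. x" j]] by (simp add: mult.commute)
    have ihc: "integrable M (\<lambda>t. indicator (cell n k) t * h t)"
      unfolding h_def by (rule ig[OF sets_cell])
    have "\<bar>\<phi> (ind (cell n k) (x i)) - (LINT t|M. indicator (cell n k) t * h t)\<bar> \<le> (LINT t|M. \<bar>s j t - h t\<bar>)"
      if "j \<ge> n" for j
    proof -
      have "n \<le> r j" using seq_suble[OF r, of j] that by linarith
      then have "\<phi> (ind (cell n k) (x i)) = (LINT t|M. indicator (cell n k) t * s j t)"
        unfolding s_def by (rule approx_cell[symmetric])
      then have "\<phi> (ind (cell n k) (x i)) - (LINT t|M. indicator (cell n k) t * h t)
          = (LINT t|M. indicator (cell n k) t * s j t - indicator (cell n k) t * h t)"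
        using isc ihc by simp
      also have "\<bar>\<dots>\<bar> \<le> (LINT t|M. \<bar>indicator (cell n k) t * s j t - indicator (cell n k) t * h t\<bar>)"
        by (rule integral_abs_bound)
      also have "\<dots> \<le> (LINT t|M. \<bar>s j t - h t\<bar>)"
      proof (rule integral_mono)
        show "integrable M (\<lambda>t. \<bar>s j t - h t\<bar>)"
          using sF[of "\<lambda>x. x" j] iapply[of "x i"] by (auto simp: h_def)
      qed (use isc ihc in \<open>auto simp: indicator_def\<close>)
      finally show ?thesis .
    qed
    then have "\<bar>\<phi> (ind (cell n k) (x i)) - (LINT t|M. indicator (cell n k) t * h t)\<bar> \<le> 0"
      by (intro LIMSEQ_le_const[OF L1]) blast
    then show ?thesis by (simp add: h_def)
  qed
  have cell_all: "(LINT t|M. indicator (cell n k) t * blinfun_apply (g t) y) = \<phi> (ind (cell n k) y)" for n k y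
  proof -
    define D where "D y = \<phi> (ind (cell n k) y) - (LINT t|M. indicator (cell n k) t * blinfun_apply (g t) y)" for y
    define B where "B = (K + Lp_norm M q g) * measure M (cell n k) powr (1 / p)"
    have "bounded_linear D"
    proof (rule bounded_linear_intro)
      show "D (y + z) = D y + D z" for y z
        using ig[OF sets_cell] by (simp add: D_def \<phi>_ind_linear[OF sets_cell] blinfun.add_right distrib_left)
      show "D (a *\<^sub>R y) = a *\<^sub>R D y" for a y
        by (simp add: D_def \<phi>_ind_linear[OF sets_cell] blinfun.scaleR_right mult.left_commute[of _ a] right_diff_distrib)
      show "norm (D y) \<le> norm y * B" for y
        using \<phi>_ind_bound[OF sets_cell, of n k y] pairing(3)[OF ind_Lp[OF sets_cell], of n k y]
          Lp_norm_indicator[OF sets_cell, of p n k y] p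
        by (simp add: D_def B_def ind_apply) (simp add: ind_def algebra_simps)
    qed
    then have D: "blinfun_apply (Blinfun D) y = D y" for y
      by (simp add: bounded_linear_Blinfun_apply)
    \<comment> \<open>Otherwise a separating functional would be evaluation at some \<open>z\<close>
      where all \<open>g t\<close> and all densities vanish. But then both terms of
      \<open>D z\<close> are 0. The integral of \<open>g\<close> over the cell is thus placed in
      \<open>S\<close> by testing it on vectors only.\<close>
    have "Blinfun D \<in> S"
    proof (rule ccontr)
      assume "Blinfun D \<notin> S"
      then obtain \<xi> :: "('a \<Rightarrow>\<^sub>L real) \<Rightarrow>\<^sub>L real"
        where \<xi>: "\<And>z. z \<in> S \<Longrightarrow> blinfun_apply \<xi> z = 0" "blinfun_apply \<xi> (Blinfun D) \<noteq> 0"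
        using separating_functional[OF S] by blast
      obtain z where z: "\<And>f. blinfun_apply \<xi> f = blinfun_apply f z"
        using reflexive by blast
      have "blinfun_apply (g t) z = 0" "blinfun_apply (cell_density n k) z = 0" for t n k
        using \<xi>(1)[OF gS] \<xi>(1)[OF dens] z by simp_all
      then have "D z = 0"
        by (simp add: D_def cell_density_measure[symmetric])
      then show False using \<xi>(2) z D by simp
    qed
    moreover have "blinfun_apply (Blinfun D) (x i) \<le> 0" for i
      unfolding D by (simp add: D_def cell_x)
    ultimately have "norm (Blinfun D) \<le> 0"
      using norming by blast
    then have "Blinfun D = 0" by simp
    then have "D y = 0" using D[of y] by (simp add: blinfun.zero_left)
    then show ?thesis by (simp add: D_def)
  qed
  define \<psi> where "\<psi> f = \<phi> f - (LINT t|M. blinfun_apply (g t) (f t))" for f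
  \<comment> \<open>The error is itself a bounded functional, Hoelder's inequality adding
    \<open>Lp_norm M q g\<close> to the constant, so \<open>vanishes\<close> applies to it.\<close>
  interpret \<psi>: Lp_functional M c p "K + Lp_norm M q g" \<psi>
  proof
    show "K + Lp_norm M q g \<ge> 0" using K by (simp add: Lp_norm_def)
    show "\<psi> (\<lambda>t. u t + v t) = \<psi> u + \<psi> v" if "u \<in> Lp_functions M p" "v \<in> Lp_functions M p" for u v
      using \<phi>_add[OF that] pairing(2)[OF that(1)] pairing(2)[OF that(2)] by (simp add: \<psi>_def blinfun.add_right)
    show "\<psi> (\<lambda>t. a *\<^sub>R v t) = a * \<psi> v" if "v \<in> Lp_functions M p" for a v
      using \<phi>_scale[OF that] by (simp add: \<psi>_def blinfun.scaleR_right right_diff_distrib)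
    show "\<bar>\<psi> v\<bar> \<le> (K + Lp_norm M q g) * Lp_norm M p v" if "v \<in> Lp_functions M p" for v
      using \<phi>_bound[OF that] pairing(3)[OF that] by (simp add: \<psi>_def distrib_right)
  qed (rule p)
  have "\<psi> f = 0" if "f \<in> Lp_functions M p" for f
  proof (rule \<psi>.vanishes[OF _ that])
    show "\<psi> (ind (cell n k) y) = 0" for n k y
      using cell_all[of n k y] by (simp add: \<psi>_def ind_apply)
  qed
  then have "\<forall>f\<in>Lp_functions M p. \<phi> f = (LINT t|M. blinfun_apply (g t) (f t))"
    by (simp add: \<psi>_def)
  with g show ?thesis by blast
qed

end

section \<open>Duality for normed spaces with explicit carriers\<close>

text \<open>The closure and homogeneity properties on which estimates with the dual norm rest. In
  particular \<open>vscale V 0 x\<close> has norm 0, so the supremum that defines the dual norm runs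
  over a nonempty set.\<close>

definition seminormed_space :: "'v normed_space \<Rightarrow> bool" where
  "seminormed_space V \<longleftrightarrow>
     (\<forall>x\<in>vecs V. \<forall>y\<in>vecs V. vadd V x y \<in> vecs V) \<and>
     (\<forall>c. \<forall>x\<in>vecs V. vscale V c x \<in> vecs V) \<and> vecs V \<noteq> {} \<and>
     (\<forall>x\<in>vecs V. 0 \<le> vnorm V x) \<and>
     (\<forall>c. \<forall>x\<in>vecs V. vnorm V (vscale V c x) = \<bar>c\<bar> * vnorm V x)"

lemma dual_space_simps:
  "vecs (dual_space V) = bounded_functionals V"
  "vadd (dual_space V) f g = (\<lambda>x\<in>vecs V. f x + g x)"
  "vscale (dual_space V) c f = (\<lambda>x\<in>vecs V. c * f x)"
  "vnorm (dual_space V) f = (SUP x\<in>{x \<in> vecs V. vnorm V x \<le> 1}. \<bar>f x\<bar>)"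
  by (simp_all add: dual_space_def)

text \<open>The absolute value around \<open>vnorm V x\<close> permits a nonnegative constant before
  the norm itself is known to be nonnegative.\<close>

lemma bounded_functionalsD:
  assumes "f \<in> bounded_functionals V"
  shows "f \<in> extensional (vecs V)"
    and "x \<in> vecs V \<Longrightarrow> y \<in> vecs V \<Longrightarrow> f (vadd V x y) = f x + f y"
    and "x \<in> vecs V \<Longrightarrow> f (vscale V c x) = c * f x"
    and "\<exists>K\<ge>0. \<forall>x\<in>vecs V. \<bar>f x\<bar> \<le> K * \<bar>vnorm V x\<bar>"
proof -
  obtain K where K: "\<And>x. x \<in> vecs V \<Longrightarrow> \<bar>f x\<bar> \<le> K * vnorm V x"
    using assms unfolding bounded_functionals_def by blast
  have "\<bar>f x\<bar> \<le> \<bar>K\<bar> * \<bar>vnorm V x\<bar>" if "x \<in> vecs V" for x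
    using K[OF that] abs_ge_self[of "K * vnorm V x"] by (simp add: abs_mult)
  then show "\<exists>K\<ge>0. \<forall>x\<in>vecs V. \<bar>f x\<bar> \<le> K * \<bar>vnorm V x\<bar>"
    by (intro exI[of _ "\<bar>K\<bar>"]) auto
qed (use assms in \<open>auto simp: bounded_functionals_def\<close>)

lemma bounded_functionalsI:
  assumes "f \<in> extensional (vecs V)"
    and "\<And>x y. x \<in> vecs V \<Longrightarrow> y \<in> vecs V \<Longrightarrow> f (vadd V x y) = f x + f y"
    and "\<And>x c. x \<in> vecs V \<Longrightarrow> f (vscale V c x) = c * f x"
    and "\<And>x. x \<in> vecs V \<Longrightarrow> \<bar>f x\<bar> \<le> K * vnorm V x"
  shows "f \<in> bounded_functionals V"
  using assms unfolding bounded_functionals_def by blast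

lemma dual_norm_bound:
  assumes V: "seminormed_space V" and f: "f \<in> bounded_functionals V"
  shows "0 \<le> vnorm (dual_space V) f" and "x \<in> vecs V \<Longrightarrow> \<bar>f x\<bar> \<le> vnorm (dual_space V) f * vnorm V x"
proof -
  obtain K where K: "K \<ge> 0" "\<And>x. x \<in> vecs V \<Longrightarrow> \<bar>f x\<bar> \<le> K * vnorm V x"
    using bounded_functionalsD(4)[OF f] V by (auto simp: seminormed_space_def)
  have bdd: "bdd_above ((\<lambda>x. \<bar>f x\<bar>) ` {x \<in> vecs V. vnorm V x \<le> 1})"
  proof (rule bdd_aboveI2)
    fix x assume "x \<in> {x \<in> vecs V. vnorm V x \<le> 1}"
    then show "\<bar>f x\<bar> \<le> K"
      using K(2)[of x] mult_left_le[OF _ K(1), of "vnorm V x"] by auto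
  qed
  have le: "\<bar>f x\<bar> \<le> vnorm (dual_space V) f" if "x \<in> vecs V" "vnorm V x \<le> 1" for x
    unfolding dual_space_simps by (rule cSUP_upper[OF _ bdd]) (use that in auto)
  obtain z where z: "z \<in> vecs V" using V by (auto simp: seminormed_space_def)
  then have z0: "vscale V 0 z \<in> vecs V" "vnorm V (vscale V 0 z) = 0"
    using V by (auto simp: seminormed_space_def)
  show "0 \<le> vnorm (dual_space V) f"
    using le[of "vscale V 0 z"] z0 by simp
  show "\<bar>f x\<bar> \<le> vnorm (dual_space V) f * vnorm V x" if x: "x \<in> vecs V"
  proof (cases "vnorm V x = 0")
    case True
    then show ?thesis using K(2)[OF x] by simp
  next
    case False
    then have pos: "vnorm V x > 0" using V x by (auto simp: seminormed_space_def less_le)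
    have "\<bar>f (vscale V (1 / vnorm V x) x)\<bar> \<le> vnorm (dual_space V) f"
      using V x pos by (intro le) (auto simp: seminormed_space_def)
    then show ?thesis
      using pos by (simp add: bounded_functionalsD(3)[OF f x] abs_mult field_simps)
  qed
qed

lemma dual_space_closed:
  assumes V: "seminormed_space V" and f: "f \<in> bounded_functionals V" and g: "g \<in> bounded_functionals V"
  shows "(\<lambda>x\<in>vecs V. f x + g x) \<in> bounded_functionals V"
    and "(\<lambda>x\<in>vecs V. c * f x) \<in> bounded_functionals V"
proof -
  have cl: "vadd V x y \<in> vecs V" "vscale V c x \<in> vecs V" if "x \<in> vecs V" "y \<in> vecs V" for x y c
    using V that by (auto simp: seminormed_space_def)
  note bf = dual_norm_bound(2)[OF V f] and bg = dual_norm_bound(2)[OF V g]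
  note Df = bounded_functionalsD[OF f] and Dg = bounded_functionalsD[OF g]
  show "(\<lambda>x\<in>vecs V. f x + g x) \<in> bounded_functionals V"
  proof (rule bounded_functionalsI)
    show "\<bar>(\<lambda>x\<in>vecs V. f x + g x) x\<bar> \<le> (vnorm (dual_space V) f + vnorm (dual_space V) g) * vnorm V x"
      if "x \<in> vecs V" for x
      using bf[OF that] bg[OF that] that by (simp add: distrib_right)
  qed (simp_all add: cl Df Dg distrib_left)
  show "(\<lambda>x\<in>vecs V. c * f x) \<in> bounded_functionals V"
  proof (rule bounded_functionalsI)
    show "\<bar>(\<lambda>x\<in>vecs V. c * f x) x\<bar> \<le> (\<bar>c\<bar> * vnorm (dual_space V) f) * vnorm V x"
      if "x \<in> vecs V" for x
      using mult_left_mono[OF bf[OF that], of "\<bar>c\<bar>"] that by (simp add: abs_mult mult_ac)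
  qed (simp_all add: cl Df distrib_left)
qed

lemma reflexive_spaceI:
  assumes V: "seminormed_space V"
    and surj: "\<And>\<Xi>. \<Xi> \<in> bounded_functionals (dual_space V) \<Longrightarrow> \<exists>x\<in>vecs V. \<forall>f\<in>bounded_functionals V. \<Xi> f = f x"
  shows "reflexive_space V"
  unfolding reflexive_space_def dual_space_simps
proof (intro equalityI subsetI)
  fix \<Xi> assume "\<Xi> \<in> canonical_embedding V ` vecs V"
  then obtain x where x: "x \<in> vecs V" and \<Xi>: "\<Xi> = canonical_embedding V x" by blast
  show "\<Xi> \<in> bounded_functionals (dual_space V)"
  proof (rule bounded_functionalsI)
    show "\<bar>\<Xi> f\<bar> \<le> vnorm V x * vnorm (dual_space V) f" if "f \<in> vecs (dual_space V)" for f
      using dual_norm_bound(2)[OF V _ x, of f] that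
      by (simp add: \<Xi> canonical_embedding_def dual_space_simps(1) mult.commute)
  qed (use x in \<open>simp_all add: \<Xi> canonical_embedding_def dual_space_simps(1-3) dual_space_closed[OF V]\<close>)
next
  fix \<Xi> assume \<Xi>: "\<Xi> \<in> bounded_functionals (dual_space V)"
  then obtain x where x: "x \<in> vecs V" "\<And>f. f \<in> bounded_functionals V \<Longrightarrow> \<Xi> f = f x"
    using surj by blast
  have "\<Xi> = canonical_embedding V x"
    using bounded_functionalsD(1)[OF \<Xi>] x
    by (intro extensionalityI[of _ "bounded_functionals V"]) (auto simp: canonical_embedding_def dual_space_simps(1))
  then show "\<Xi> \<in> canonical_embedding V ` vecs V" using x(1) by blast
qed

lemma reflexive_spaceD:
  assumes "reflexive_space V" and "\<Xi> \<in> bounded_functionals (dual_space V)"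
  shows "\<exists>x\<in>vecs V. \<forall>f\<in>bounded_functionals V. \<Xi> f = f x"
proof -
  obtain x where "x \<in> vecs V" "\<Xi> = canonical_embedding V x"
    using assms unfolding reflexive_space_def dual_space_simps by blast
  then show ?thesis
    by (intro bexI[of _ x]) (simp_all add: canonical_embedding_def dual_space_simps(1))
qed

text \<open>Composition with \<open>\<Phi>\<close> gives an isometry \<open>pull\<close> between the
  duals. A functional on the dual of \<open>V\<close> is transported along it to the dual of
  \<open>W\<close> and represented there by some \<open>\<Phi> x\<close>. Since \<open>pull\<close>
  is onto, with preimages built from the inverse of \<open>\<Phi>\<close>, the same \<open>x\<close>
  represents the original functional.\<close>

lemma reflexive_space_isometric:
  fixes V :: "'v normed_space" and W :: "'w normed_space"
  assumes V: "seminormed_space V" and W: "seminormed_space W"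
    and iso: "isometrically_isomorphic V W" and refl: "reflexive_space W"
  shows "reflexive_space V"
proof (rule reflexive_spaceI[OF V])
  fix \<Xi> assume \<Xi>: "\<Xi> \<in> bounded_functionals (dual_space V)"
  obtain \<Phi> where bij: "bij_betw \<Phi> (vecs V) (vecs W)"
      and add: "\<And>x y. x \<in> vecs V \<Longrightarrow> y \<in> vecs V \<Longrightarrow> \<Phi> (vadd V x y) = vadd W (\<Phi> x) (\<Phi> y)"
      and scale: "\<And>c x. x \<in> vecs V \<Longrightarrow> \<Phi> (vscale V c x) = vscale W c (\<Phi> x)"
      and norm: "\<And>x. x \<in> vecs V \<Longrightarrow> vnorm W (\<Phi> x) = vnorm V x"
    using iso unfolding isometrically_isomorphic_def by blast
  have \<Phi>W: "\<Phi> x \<in> vecs W" if "x \<in> vecs V" for x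
    using bij that by (auto dest: bij_betwE)
  have \<Phi>surj: "\<exists>x\<in>vecs V. y = \<Phi> x" if "y \<in> vecs W" for y
    using bij that by (auto simp: bij_betw_def)
  have cl: "vadd V x y \<in> vecs V" "vscale V c x \<in> vecs V" if "x \<in> vecs V" "y \<in> vecs V" for x y c
    using V that by (auto simp: seminormed_space_def)
  define \<Psi> where "\<Psi> x = inv_into (vecs V) \<Phi> x" for x
  have \<Psi>: "\<Psi> (\<Phi> x) = x" if "x \<in> vecs V" for x
    using bij that by (simp add: \<Psi>_def bij_betw_def inv_into_f_f)
  define pull where "pull g = (\<lambda>x\<in>vecs V. g (\<Phi> x))" for g :: "'w \<Rightarrow> real"
  have pull: "pull g \<in> bounded_functionals V" if g: "g \<in> bounded_functionals W" for g
  proof (rule bounded_functionalsI)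
    show "\<bar>pull g x\<bar> \<le> vnorm (dual_space W) g * vnorm V x" if "x \<in> vecs V" for x
      using dual_norm_bound(2)[OF W g \<Phi>W[OF that]] that by (simp add: pull_def norm)
  qed (simp_all add: pull_def cl add scale \<Phi>W bounded_functionalsD[OF g])
  have pull_norm: "vnorm (dual_space V) (pull g) = vnorm (dual_space W) g" for g
  proof -
    have "(\<lambda>x. \<bar>pull g x\<bar>) ` {x \<in> vecs V. vnorm V x \<le> 1} = (\<lambda>y. \<bar>g y\<bar>) ` {y \<in> vecs W. vnorm W y \<le> 1}"
    proof (intro equalityI subsetI)
      fix r assume "r \<in> (\<lambda>x. \<bar>pull g x\<bar>) ` {x \<in> vecs V. vnorm V x \<le> 1}"
      then obtain x where "x \<in> vecs V" "vnorm V x \<le> 1" "r = \<bar>pull g x\<bar>" by blast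
      then show "r \<in> (\<lambda>y. \<bar>g y\<bar>) ` {y \<in> vecs W. vnorm W y \<le> 1}"
        using \<Phi>W norm by (intro image_eqI[of _ _ "\<Phi> x"]) (auto simp: pull_def)
    next
      fix r assume "r \<in> (\<lambda>y. \<bar>g y\<bar>) ` {y \<in> vecs W. vnorm W y \<le> 1}"
      then obtain x where "x \<in> vecs V" "vnorm W (\<Phi> x) \<le> 1" "r = \<bar>g (\<Phi> x)\<bar>" using \<Phi>surj by blast
      then show "r \<in> (\<lambda>x. \<bar>pull g x\<bar>) ` {x \<in> vecs V. vnorm V x \<le> 1}"
        using norm by (intro image_eqI[of _ _ x]) (auto simp: pull_def)
    qed
    then show ?thesis by (simp add: dual_space_simps(4))
  qed
  obtain K where K: "\<And>f. f \<in> bounded_functionals V \<Longrightarrow> \<bar>\<Xi> f\<bar> \<le> K * vnorm (dual_space V) f"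
    using \<Xi> by (auto simp: bounded_functionals_def dual_space_simps(1))
  note D = bounded_functionalsD(2,3)[OF \<Xi>, unfolded dual_space_simps(1-3)]
  define \<Xi>' where "\<Xi>' = (\<lambda>g\<in>bounded_functionals W. \<Xi> (pull g))"
  have "\<Xi>' \<in> bounded_functionals (dual_space W)"
  proof (rule bounded_functionalsI, unfold dual_space_simps(1-3))
    show "\<Xi>' \<in> extensional (bounded_functionals W)" by (simp add: \<Xi>'_def)
    fix g h and a :: real assume g: "g \<in> bounded_functionals W"
    show "\<bar>\<Xi>' g\<bar> \<le> K * vnorm (dual_space W) g"
      using K[OF pull[OF g]] g by (simp add: \<Xi>'_def pull_norm)
    have "pull (\<lambda>x\<in>vecs W. a * g x) = (\<lambda>x\<in>vecs V. a * pull g x)"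
      by (auto simp: pull_def fun_eq_iff \<Phi>W)
    then show "\<Xi>' (\<lambda>x\<in>vecs W. a * g x) = a * \<Xi>' g"
      using g D(2)[OF pull[OF g], of a] by (simp add: \<Xi>'_def dual_space_closed[OF W g])
    assume h: "h \<in> bounded_functionals W"
    have "pull (\<lambda>x\<in>vecs W. g x + h x) = (\<lambda>x\<in>vecs V. pull g x + pull h x)"
      by (auto simp: pull_def fun_eq_iff \<Phi>W)
    then show "\<Xi>' (\<lambda>x\<in>vecs W. g x + h x) = \<Xi>' g + \<Xi>' h"
      using g h D(1)[OF pull[OF g] pull[OF h]] by (simp add: \<Xi>'_def dual_space_closed[OF W g h])
  qed
  from reflexive_spaceD[OF refl this] \<Phi>surj obtain x where x: "x \<in> vecs V"
      "\<And>g. g \<in> bounded_functionals W \<Longrightarrow> \<Xi>' g = g (\<Phi> x)" by metis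
  have "\<Xi> f = f x" if f: "f \<in> bounded_functionals V" for f
  proof -
    define g where "g = (\<lambda>y\<in>vecs W. f (\<Psi> y))"
    have g\<Phi>: "g (\<Phi> z) = f z" if "z \<in> vecs V" for z
      using that by (simp add: g_def \<Phi>W \<Psi>)
    have g: "g \<in> bounded_functionals W"
    proof (rule bounded_functionalsI)
      show "g \<in> extensional (vecs W)" by (simp add: g_def)
      fix y z and a :: real assume "y \<in> vecs W"
      then obtain u where u: "u \<in> vecs V" "y = \<Phi> u" using \<Phi>surj by blast
      show "g (vscale W a y) = a * g y"
        using u by (simp add: scale[symmetric] g\<Phi> cl bounded_functionalsD[OF f])
      show "\<bar>g y\<bar> \<le> vnorm (dual_space V) f * vnorm W y"
        using u dual_norm_bound(2)[OF V f u(1)] by (simp add: g\<Phi> norm)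
      assume "z \<in> vecs W"
      then obtain v where "v \<in> vecs V" "z = \<Phi> v" using \<Phi>surj by blast
      then show "g (vadd W y z) = g y + g z"
        using u by (simp add: add[symmetric] g\<Phi> cl bounded_functionalsD[OF f])
    qed
    have "pull g = f"
      using bounded_functionalsD(1)[OF f] by (auto simp: pull_def fun_eq_iff g\<Phi> extensional_def)
    then show ?thesis
      using x(2)[OF g] g g\<Phi>[OF x(1)] by (simp add: \<Xi>'_def)
  qed
  then show "\<exists>x\<in>vecs V. \<forall>f\<in>bounded_functionals V. \<Xi> f = f x"
    using x(1) by blast
qed

text \<open>The passage from extensional functionals on a carrier to the type of bounded linear
  maps, in which the representation is proved. \<open>Blinfun\<close> identifies the two duals and
  does not increase the norm, so \<open>\<xi>\<close> induces a bounded functional on the dual in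
  the carrier sense.\<close>

lemma reflexive_type_spaceD:
  fixes \<xi> :: "('a::real_normed_vector \<Rightarrow>\<^sub>L real) \<Rightarrow>\<^sub>L real"
  assumes "reflexive_space (type_space :: 'a normed_space)"
  shows "\<exists>x. \<forall>f. blinfun_apply \<xi> f = blinfun_apply f x"
proof -
  let ?V = "type_space :: 'a normed_space"
  have V: "seminormed_space ?V"
    by (auto simp: seminormed_space_def type_space_def)
  have ts: "vecs ?V = UNIV" "vadd ?V = (+)" "vscale ?V = (*\<^sub>R)" "vnorm ?V = norm"
    by (simp_all add: type_space_def)
  have lin: "bounded_linear f" if f: "f \<in> bounded_functionals ?V" for f
    using bounded_functionalsD(2,3)[OF f] dual_norm_bound(2)[OF V f]
    by (intro bounded_linear_intro[where K = "vnorm (dual_space ?V) f"]) (auto simp: ts mult.commute)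
  have app: "blinfun_apply (Blinfun f) x = f x" if "f \<in> bounded_functionals ?V" for f x
    using lin[OF that] by (simp add: bounded_linear_Blinfun_apply)
  define \<Xi> where "\<Xi> = (\<lambda>f\<in>bounded_functionals ?V. blinfun_apply \<xi> (Blinfun f))"
  have "\<Xi> \<in> bounded_functionals (dual_space ?V)"
  proof (rule bounded_functionalsI, unfold dual_space_simps(1-3))
    show "\<Xi> \<in> extensional (bounded_functionals ?V)" by (simp add: \<Xi>_def)
    fix f g and a :: real assume f: "f \<in> bounded_functionals ?V"
    have "norm (Blinfun f) \<le> vnorm (dual_space ?V) f"
      using dual_norm_bound[OF V f] by (intro norm_blinfun_bound) (simp_all add: app[OF f] ts)
    then have "norm \<xi> * norm (Blinfun f) \<le> norm \<xi> * vnorm (dual_space ?V) f"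
      by (rule mult_left_mono) simp
    then show "\<bar>\<Xi> f\<bar> \<le> norm \<xi> * vnorm (dual_space ?V) f"
      using norm_blinfun[of \<xi> "Blinfun f"] f by (simp add: \<Xi>_def)
    have "Blinfun (\<lambda>x\<in>vecs ?V. a * f x) = a *\<^sub>R Blinfun f"
      by (rule blinfun_eqI)
        (simp add: app[OF dual_space_closed(2)[OF V f f]] app[OF f] blinfun.scaleR_left, simp add: ts)
    then show "\<Xi> (\<lambda>x\<in>vecs ?V. a * f x) = a * \<Xi> f"
      using f by (simp add: \<Xi>_def dual_space_closed[OF V f f] blinfun.scaleR_right)
    assume g: "g \<in> bounded_functionals ?V"
    have "Blinfun (\<lambda>x\<in>vecs ?V. f x + g x) = Blinfun f + Blinfun g"
      by (rule blinfun_eqI)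
        (simp add: app[OF dual_space_closed(1)[OF V f g]] app[OF f] app[OF g] blinfun.add_left, simp add: ts)
    then show "\<Xi> (\<lambda>x\<in>vecs ?V. f x + g x) = \<Xi> f + \<Xi> g"
      using f g by (simp add: \<Xi>_def dual_space_closed[OF V f g] blinfun.add_right)
  qed
  from reflexive_spaceD[OF assms this] obtain x where x: "\<And>f. f \<in> bounded_functionals ?V \<Longrightarrow> \<Xi> f = f x"
    by blast
  have "blinfun_apply \<xi> f = blinfun_apply f x" for f
  proof -
    have f: "blinfun_apply f \<in> bounded_functionals ?V"
      using norm_blinfun[of f]
      by (intro bounded_functionalsI[where K = "norm f"])
        (auto simp: ts blinfun.add_right blinfun.scaleR_right extensional_def)
    show ?thesis using x[OF f] f by (simp add: \<Xi>_def blinfun_apply_inverse)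
  qed
  then show ?thesis by blast
qed

text \<open>Composing \<open>\<zeta>\<close> with the canonical embedding \<open>ev\<close> gives
  the representing functional; as every \<open>\<xi>\<close> is some \<open>ev x\<close>, agreement
  on the range of \<open>ev\<close> is enough. This is what admits the dual as value space in the
  representation.\<close>

lemma reflexive_dual:
  fixes \<zeta> :: "(('a::real_normed_vector \<Rightarrow>\<^sub>L real) \<Rightarrow>\<^sub>L real) \<Rightarrow>\<^sub>L real"
  assumes refl: "\<And>\<xi> :: ('a \<Rightarrow>\<^sub>L real) \<Rightarrow>\<^sub>L real. \<exists>x. \<forall>f. blinfun_apply \<xi> f = blinfun_apply f x"
  shows "\<exists>y. \<forall>\<xi>. blinfun_apply \<zeta> \<xi> = blinfun_apply \<xi> y"
proof -
  define ev :: "'a \<Rightarrow> ('a \<Rightarrow>\<^sub>L real) \<Rightarrow>\<^sub>L real" where "ev x = Blinfun (\<lambda>f. blinfun_apply f x)" for x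
  have ev: "blinfun_apply (ev x) f = blinfun_apply f x" for x f
    unfolding ev_def by (subst bounded_linear_Blinfun_apply) (auto intro: blinfun.bounded_linear_left)
  have ev_norm: "norm (ev x) \<le> norm x" for x
  proof (rule norm_blinfun_bound)
    show "norm (blinfun_apply (ev x) f) \<le> norm x * norm f" for f
      using norm_blinfun[of f x] by (simp add: ev mult.commute)
  qed simp
  have ev_lin: "ev (x + y) = ev x + ev y" "ev (a *\<^sub>R x) = a *\<^sub>R ev x" for x y a
    by (auto intro!: blinfun_eqI simp: ev blinfun.add_left blinfun.add_right blinfun.scaleR_left blinfun.scaleR_right)
  have "bounded_linear (\<lambda>x. blinfun_apply \<zeta> (ev x))"
  proof (rule bounded_linear_intro)
    show "norm (blinfun_apply \<zeta> (ev x)) \<le> norm x * norm \<zeta>" for x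
      using norm_blinfun[of \<zeta> "ev x"] mult_left_mono[OF ev_norm[of x] norm_ge_zero[of \<zeta>]]
      by (simp add: mult.commute)
  qed (simp_all add: ev_lin blinfun.add_right blinfun.scaleR_right)
  then have y: "blinfun_apply (Blinfun (\<lambda>x. blinfun_apply \<zeta> (ev x))) x = blinfun_apply \<zeta> (ev x)" for x
    by (simp add: bounded_linear_Blinfun_apply)
  have "blinfun_apply \<zeta> \<xi> = blinfun_apply \<xi> (Blinfun (\<lambda>x. blinfun_apply \<zeta> (ev x)))" for \<xi>
  proof -
    obtain x where x: "\<And>f. blinfun_apply \<xi> f = blinfun_apply f x" using refl by blast
    then have "\<xi> = ev x" by (intro blinfun_eqI) (simp add: ev)
    then show ?thesis using x y by simp
  qed
  then show ?thesis by blast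
qed

section \<open>The weighted Lebesgue--Bochner spaces\<close>

lemma equiv_wLp_ae_eq: "equiv (wLp_functions M w p) (wLp_ae_eq M w p)"
proof (rule equivI)
  show "wLp_ae_eq M w p \<subseteq> wLp_functions M w p \<times> wLp_functions M w p"
    by (auto simp: wLp_ae_eq_def)
  show "refl_on (wLp_functions M w p) (wLp_ae_eq M w p)"
    by (auto simp: refl_on_def wLp_ae_eq_def)
  show "sym (wLp_ae_eq M w p)"
    by (auto simp: sym_def wLp_ae_eq_def elim: eventually_mono)
  show "trans (wLp_ae_eq M w p)"
    unfolding trans_def wLp_ae_eq_def by (auto elim: eventually_elim2)
qed

definition wLp_class :: "'t measure \<Rightarrow> ('t \<Rightarrow> real) \<Rightarrow> real \<Rightarrow> ('t \<Rightarrow> 'a::real_normed_vector) \<Rightarrow> ('t \<Rightarrow> 'a) set" where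
  "wLp_class M w p u = wLp_ae_eq M w p `` {u}"

lemma wLp_class_eq_iff:
  assumes "u \<in> wLp_functions M w p" "v \<in> wLp_functions M w p"
  shows "wLp_class M w p u = wLp_class M w p v \<longleftrightarrow> (AE t in M. u t = v t)"
  using eq_equiv_class_iff[OF equiv_wLp_ae_eq assms] assms
  by (simp add: wLp_class_def wLp_ae_eq_def)

lemma mem_wLp_class:
  "v \<in> wLp_class M w p u \<longleftrightarrow> u \<in> wLp_functions M w p \<and> v \<in> wLp_functions M w p \<and> (AE t in M. u t = v t)"
  by (simp add: wLp_class_def wLp_ae_eq_def)

lemma vecs_wLp_space: "vecs (wLp_space M w p) = wLp_class M w p ` wLp_functions M w p"
  by (auto simp: wLp_space_def wLp_class_def quotient_def)

lemma vnorm_wLp_class: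
  assumes u: "u \<in> wLp_functions M w p"
  shows "vnorm (wLp_space M w p) (wLp_class M w p u) = (LINT t|M. w t * norm (u t) powr p) powr (1 / p)"
proof -
  have "(LINT t|M. w t * norm (v t) powr p) = (LINT t|M. w t * norm (u t) powr p)" if "v \<in> wLp_class M w p u" for v
  proof (rule integral_cong_AE)
    show "(\<lambda>t. w t * norm (v t) powr p) \<in> borel_measurable M" "(\<lambda>t. w t * norm (u t) powr p) \<in> borel_measurable M"
      using that u unfolding mem_wLp_class wLp_functions_def by (auto intro: borel_measurable_integrable)
    have "AE t in M. u t = v t" using that by (simp add: mem_wLp_class)
    then show "AE t in M. w t * norm (v t) powr p = w t * norm (u t) powr p"
      by eventually_elim simp
  qed
  then have "(\<lambda>v. (LINT t|M. w t * norm (v t) powr p) powr (1 / p)) ` wLp_class M w p u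
      = (\<lambda>v. (LINT t|M. w t * norm (u t) powr p) powr (1 / p)) ` wLp_class M w p u"
    by (intro image_cong refl) simp
  also have "\<dots> = {(LINT t|M. w t * norm (u t) powr p) powr (1 / p)}"
    using u by (intro image_constant[of u]) (simp add: mem_wLp_class)
  finally show ?thesis by (simp add: wLp_space_def)
qed

context complete_measure
begin

context
  fixes w :: "'a \<Rightarrow> real" and p :: real
  assumes w[measurable]: "w \<in> borel_measurable M" and w0: "AE t in M. 0 \<le> w t" and p0: "0 < p"
begin

text \<open>All sets in the double union coincide, because changing representatives alters the sum
  on a null set only, and the index sets are nonempty.\<close>

lemma vadd_wLp_class:
  assumes u: "u \<in> wLp_functions M w p" and v: "v \<in> wLp_functions M w p"
  shows "vadd (wLp_space M w p) (wLp_class M w p u) (wLp_class M w p v) = wLp_class M w p (\<lambda>t. u t + v t)"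
proof -
  have "wLp_class M w p (\<lambda>t. u' t + v' t) = wLp_class M w p (\<lambda>t. u t + v t)"
    if u': "u' \<in> wLp_class M w p u" and v': "v' \<in> wLp_class M w p v" for u' v'
  proof -
    have ae: "AE t in M. u t = u' t" "AE t in M. v t = v' t"
        and mem: "u' \<in> wLp_functions M w p" "v' \<in> wLp_functions M w p"
      using u' v' by (simp_all add: mem_wLp_class)
    from ae have "AE t in M. u' t + v' t = u t + v t"
      by eventually_elim simp
    then show ?thesis
      using wLp_class_eq_iff wLp_functions_add[OF w w0 less_imp_le[OF p0]] u v mem by blast
  qed
  then have "(\<Union>u'\<in>wLp_class M w p u. \<Union>v'\<in>wLp_class M w p v. wLp_class M w p (\<lambda>t. u' t + v' t))
      = (\<Union>u'\<in>wLp_class M w p u. \<Union>v'\<in>wLp_class M w p v. wLp_class M w p (\<lambda>t. u t + v t))"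
    by (intro SUP_cong refl)
  moreover have "u \<in> wLp_class M w p u" "v \<in> wLp_class M w p v"
    using u v by (simp_all add: mem_wLp_class)
  then have "wLp_class M w p u \<noteq> {}" "wLp_class M w p v \<noteq> {}"
    by blast+
  ultimately show ?thesis
    by (simp add: wLp_space_def wLp_class_def)
qed

lemma vscale_wLp_class:
  assumes u: "u \<in> wLp_functions M w p"
  shows "vscale (wLp_space M w p) a (wLp_class M w p u) = wLp_class M w p (\<lambda>t. a *\<^sub>R u t)"
proof -
  have "wLp_class M w p (\<lambda>t. a *\<^sub>R v t) = wLp_class M w p (\<lambda>t. a *\<^sub>R u t)" if v: "v \<in> wLp_class M w p u" for v
  proof -
    have ae: "AE t in M. u t = v t" and mem: "v \<in> wLp_functions M w p"
      using v by (simp_all add: mem_wLp_class)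
    from ae have "AE t in M. a *\<^sub>R v t = a *\<^sub>R u t"
      by eventually_elim simp
    then show ?thesis
      using wLp_class_eq_iff wLp_functions_scaleR u mem by blast
  qed
  then have "(\<Union>v\<in>wLp_class M w p u. wLp_class M w p (\<lambda>t. a *\<^sub>R v t))
      = (\<Union>v\<in>wLp_class M w p u. wLp_class M w p (\<lambda>t. a *\<^sub>R u t))"
    by (intro SUP_cong refl)
  moreover have "u \<in> wLp_class M w p u"
    using u by (simp add: mem_wLp_class)
  then have "wLp_class M w p u \<noteq> {}"
    by blast
  ultimately show ?thesis
    by (simp add: wLp_space_def wLp_class_def)
qed

lemma seminormed_wLp_space: "seminormed_space (wLp_space M w p :: ('a \<Rightarrow> 'b::real_normed_vector) set normed_space)"
  unfolding seminormed_space_def vecs_wLp_space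
proof (intro conjI ballI allI)
  fix A B :: "('a \<Rightarrow> 'b) set" and a :: real
  assume "A \<in> wLp_class M w p ` wLp_functions M w p"
  then obtain u where u: "u \<in> wLp_functions M w p" and A: "A = wLp_class M w p u" by blast
  show "vscale (wLp_space M w p) a A \<in> wLp_class M w p ` wLp_functions M w p"
    unfolding A vscale_wLp_class[OF u] by (intro imageI wLp_functions_scaleR u)
  show "0 \<le> vnorm (wLp_space M w p) A"
    unfolding A vnorm_wLp_class[OF u] by simp
  have "(LINT t|M. w t * norm (a *\<^sub>R u t) powr p) powr (1 / p)
      = (\<bar>a\<bar> powr p * (LINT t|M. w t * norm (u t) powr p)) powr (1 / p)"
    unfolding integral_norm_scaleR_powr ..
  also have "\<dots> = \<bar>a\<bar> * (LINT t|M. w t * norm (u t) powr p) powr (1 / p)"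
    using p0 w0 by (subst powr_mult) (auto simp: powr_powr intro!: integral_nonneg_AE elim: eventually_mono)
  finally show "vnorm (wLp_space M w p) (vscale (wLp_space M w p) a A) = \<bar>a\<bar> * vnorm (wLp_space M w p) A"
    unfolding A vscale_wLp_class[OF u] vnorm_wLp_class[OF u] vnorm_wLp_class[OF wLp_functions_scaleR[OF u]] .
  assume "B \<in> wLp_class M w p ` wLp_functions M w p"
  then obtain v where v: "v \<in> wLp_functions M w p" and B: "B = wLp_class M w p v" by blast
  show "vadd (wLp_space M w p) A B \<in> wLp_class M w p ` wLp_functions M w p"
    unfolding A B vadd_wLp_class[OF u v] by (intro imageI wLp_functions_add w w0 u v less_imp_le p0)
next
  have "(\<lambda>t. 0 :: 'b) \<in> wLp_functions M w p"
    by (simp add: wLp_functions_def Bochner_measurable_simple)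
  then show "wLp_class M w p ` (wLp_functions M w p :: ('a \<Rightarrow> 'b) set) \<noteq> {}" by blast
qed

end

end

section \<open>Reflexivity of the unweighted space\<close>

definition reflexive_point :: "(('a::real_normed_vector \<Rightarrow>\<^sub>L real) \<Rightarrow>\<^sub>L real) \<Rightarrow> 'a" where
  "reflexive_point \<xi> = (SOME x. \<forall>f. blinfun_apply \<xi> f = blinfun_apply f x)"

text \<open>By a norming functional, \<open>norm x\<close> is at most the norm of evaluation at
  \<open>x\<close>. Hence the inverse of the canonical embedding is a contraction, so that composing
  with it preserves strong measurability and \<open>p\<close>-integrability.\<close>

lemma
  fixes \<xi> \<zeta> :: "('a::real_normed_vector \<Rightarrow>\<^sub>L real) \<Rightarrow>\<^sub>L real"
  assumes refl: "\<And>\<xi> :: ('a \<Rightarrow>\<^sub>L real) \<Rightarrow>\<^sub>L real. \<exists>x. \<forall>f. blinfun_apply \<xi> f = blinfun_apply f x"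
  shows reflexive_point: "blinfun_apply f (reflexive_point \<xi>) = blinfun_apply \<xi> f"
    and norm_reflexive_point_diff: "norm (reflexive_point \<xi> - reflexive_point \<zeta>) \<le> norm (\<xi> - \<zeta>)"
    and norm_reflexive_point: "norm (reflexive_point \<xi>) \<le> norm \<xi>"
proof -
  have ap: "blinfun_apply f (reflexive_point \<xi>) = blinfun_apply \<xi> f" for f and \<xi> :: "('a \<Rightarrow>\<^sub>L real) \<Rightarrow>\<^sub>L real"
  proof -
    have "\<forall>f. blinfun_apply \<xi> f = blinfun_apply f (reflexive_point \<xi>)"
      unfolding reflexive_point_def by (rule someI_ex[OF refl])
    then show ?thesis by simp
  qed
  then show "blinfun_apply f (reflexive_point \<xi>) = blinfun_apply \<xi> f" .
  have le: "norm x \<le> norm \<omega>" if "\<And>f. blinfun_apply \<omega> f = blinfun_apply f x" for x and \<omega> :: "('a \<Rightarrow>\<^sub>L real) \<Rightarrow>\<^sub>L real"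
  proof -
    obtain L :: "'a \<Rightarrow>\<^sub>L real" where L: "norm L \<le> 1" "blinfun_apply L x = norm x"
      using norming_functional by blast
    have "norm x = blinfun_apply \<omega> L" using that L by simp
    also have "\<dots> \<le> norm \<omega> * norm L" using norm_blinfun[of \<omega> L] by simp
    also have "\<dots> \<le> norm \<omega>" using L by (simp add: mult_left_le)
    finally show ?thesis .
  qed
  show "norm (reflexive_point \<xi> - reflexive_point \<zeta>) \<le> norm (\<xi> - \<zeta>)"
    by (rule le) (simp add: ap blinfun.diff_left blinfun.diff_right)
  show "norm (reflexive_point \<xi>) \<le> norm \<xi>"
    by (rule le) (simp add: ap)
qed

context cell_filtration
begin

text \<open>The pairing \<open>F\<close> embeds \<open>L^q\<close> with values in the dual into the
  dual of \<open>L^p\<close>. The composite of \<open>\<Xi>\<close> with \<open>F\<close> is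
  represented by a function with values in the bidual, which \<open>reflexive_point\<close> turns
  into the sought element of \<open>L^p\<close>; surjectivity of \<open>F\<close> shows that it
  represents all of \<open>\<Xi>\<close>.\<close>

lemma reflexive_Lp_space:
  assumes pq: "p > 1" "q > 1" "1 / p + 1 / q = 1"
    and refl: "\<And>\<xi> :: ('a::real_normed_vector \<Rightarrow>\<^sub>L real) \<Rightarrow>\<^sub>L real. \<exists>x. \<forall>f. blinfun_apply \<xi> f = blinfun_apply f x"
  shows "reflexive_space (wLp_space M (\<lambda>_. 1) p :: ('t \<Rightarrow> 'a) set normed_space)"
proof -
  let ?V = "wLp_space M (\<lambda>_. 1) p :: ('t \<Rightarrow> 'a) set normed_space"
  define cls where "cls = (wLp_class M (\<lambda>_. 1) p :: ('t \<Rightarrow> 'a) \<Rightarrow> _)"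
  have p0: "0 < p" and qp: "1 / q + 1 / p = 1" using pq by auto
  have one: "(\<lambda>_. 1 :: real) \<in> borel_measurable M" "AE t in M. (0 :: real) \<le> 1" by auto
  have V: "seminormed_space ?V"
    by (rule seminormed_wLp_space[OF one p0])
  have vecs: "vecs ?V = cls ` Lp_functions M p"
    by (simp add: vecs_wLp_space wLp_functions_1 cls_def)
  have add: "vadd ?V (cls u) (cls v) = cls (\<lambda>t. u t + v t)"
    if "u \<in> Lp_functions M p" "v \<in> Lp_functions M p" for u v
    unfolding cls_def by (rule vadd_wLp_class[OF one p0]) (simp_all add: wLp_functions_1 that)
  have scale: "vscale ?V a (cls u) = cls (\<lambda>t. a *\<^sub>R u t)" if "u \<in> Lp_functions M p" for a u
    unfolding cls_def by (rule vscale_wLp_class[OF one p0]) (simp add: wLp_functions_1 that)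
  have norm: "vnorm ?V (cls u) = Lp_norm M p u" if "u \<in> Lp_functions M p" for u
    using vnorm_wLp_class[of u M "\<lambda>_. 1" p] that by (simp add: wLp_functions_1 cls_def Lp_norm_def)
  have addL: "(\<lambda>t. u t + v t) \<in> Lp_functions M p" if "u \<in> Lp_functions M p" "v \<in> Lp_functions M p" for u v :: "'t \<Rightarrow> 'a"
    using that p0 by (intro Lp_functions_add) auto
  define rep where "rep A = (SOME u. u \<in> A)" for A :: "('t \<Rightarrow> 'a) set"
  have rep: "AE t in M. u t = rep (cls u) t" "rep (cls u) \<in> Lp_functions M p" if "u \<in> Lp_functions M p" for u
  proof -
    have "u \<in> cls u" using that by (simp add: cls_def mem_wLp_class wLp_functions_1)
    then have "rep (cls u) \<in> cls u" unfolding rep_def by (rule someI[of "\<lambda>v. v \<in> cls u"])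
    then show "AE t in M. u t = rep (cls u) t" "rep (cls u) \<in> Lp_functions M p"
      by (simp_all add: cls_def mem_wLp_class wLp_functions_1)
  qed
  define F where "F g = (\<lambda>A\<in>vecs ?V. LINT t|M. blinfun_apply (g t) (rep A t))" for g :: "'t \<Rightarrow> 'a \<Rightarrow>\<^sub>L real"
  note pairing = Lp_pairing[OF pq]
  have F: "F g (cls u) = (LINT t|M. blinfun_apply (g t) (u t))"
    if u: "u \<in> Lp_functions M p" and g: "g \<in> Lp_functions M q" for u g
  proof -
    have "(LINT t|M. blinfun_apply (g t) (rep (cls u) t)) = (LINT t|M. blinfun_apply (g t) (u t))"
    proof (rule integral_cong_AE)
      show "AE t in M. blinfun_apply (g t) (rep (cls u) t) = blinfun_apply (g t) (u t)"
        using rep(1)[OF u] by eventually_elim simp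
    qed (rule borel_measurable_integrable[OF pairing(2)[OF rep(2)[OF u] g]],
         rule borel_measurable_integrable[OF pairing(2)[OF u g]])
    then show ?thesis using u by (simp add: F_def vecs)
  qed
  have F_ext: "F g \<in> extensional (vecs ?V)" for g by (simp add: F_def)
  have F_bounded: "F g \<in> bounded_functionals ?V" if g: "g \<in> Lp_functions M q" for g
  proof (rule bounded_functionalsI[OF F_ext])
    fix A B and a :: real assume "A \<in> vecs ?V"
    then obtain u where u: "u \<in> Lp_functions M p" and A: "A = cls u" by (auto simp: vecs)
    show "F g (vscale ?V a A) = a * F g A"
      using u by (simp add: A scale F[OF _ g] Lp_functions_scaleR blinfun.scaleR_right)
    show "\<bar>F g A\<bar> \<le> Lp_norm M q g * vnorm ?V A"
      using pairing(3)[OF u g] by (simp add: A F[OF u g] norm[OF u])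
    assume "B \<in> vecs ?V"
    then obtain v where v: "v \<in> Lp_functions M p" and B: "B = cls v" by (auto simp: vecs)
    show "F g (vadd ?V A B) = F g A + F g B"
      using pairing(2)[OF u g] pairing(2)[OF v g] by (simp add: A B add[OF u v] F[OF _ g] u v addL blinfun.add_right)
  qed
  \<comment> \<open>Hoelder's inequality, from which the bound on \<open>\<Xi> (F g)\<close> in
    terms of \<open>Lp_norm M q g\<close> results.\<close>
  have F_norm: "vnorm (dual_space ?V) (F g) \<le> Lp_norm M q g" if g: "g \<in> Lp_functions M q" for g
    unfolding dual_space_simps
  proof (rule cSUP_least)
    obtain A where "A \<in> vecs ?V" using V by (auto simp: seminormed_space_def)
    then have "vscale ?V 0 A \<in> {x \<in> vecs ?V. vnorm ?V x \<le> 1}"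
      using V by (auto simp: seminormed_space_def)
    then show "{x \<in> vecs ?V. vnorm ?V x \<le> 1} \<noteq> {}" by blast
    fix A assume A: "A \<in> {x \<in> vecs ?V. vnorm ?V x \<le> 1}"
    then obtain u where u: "u \<in> Lp_functions M p" "A = cls u" by (auto simp: vecs)
    have "\<bar>F g A\<bar> \<le> Lp_norm M q g * Lp_norm M p u"
      using pairing(3)[OF u(1) g] by (simp add: u F[OF u(1) g])
    also have "\<dots> \<le> Lp_norm M q g"
      using A u by (intro mult_left_le) (auto simp: norm Lp_norm_def)
    finally show "\<bar>F g A\<bar> \<le> Lp_norm M q g" .
  qed
  have F_eqI: "f = F g" if f: "f \<in> extensional (vecs ?V)" and g: "g \<in> Lp_functions M q"
    and eq: "\<And>u. u \<in> Lp_functions M p \<Longrightarrow> f (cls u) = (LINT t|M. blinfun_apply (g t) (u t))" for f g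
    using f F_ext by (rule extensionalityI) (auto simp: vecs eq F[OF _ g])
  have refl': "\<exists>x. \<forall>f. blinfun_apply \<xi> f = blinfun_apply f x" for \<xi> :: "(('a \<Rightarrow>\<^sub>L real) \<Rightarrow>\<^sub>L real) \<Rightarrow>\<^sub>L real"
    by (rule reflexive_dual[OF refl])
  show ?thesis
  proof (rule reflexive_spaceI[OF V])
    fix \<Xi> assume \<Xi>: "\<Xi> \<in> bounded_functionals (dual_space ?V)"
    obtain K where K: "K \<ge> 0" "\<And>f. f \<in> bounded_functionals ?V \<Longrightarrow> \<bar>\<Xi> f\<bar> \<le> K * vnorm (dual_space ?V) f"
      using bounded_functionalsD(4)[OF \<Xi>] dual_norm_bound(1)[OF V] by (auto simp: dual_space_simps(1))
    note D\<Xi> = bounded_functionalsD(2,3)[OF \<Xi>, unfolded dual_space_simps(1-3)]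
    \<comment> \<open>First use of the representation, with the exponents exchanged and the dual of
      \<open>X\<close> as value space; \<open>refl'\<close> is its reflexivity.\<close>
    interpret \<Psi>: reflexive_Lp_functional M c q K "\<lambda>g. \<Xi> (F g)" p
    proof
      show "\<Xi> (F (\<lambda>t. g t + h t)) = \<Xi> (F g) + \<Xi> (F h)"
        if g: "g \<in> Lp_functions M q" and h: "h \<in> Lp_functions M q" for g h
      proof -
        have gh: "(\<lambda>t. g t + h t) \<in> Lp_functions M q"
          using pq g h by (intro Lp_functions_add) auto
        have "(\<lambda>A\<in>vecs ?V. F g A + F h A) = F (\<lambda>t. g t + h t)"
          by (rule F_eqI[OF _ gh])
            (auto simp: vecs F g h blinfun.add_left pairing(2)[OF _ g] pairing(2)[OF _ h])
        then show ?thesis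
          using D\<Xi>(1)[OF F_bounded[OF g] F_bounded[OF h]] by simp
      qed
      show "\<Xi> (F (\<lambda>t. a *\<^sub>R g t)) = a * \<Xi> (F g)" if g: "g \<in> Lp_functions M q" for g a
      proof -
        have "(\<lambda>A\<in>vecs ?V. a * F g A) = F (\<lambda>t. a *\<^sub>R g t)"
          by (rule F_eqI[OF _ Lp_functions_scaleR[OF g]])
            (auto simp: vecs F g blinfun.scaleR_left pairing(2)[OF _ g])
        then show ?thesis
          using D\<Xi>(2)[OF F_bounded[OF g], of a] by simp
      qed
      show "\<bar>\<Xi> (F g)\<bar> \<le> K * Lp_norm M q g" if g: "g \<in> Lp_functions M q" for g
        using K(2)[OF F_bounded[OF g]] mult_left_mono[OF F_norm[OF g] K(1)] by linarith
    qed (use pq qp K(1) refl' in auto)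
    obtain h :: "'t \<Rightarrow> ('a \<Rightarrow>\<^sub>L real) \<Rightarrow>\<^sub>L real" where h: "h \<in> Lp_functions M p"
        and \<Xi>h: "\<And>g. g \<in> Lp_functions M q \<Longrightarrow> \<Xi> (F g) = (LINT t|M. blinfun_apply (h t) (g t))"
      using \<Psi>.Riesz_representation by blast
    define f where "f t = reflexive_point (h t)" for t
    have f_apply: "blinfun_apply l (f t) = blinfun_apply (h t) l" for l t
      unfolding f_def by (rule reflexive_point[OF refl])
    have f: "f \<in> Lp_functions M p"
    proof -
      have hB: "Bochner_measurable M h" and hi: "integrable M (\<lambda>t. norm (h t) powr p)"
        using h by (simp_all add: Lp_functions_def)
      have fB: "Bochner_measurable M f"
        unfolding f_def
      proof (rule Bochner_measurable_compose1[OF hB])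
        fix a and x :: "('a \<Rightarrow>\<^sub>L real) \<Rightarrow>\<^sub>L real" assume a: "a \<longlonglongrightarrow> x"
        have "(\<lambda>n. norm (a n - x)) \<longlonglongrightarrow> 0"
          using a by (simp add: LIM_zero tendsto_norm_zero)
        then have "(\<lambda>n. reflexive_point (a n) - reflexive_point x) \<longlonglongrightarrow> 0"
          by (rule Lim_null_comparison[rotated]) (simp add: norm_reflexive_point_diff[OF refl])
        then show "(\<lambda>n. reflexive_point (a n)) \<longlonglongrightarrow> reflexive_point x"
          by (rule LIM_zero_cancel)
      qed
      have "integrable M (\<lambda>t. 1 * norm (f t) powr p)"
      proof (rule integrable_powr_Bochner_bound[OF fB _ hi])
        show "AE t in M. \<bar>1 * norm (f t) powr p\<bar> \<le> norm (h t) powr p"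
          using norm_reflexive_point[OF refl] p0 by (intro AE_I2) (auto simp: f_def intro!: powr_mono2)
      qed simp
      then show ?thesis using fB by (simp add: Lp_functions_def)
    qed
    have "\<Xi> G = G (cls f)" if G: "G \<in> bounded_functionals ?V" for G
    proof -
      obtain L where L: "L \<ge> 0" "\<And>u. u \<in> Lp_functions M p \<Longrightarrow> \<bar>G (cls u)\<bar> \<le> L * Lp_norm M p u"
        using dual_norm_bound[OF V G] by (metis imageI norm vecs)
      have mem: "cls u \<in> vecs ?V" if "u \<in> Lp_functions M p" for u using that by (simp add: vecs)
      \<comment> \<open>Second use, with the original exponents: it exhibits \<open>G\<close> as
        some \<open>F g\<close>, where \<open>\<Xi>\<close> is already known.\<close>
      interpret G: reflexive_Lp_functional M c p L "\<lambda>u. G (cls u)" q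
      proof
        show "G (cls (\<lambda>t. u t + v t)) = G (cls u) + G (cls v)"
          if "u \<in> Lp_functions M p" "v \<in> Lp_functions M p" for u v
          using bounded_functionalsD(2)[OF G mem mem, of u v] that by (simp add: add)
        show "G (cls (\<lambda>t. a *\<^sub>R u t)) = a * G (cls u)" if "u \<in> Lp_functions M p" for u a
          using bounded_functionalsD(3)[OF G mem, of u a] that by (simp add: scale)
      qed (use pq L refl in auto)
      obtain g :: "'t \<Rightarrow> 'a \<Rightarrow>\<^sub>L real" where g: "g \<in> Lp_functions M q"
          and Gg: "\<And>u. u \<in> Lp_functions M p \<Longrightarrow> G (cls u) = (LINT t|M. blinfun_apply (g t) (u t))"
        using G.Riesz_representation by blast
      have "G = F g"
        using bounded_functionalsD(1)[OF G] g Gg by (rule F_eqI)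
      then have "\<Xi> G = (LINT t|M. blinfun_apply (h t) (g t))" using \<Xi>h[OF g] by simp
      also have "\<dots> = G (cls f)" using Gg[OF f] by (simp add: f_apply)
      finally show ?thesis .
    qed
    then show "\<exists>x\<in>vecs ?V. \<forall>f\<in>bounded_functionals ?V. \<Xi> f = f x"
      using f by (intro bexI[of _ "cls f"]) (auto simp: vecs)
  qed
qed

end

text \<open>The factors \<open>w t powr (1 / p)\<close> and \<open>w t powr (- 1 / p)\<close> are
  inverse to each other only where \<open>w t > 0\<close>. The two maps are therefore mutually
  inverse almost everywhere, and become a bijection on classes.\<close>

lemma (in complete_measure) wLp_space_isometric:
  assumes w[measurable]: "w \<in> borel_measurable M" and w0: "AE t in M. 0 < w t" and p: "0 < p"
  shows "isometrically_isomorphic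
    (wLp_space M w p :: ('a \<Rightarrow> 'b::real_normed_vector) set normed_space)
    (wLp_space M (\<lambda>_. 1) p :: ('a \<Rightarrow> 'b) set normed_space)"
proof -
  let ?V = "wLp_space M w p :: ('a \<Rightarrow> 'b) set normed_space"
  let ?W = "wLp_space M (\<lambda>_. 1) p :: ('a \<Rightarrow> 'b) set normed_space"
  let ?LV = "wLp_functions M w p :: ('a \<Rightarrow> 'b) set"
  let ?LW = "wLp_functions M (\<lambda>_. 1) p :: ('a \<Rightarrow> 'b) set"
  let ?cV = "wLp_class M w p :: ('a \<Rightarrow> 'b) \<Rightarrow> _"
  let ?cW = "wLp_class M (\<lambda>_. 1) p :: ('a \<Rightarrow> 'b) \<Rightarrow> _"
  have w_nn: "AE t in M. 0 \<le> w t" using w0 by eventually_elim simp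
  have one: "(\<lambda>_. 1 :: real) \<in> borel_measurable M" "AE t in M. (0 :: real) \<le> 1" by auto
  define to where "to u t = w t powr (1 / p) *\<^sub>R u t" for u :: "'a \<Rightarrow> 'b" and t
  define from' where "from' u t = w t powr (- 1 / p) *\<^sub>R u t" for u :: "'a \<Rightarrow> 'b" and t
  have B: "Bochner_measurable M (\<lambda>t. w t powr a *\<^sub>R u t)" if "Bochner_measurable M u" for a and u :: "'a \<Rightarrow> 'b"
    using that by (intro Bochner_measurable_scaleR Bochner_measurable_borel) auto
  have meas: "(\<lambda>t. v t * norm (u t) powr p) \<in> borel_measurable M"
    if "Bochner_measurable M u" "v \<in> borel_measurable M" for u :: "'a \<Rightarrow> 'b" and v
    using borel_measurable_norm_Bochner[OF that(1)] that(2) by measurable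
  have ae_to: "AE t in M. 1 * norm (to u t) powr p = w t * norm (u t) powr p" for u
    using w0 by eventually_elim (use p in \<open>simp add: to_def powr_mult powr_powr\<close>)
  have ae_from: "AE t in M. w t * norm (from' u t) powr p = 1 * norm (u t) powr p" for u
    using w0
  proof eventually_elim
    case (elim t)
    have "w t * norm (from' u t) powr p = (w t * w t powr - 1) * norm (u t) powr p"
      using p by (simp add: from'_def powr_mult powr_powr)
    then show ?case using elim by (simp add: powr_minus)
  qed
  have to: "to u \<in> ?LW" and to_norm: "(LINT t|M. 1 * norm (to u t) powr p) = (LINT t|M. w t * norm (u t) powr p)"
    if u: "u \<in> ?LV" for u
  proof -
    have uB: "Bochner_measurable M u" and ui: "integrable M (\<lambda>t. w t * norm (u t) powr p)"
      using u by (simp_all add: wLp_functions_def)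
    have tB: "Bochner_measurable M (to u)"
      unfolding to_def[abs_def] by (rule B[OF uB])
    have "integrable M (\<lambda>t. 1 * norm (to u t) powr p)"
      using integrable_cong_AE[OF meas[OF tB one(1)] meas[OF uB w] ae_to] ui by blast
    with tB show "to u \<in> ?LW" by (simp add: wLp_functions_def)
    show "(LINT t|M. 1 * norm (to u t) powr p) = (LINT t|M. w t * norm (u t) powr p)"
      by (rule integral_cong_AE[OF meas[OF tB one(1)] meas[OF uB w] ae_to])
  qed
  have from': "from' v \<in> ?LV" if v: "v \<in> ?LW" for v
  proof -
    have vB: "Bochner_measurable M v" and vi: "integrable M (\<lambda>t. 1 * norm (v t) powr p)"
      using v by (simp_all add: wLp_functions_def)
    have fB: "Bochner_measurable M (from' v)"
      unfolding from'_def[abs_def] by (rule B[OF vB])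
    have "integrable M (\<lambda>t. w t * norm (from' v t) powr p)"
      using integrable_cong_AE[OF meas[OF fB w] meas[OF vB one(1)] ae_from] vi by blast
    with fB show ?thesis by (simp add: wLp_functions_def)
  qed
  have to_from: "AE t in M. to (from' v) t = v t" for v
    using w0 by eventually_elim (simp add: to_def from'_def flip: powr_add)
  have to_cong: "(AE t in M. to u t = to v t) \<longleftrightarrow> (AE t in M. u t = v t)" for u v
  proof
    assume "AE t in M. to u t = to v t"
    then show "AE t in M. u t = v t"
      using w0 by eventually_elim (simp add: to_def)
  next
    assume "AE t in M. u t = v t"
    then show "AE t in M. to u t = to v t"
      by eventually_elim (simp add: to_def)
  qed
  define \<Phi> where "\<Phi> A = ?cW (to (SOME u. u \<in> A))" for A
  have \<Phi>: "\<Phi> (?cV u) = ?cW (to u)" if u: "u \<in> ?LV" for u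
  proof -
    define v where "v = (SOME v. v \<in> ?cV u)"
    have "u \<in> ?cV u" using u by (simp add: mem_wLp_class)
    then have "v \<in> ?cV u" unfolding v_def by (rule someI[of "\<lambda>v. v \<in> ?cV u"])
    then have v: "v \<in> ?LV" "AE t in M. u t = v t" by (simp_all add: mem_wLp_class)
    have "?cW (to u) = ?cW (to v)"
      using wLp_class_eq_iff[OF to[OF u] to[OF v(1)]] to_cong v(2) by blast
    then show ?thesis by (simp add: \<Phi>_def v_def)
  qed
  have to_add: "to (\<lambda>t. u t + v t) = (\<lambda>t. to u t + to v t)" for u v
    by (simp add: to_def fun_eq_iff scaleR_add_right)
  have to_scale: "to (\<lambda>t. a *\<^sub>R u t) = (\<lambda>t. a *\<^sub>R to u t)" for u a
    by (simp add: to_def fun_eq_iff mult.commute)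
  show ?thesis
    unfolding isometrically_isomorphic_def
  proof (intro exI[of _ \<Phi>] conjI ballI allI)
    show "bij_betw \<Phi> (vecs ?V) (vecs ?W)"
      unfolding bij_betw_def
    proof
      show "inj_on \<Phi> (vecs ?V)"
      proof (rule inj_onI)
        fix A B assume "A \<in> vecs ?V" "B \<in> vecs ?V" and eq: "\<Phi> A = \<Phi> B"
        then obtain u v where u: "u \<in> ?LV" "A = ?cV u" and v: "v \<in> ?LV" "B = ?cV v"
          unfolding vecs_wLp_space by blast
        then show "A = B"
          using eq wLp_class_eq_iff[OF to[OF u(1)] to[OF v(1)]] wLp_class_eq_iff[OF u(1) v(1)] to_cong
          by (simp add: \<Phi>)
      qed
      show "\<Phi> ` vecs ?V = vecs ?W"
      proof (intro equalityI subsetI)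
        fix B assume "B \<in> \<Phi> ` vecs ?V"
        then obtain u where "u \<in> ?LV" "B = \<Phi> (?cV u)" unfolding vecs_wLp_space by blast
        then show "B \<in> vecs ?W" unfolding vecs_wLp_space by (simp add: \<Phi> to)
      next
        fix B assume "B \<in> vecs ?W"
        then obtain v where v: "v \<in> ?LW" "B = ?cW v" unfolding vecs_wLp_space by blast
        then have "B = \<Phi> (?cV (from' v))"
          using wLp_class_eq_iff[OF to[OF from'[OF v(1)]] v(1)] to_from by (simp add: \<Phi>[OF from'[OF v(1)]])
        then show "B \<in> \<Phi> ` vecs ?V" unfolding vecs_wLp_space using from'[OF v(1)] by blast
      qed
    qed
  next
    fix A B and a :: real assume "A \<in> vecs ?V"
    then obtain u where u: "u \<in> ?LV" "A = ?cV u" unfolding vecs_wLp_space by blast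
    show "\<Phi> (vscale ?V a A) = vscale ?W a (\<Phi> A)"
      unfolding u(2) vscale_wLp_class[OF w w_nn p u(1)] \<Phi>[OF u(1)] \<Phi>[OF wLp_functions_scaleR[OF u(1)]]
        vscale_wLp_class[OF one p to[OF u(1)]] to_scale ..
    show "vnorm ?W (\<Phi> A) = vnorm ?V A"
      unfolding u(2) \<Phi>[OF u(1)] vnorm_wLp_class[OF u(1)] vnorm_wLp_class[OF to[OF u(1)]] to_norm[OF u(1)] ..
    assume "B \<in> vecs ?V"
    then obtain v where v: "v \<in> ?LV" "B = ?cV v" unfolding vecs_wLp_space by blast
    show "\<Phi> (vadd ?V A B) = vadd ?W (\<Phi> A) (\<Phi> B)"
      unfolding u(2) v(2) vadd_wLp_class[OF w w_nn p u(1) v(1)] \<Phi>[OF u(1)] \<Phi>[OF v(1)]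
        \<Phi>[OF wLp_functions_add[OF w w_nn less_imp_le[OF p] u(1) v(1)]]
        vadd_wLp_class[OF one p to[OF u(1)] to[OF v(1)]] to_add ..
  qed
qed

section \<open>The interval\<close>

lemma borel_measurable_lebesgue_on: "f \<in> borel \<rightarrow>\<^sub>M N \<Longrightarrow> f \<in> lebesgue_on S \<rightarrow>\<^sub>M N"
  by (intro measurable_restrict_space1 measurable_completion) simp

lemma AE_lebesgue_onI:
  assumes "S \<in> sets lebesgue" "N \<in> null_sets lborel" "\<And>t. t \<in> S \<Longrightarrow> t \<notin> N \<Longrightarrow> P t"
  shows "AE t in lebesgue_on S. P t"
proof -
  have "AE t in lebesgue. t \<notin> N"
    using assms(2) by (intro AE_not_in null_sets_completionI)
  then have "AE t in lebesgue. t \<in> S \<longrightarrow> P t"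
    by eventually_elim (use assms(3) in auto)
  then show ?thesis
    using assms(1) by (subst AE_restrict_space_iff) auto
qed

text \<open>The cells are dyadic intervals cut off at \<open>T\<close>, finitely many at each level
  because the interval is bounded; as \<open>t \<ge> 0\<close> on it, \<open>nat\<close> loses no
  information. Around a point of an open set a fine enough cell fits, so open sets are countable
  unions of cells, and the Borel sets follow.\<close>

lemma cell_filtration_interval:
  fixes T :: real
  assumes T: "T > 0"
  shows "cell_filtration (lebesgue_on {0..T}) (\<lambda>n t. nat \<lfloor>2 ^ n * t\<rfloor>)"
proof -
  define c where "c n t = nat \<lfloor>2 ^ n * t\<rfloor>" for n :: nat and t :: real
  define G where "G = {{t \<in> {0..T}. c n t = k} | n k. True}"
  have space: "space (lebesgue_on {0..T}) = {0..T}" by simp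
  have "cell_filtration (lebesgue_on {0..T}) c"
  proof (intro cell_filtration.intro finite_measureI complete_measure.intro cell_filtration_axioms.intro)
    show "emeasure (lebesgue_on {0..T}) (space (lebesgue_on {0..T})) \<noteq> \<infinity>"
      using T by (simp add: emeasure_restrict_space)
  next
    fix A B :: "real set" assume B: "B \<subseteq> A" "A \<in> null_sets (lebesgue_on {0..T})"
    then have A: "A \<in> null_sets lebesgue" "A \<subseteq> {0..T}"
      by (auto simp: null_sets_restrict_space)
    then have "B \<in> sets lebesgue"
      using B(1) completion.complete[of B A lborel] by blast
    then show "B \<in> sets (lebesgue_on {0..T})"
      using A B by (auto simp: sets_restrict_space)
  next
    fix n
    have "c n \<in> measurable (lebesgue_on {0..T}) (count_space UNIV)"
      unfolding c_def[abs_def] by (intro borel_measurable_lebesgue_on) measurable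
    moreover have "c n ` {0..T} \<subseteq> {..c n T}"
      by (auto simp: c_def intro!: nat_mono floor_mono)
    then have "finite (c n ` {0..T})" by (rule finite_subset) simp
    ultimately show "simple_function (lebesgue_on {0..T}) (c n)"
      by (simp add: simple_function_eq_measurable)
  next
    fix s t n
    assume st: "s \<in> space (lebesgue_on {0..T})" "t \<in> space (lebesgue_on {0..T})"
      and eq: "c (Suc n) s = c (Suc n) t"
    \<comment> \<open>Halving commutes with taking integer parts, so the label at level
      \<open>n\<close> is determined by the one at level \<open>Suc n\<close>.\<close>
    have "\<lfloor>2 ^ n * r\<rfloor> = \<lfloor>2 ^ Suc n * r\<rfloor> div 2" for r :: real
      using floor_divide_real_eq_div[of 2 "2 ^ Suc n * r"] by simp
    moreover have "\<lfloor>2 ^ Suc n * s\<rfloor> = \<lfloor>2 ^ Suc n * t\<rfloor>"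
      using eq st by (simp add: c_def eq_nat_nat_iff)
    ultimately show "c n s = c n t" by (simp add: c_def)
  next
    fix A assume "A \<in> sets (lebesgue_on {0..T})"
    then have A: "A \<in> sets lebesgue" "A \<subseteq> {0..T}"
      by (auto simp: sets_restrict_space)
    \<comment> \<open>A Lebesgue set is a Borel set \<open>S\<close> up to a null set, and only
      \<open>S\<close> has to be generated by the cells.\<close>
    obtain S N N' where SN: "A = S \<union> N" "N \<subseteq> N'" "N' \<in> null_sets lborel" "S \<in> sets lborel"
      using A(1) by (rule sets_completionE)
    have open_case: "U \<inter> {0..T} \<in> sigma_sets {0..T} G" if "open U" for U
    proof -
      define P where "P = {(n, k). {t \<in> {0..T}. c n t = k} \<subseteq> U}"
      have "U \<inter> {0..T} = (\<Union>(n, k)\<in>P. {t \<in> {0..T}. c n t = k})"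
      proof (intro equalityI subsetI)
        fix t assume t: "t \<in> U \<inter> {0..T}"
        then obtain e where e: "e > 0" "ball t e \<subseteq> U" using \<open>open U\<close> by (meson IntD1 open_contains_ball)
        obtain n where n: "(1 / 2) ^ n < e"
          using real_arch_pow_inv[of e "1 / 2"] e by auto
        have "s \<in> U" if s: "s \<in> {0..T}" "c n s = c n t" for s
        proof -
          have "\<lfloor>2 ^ n * s\<rfloor> = \<lfloor>2 ^ n * t\<rfloor>"
            using s t by (simp add: c_def eq_nat_nat_iff)
          then have "\<bar>2 ^ n * s - 2 ^ n * t\<bar> < 1" by linarith
          then have "2 ^ n * \<bar>s - t\<bar> < 1" by (simp add: abs_mult flip: right_diff_distrib)
          then have "\<bar>s - t\<bar> < (1 / 2) ^ n" by (simp add: field_simps power_divide)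
          then show ?thesis using n e by (auto simp: dist_real_def subset_eq)
        qed
        then have "(n, c n t) \<in> P" by (auto simp: P_def)
        then show "t \<in> (\<Union>(n, k)\<in>P. {t \<in> {0..T}. c n t = k})"
          using t by (intro UN_I[of "(n, c n t)"]) auto
      qed (auto simp: P_def)
      also have "\<dots> \<in> sigma_sets {0..T} G"
        by (rule sigma_sets_UNION) (auto simp: G_def intro: sigma_sets.Basic)
      finally show ?thesis .
    qed
    have "S \<in> sigma_sets UNIV {S. open S}"
      using SN(4) by (simp add: borel_def)
    then have "S \<inter> {0..T} \<in> sigma_sets {0..T} G"
    proof induction
      case (Basic a)
      then show ?case using open_case by simp
    next
      case Empty
      show ?case by (simp add: sigma_sets.Empty)
    next
      case (Compl a)
      have "(UNIV - a) \<inter> {0..T} = {0..T} - a \<inter> {0..T}" by blast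
      then show ?case using sigma_sets.Compl[OF Compl(2)] by simp
    next
      case (Union a)
      have "\<Union> (range a) \<inter> {0..T} = (\<Union>i. a i \<inter> {0..T})" by blast
      then show ?case using sigma_sets.Union[of "\<lambda>i. a i \<inter> {0..T}"] Union by simp
    qed
    moreover have "AE t in lebesgue_on {0..T}. t \<in> A \<longleftrightarrow> t \<in> S \<inter> {0..T}"
      by (rule AE_lebesgue_onI[OF _ SN(3)]) (use SN in auto)
    ultimately show "\<exists>B\<in>sigma_sets (space (lebesgue_on {0..T})) {{t \<in> space (lebesgue_on {0..T}). c n t = k} | n k. True}.
        AE t in lebesgue_on {0..T}. t \<in> A \<longleftrightarrow> t \<in> B"
      unfolding space G_def by blast
  qed
  then show ?thesis by (simp add: c_def[abs_def])
qed

theorem theorem29: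
  fixes T \<alpha> p :: real
  assumes "T > 0" and "0 < \<alpha>" and "\<alpha> \<le> 1" and "1 < p"
  shows "isometrically_isomorphic
           (Lp_alpha_space T \<alpha> p :: (real \<Rightarrow> 'a::banach) set normed_space)
           (Lp_space T p :: (real \<Rightarrow> 'a) set normed_space) \<and>
         (reflexive_space (type_space :: 'a normed_space) \<longrightarrow>
          reflexive_space (Lp_alpha_space T \<alpha> p :: (real \<Rightarrow> 'a) set normed_space))"
proof -
  interpret cell_filtration "lebesgue_on {0..T}" "\<lambda>n t. nat \<lfloor>2 ^ n * t\<rfloor>"
    by (rule cell_filtration_interval[OF assms(1)])
  define w where "w s = (T - s) powr (\<alpha> - 1) / Gamma \<alpha>" for s
  have p0: "0 < p" using assms by simp
  have w: "w \<in> borel_measurable (lebesgue_on {0..T})"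
    unfolding w_def by (intro borel_measurable_lebesgue_on) measurable
  \<comment> \<open>At the endpoint \<open>t = T\<close> the weight is 0, since
    \<open>0 powr (\<alpha> - 1) = 0\<close> by convention; positivity holds off this null
    set.\<close>
  have pos: "AE t in lebesgue_on {0..T}. 0 < w t"
    by (rule AE_lebesgue_onI[of _ "{T}"]) (use assms in \<open>auto simp: w_def Gamma_real_pos\<close>)
  then have nonneg: "AE t in lebesgue_on {0..T}. 0 \<le> w t"
    by eventually_elim simp
  have one: "(\<lambda>_. 1 :: real) \<in> borel_measurable (lebesgue_on {0..T})" "AE t in lebesgue_on {0..T}. (0 :: real) \<le> 1"
    by auto
  have iso: "isometrically_isomorphic (Lp_alpha_space T \<alpha> p :: (real \<Rightarrow> 'a) set normed_space)
      (Lp_space T p :: (real \<Rightarrow> 'a) set normed_space)"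
    unfolding Lp_alpha_space_def Lp_space_def w_def[symmetric]
    by (rule wLp_space_isometric[OF w pos p0])
  moreover have "reflexive_space (Lp_alpha_space T \<alpha> p :: (real \<Rightarrow> 'a) set normed_space)"
    if refl: "reflexive_space (type_space :: 'a normed_space)"
  proof (rule reflexive_space_isometric[OF _ _ iso])
    show "seminormed_space (Lp_alpha_space T \<alpha> p :: (real \<Rightarrow> 'a) set normed_space)"
      unfolding Lp_alpha_space_def w_def[symmetric] by (rule seminormed_wLp_space[OF w nonneg p0])
    show "seminormed_space (Lp_space T p :: (real \<Rightarrow> 'a) set normed_space)"
      unfolding Lp_space_def by (rule seminormed_wLp_space[OF one p0])
    define q where "q = p / (p - 1)"
    have "q > 1" "1 / p + 1 / q = 1"
      using assms by (simp_all add: q_def field_simps)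
    then show "reflexive_space (Lp_space T p :: (real \<Rightarrow> 'a) set normed_space)"
      unfolding Lp_space_def using assms(4) reflexive_type_spaceD[OF refl]
      by (intro reflexive_Lp_space)
  qed
  ultimately show ?thesis by blast
qed

end
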